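(* Let $X\subset\mathbb{R}^n$ be a locally closed set that is pure $d$-dimensional and locally definable in a polynomially bounded o-minimal structure on $\mathbb{R}$. Then, for a fixed nonnegative integer $k$, $X$ is a $C^{k+1,1}$ smooth submanifold of $\mathbb{R}^n$ if and only if $C_3(X)$ and $C_4(X)$ coincide linearly and the Nash mapping $\eta\colon\mathcal{N}(X)\to X$ is a homeomorphism such that $\eta^{-1}$ is $C^{k,\alpha}$ smooth for all $\alpha\in(0,1)$.
   Context: A structure on $\mathbb{R}$ is a family $\mathcal{S}=\{\mathcal{S}_m\}_{m\ge1}$, with each $\mathcal{S}_m$ a Boolean algebra of subsets of $\mathbb{R}^m$ containing all algebraic subsets, closed under Cartesian products and under the projections $\mathbb{R}^{m+1}\to\mathbb{R}^m$ onto the first $m$ coordinates; it is o-minimal if $\mathcal{S}_1$ consists exactly of finite unions of points and intervals. Elements of the $\mathcal{S}_m$ are called definable, and a map is definable if its graph is. The structure is polynomially bounded if for every definable $f\colon\mathbb{R}\to\mathbb{R}$ there is a positive integer $N$ with $|f(t)|\le t^N$ for all sufficiently large $t>0$. A set $X\subset\mathbb{R}^n$ is locally definable if every $x\in\overline{X}$ has a neighbourhood $U\subset\mathbb{R}^n$ with $X\cap U$ definable. $\mathrm{Sing}_1(X)$ is the set of $x\in X$ such that $X$ is not a $C^1$ submanifold around $x$. The Nash transformation $\mathcal{N}(X)$ is the closure in $X\times Gr_{\mathbb{R}}(d,n)$ of the graph of the Gauss mapping $x\mapsto T_xX$ on $X\setminus\mathrm{Sing}_1(X)$, where $Gr_{\mathbb{R}}(d,n)$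 is the Grassmannian of $d$-dimensional linear subspaces of $\mathbb{R}^n$; the Nash mapping $\eta\colon\mathcal{N}(X)\to X$ is the restriction of the projection onto the first factor. For $p\in X$: $C_3(X,p)$ is the set of $v\in\mathbb{R}^n$ for which there are $x_j\in X$ and $t_j>0$ with $t_j\to0$ and $\frac{1}{t_j}(x_j-p)\to v$; $C_4(X,p)$ is the union of all $d$-dimensional linear subspaces $T$ for which there is a sequence $x_j\in X\setminus\mathrm{Sing}_1(X)$ with $x_j\to p$ and $T_{x_j}X\to T$. We say that $C_3(X)$ and $C_4(X)$ coincide linearly if $C_3(X,p)=C_4(X,p)$ for every $p\in X$ such that $C_4(X,p)$ is a $d$-dimensional linear subspace. For $\alpha\in(0,1]$, a map between open subsets of $C^\infty$ manifolds is $C^{k,\alpha}$ smooth if in local charts it is $C^k$ and its partial derivatives of order $k$ are locally $\alpha$-Hölder (locally Lipschitz if $\alpha=1$); $C^{0,\alpha}$ smooth means locally $\alpha$-Hölder. If $A_1\subset M_1$ and $A_2\subset M_2$ are subsets of $C^\infty$ manifolds, a map $f\colon A_1\to A_2$ is $C^{k,\alpha}$ smooth if each $p\in A_1$ has an open neighbourhood $U\subset M_1$ and a $C^{k,\alpha}$ smooth map $F\colon U\to M_2$ with $F=f$ on $A_1\cap U$. Here $X\subset\mathbb{R}^n$ and $\mathcal{N}(X)\subset\mathbb{R}^n\times Gr_{\mathbb{R}}(d,n)$. A $C^{k+1,1}$ smooth submanifold is an embedded submanifold (without boundary) which is locally, after a linear change of coordinates, the graph of a $C^{k+1,1}$ smooth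 map from an open subset of $\mathbb{R}^d$ to $\mathbb{R}^{n-d}$. *)

theory Defs
  imports "HOL-Analysis.Analysis"
begin

section \<open>O-minimal structures\<close>

text \<open>
  The index \<open>m\<close> of a structure is a number and not a type, so points of \<open>R^m\<close> are
  represented here as real lists of length \<open>m\<close>.
\<close>

definition Rspace :: "nat \<Rightarrow> real list set" where
  "Rspace m = {xs. length xs = m}"

inductive poly_fun :: "nat \<Rightarrow> (real list \<Rightarrow> real) \<Rightarrow> bool" for m :: nat where
  const: "poly_fun m (\<lambda>xs. c)"
| coord: "i < m \<Longrightarrow> poly_fun m (\<lambda>xs. xs ! i)"
| add: "poly_fun m f \<Longrightarrow> poly_fun m g \<Longrightarrow> poly_fun m (\<lambda>xs. f xs + g xs)"
| mult: "poly_fun m f \<Longrightarrow> poly_fun m g \<Longrightarrow> poly_fun m (\<lambda>xs. f xs * g xs)"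

definition algebraic_set :: "nat \<Rightarrow> real list set \<Rightarrow> bool" where
  "algebraic_set m A \<longleftrightarrow>
     (\<exists>P. finite P \<and> (\<forall>f\<in>P. poly_fun m f) \<and> A = {xs \<in> Rspace m. \<forall>f\<in>P. f xs = 0})"

locale real_structure =
  fixes S :: "nat \<Rightarrow> real list set set"
  assumes boolean_algebra: "1 \<le> m \<Longrightarrow> algebra (Rspace m) (S m)"
    and algebraic: "1 \<le> m \<Longrightarrow> algebraic_set m A \<Longrightarrow> A \<in> S m"
    and product: "1 \<le> m \<Longrightarrow> 1 \<le> l \<Longrightarrow> A \<in> S m \<Longrightarrow> B \<in> S l \<Longrightarrow>
                    {xs @ ys | xs ys. xs \<in> A \<and> ys \<in> B} \<in> S (m + l)"
    and projection: "1 \<le> m \<Longrightarrow> A \<in> S (m + 1) \<Longrightarrow> butlast ` A \<in> S m"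

text \<open>In \<^term>\<open>is_interval\<close>, bounded, unbounded, open, closed and one-point intervals are all included.\<close>

locale o_minimal_structure = real_structure +
  assumes o_minimal:
    "S 1 = {(\<lambda>t. [t]) ` \<Union>\<I> | \<I> :: real set set. finite \<I> \<and> (\<forall>I\<in>\<I>. is_interval I)}"

locale polynomially_bounded_o_minimal = o_minimal_structure +
  assumes polynomially_bounded:
    "\<And>f :: real \<Rightarrow> real. range (\<lambda>t. [t, f t]) \<in> S 2 \<Longrightarrow>
       \<exists>N\<ge>1. eventually (\<lambda>t. \<bar>f t\<bar> \<le> t ^ N) at_top"

text \<open>
  \<open>definable_injection S e n A h\<close>: the map \<open>h\<close> is an injective definable map from \<open>R^e\<close> to the
  subset \<open>A\<close> of \<open>R^n\<close>. The o-minimal dimension of a nonempty definable set is the greatest \<open>e\<close>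
  for which there is such a map (as in Coste's introduction to o-minimal geometry); this is
  also the greatest dimension of a cell contained in \<open>A\<close>.
\<close>

definition definable_injection ::
    "(nat \<Rightarrow> real list set set) \<Rightarrow> nat \<Rightarrow> nat \<Rightarrow> real list set \<Rightarrow> (real list \<Rightarrow> real list) \<Rightarrow> bool" where
  "definable_injection S e n A h \<longleftrightarrow>
     {xs @ h xs | xs. xs \<in> Rspace e} \<in> S (e + n) \<and> h ` Rspace e \<subseteq> A \<and> inj_on h (Rspace e)"

definition has_omin_dim :: "(nat \<Rightarrow> real list set set) \<Rightarrow> nat \<Rightarrow> real list set \<Rightarrow> nat \<Rightarrow> bool" where
  "has_omin_dim S n A d \<longleftrightarrow>
     (\<exists>h. definable_injection S d n A h) \<and> (\<forall>e>d. \<nexists>h. definable_injection S e n A h)"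

subsection \<open>Definable sets in Euclidean space\<close>

text \<open>
  The coordinates of \<open>real^'n\<close> are listed in some fixed order. Structures are closed under
  permutations of the coordinates, so the choice of the order is immaterial.
\<close>

definition index_list :: "'n::finite list" where
  "index_list = (SOME js. distinct js \<and> set js = UNIV)"

definition coord_list :: "real^'n \<Rightarrow> real list" where
  "coord_list x = map (\<lambda>i. x $ i) index_list"

definition definable :: "(nat \<Rightarrow> real list set set) \<Rightarrow> (real^'n) set \<Rightarrow> bool" where
  "definable S A \<longleftrightarrow> coord_list ` A \<in> S CARD('n)"

definition locally_definable :: "(nat \<Rightarrow> real list set set) \<Rightarrow> (real^'n) set \<Rightarrow> bool" where
  "locally_definable S X \<longleftrightarrow> (\<forall>x\<in>closure X. \<exists>U. x \<in> interior U \<and> definable S (X \<inter> U))"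

text \<open>Pure dimension \<open>d\<close>: the local dimension is \<open>d\<close> at every point.\<close>

definition pure_dimensional :: "(nat \<Rightarrow> real list set set) \<Rightarrow> nat \<Rightarrow> (real^'n) set \<Rightarrow> bool" where
  "pure_dimensional S d X \<longleftrightarrow>
     (\<forall>x\<in>X. \<forall>U. open U \<and> x \<in> U \<and> definable S (X \<inter> U) \<longrightarrow>
        has_omin_dim S CARD('n) (coord_list ` (X \<inter> U)) d)"

definition locally_closed_set :: "'a::topological_space set \<Rightarrow> bool" where
  "locally_closed_set X \<longleftrightarrow> (\<exists>C U. closed C \<and> open U \<and> X = C \<inter> U)"

section \<open>Smoothness classes\<close>

text \<open>
  For a set \<open>I\<close> of indices, the coordinate subspace \<open>coord_space I\<close> of \<open>real^'n\<close> plays the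
  role of \<open>R^d\<close> with \<open>d = card I\<close>. Functions on open subsets of it are differentiated
  in the directions \<open>i \<in> I\<close> only; their values outside \<open>coord_space I\<close> do not matter.
\<close>

definition coord_space :: "'n set \<Rightarrow> (real^'n) set" where
  "coord_space I = {x. \<forall>i. i \<notin> I \<longrightarrow> x $ i = 0}"

definition partial_deriv :: "'n \<Rightarrow> (real^'n \<Rightarrow> 'b::real_normed_vector) \<Rightarrow> real^'n \<Rightarrow> 'b" where
  "partial_deriv i f x = vector_derivative (\<lambda>t. f (x + t *\<^sub>R axis i 1)) (at 0)"

definition partial_derivs :: "'n list \<Rightarrow> (real^'n \<Rightarrow> 'b::real_normed_vector) \<Rightarrow> real^'n \<Rightarrow> 'b" where
  "partial_derivs js f = foldr partial_deriv js f"

definition Ck_on :: "'n set \<Rightarrow> nat \<Rightarrow> (real^'n \<Rightarrow> 'b::real_normed_vector) \<Rightarrow> (real^'n) set \<Rightarrow> bool" where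
  "Ck_on I k f W \<longleftrightarrow>
     openin (top_of_set (coord_space I)) W \<and>
     (\<forall>js\<in>lists I. length js \<le> k \<longrightarrow> continuous_on W (partial_derivs js f)) \<and>
     (\<forall>js\<in>lists I. length js < k \<longrightarrow> (\<forall>i\<in>I. \<forall>x\<in>W.
        (\<lambda>t. partial_derivs js f (x + t *\<^sub>R axis i 1)) differentiable (at 0)))"

definition locally_holder_on ::
    "real \<Rightarrow> ('a::metric_space \<Rightarrow> 'b::metric_space) \<Rightarrow> 'a set \<Rightarrow> bool" where
  "locally_holder_on \<alpha> f W \<longleftrightarrow>
     (\<forall>p\<in>W. \<exists>V C. open V \<and> p \<in> V \<and>
        (\<forall>x\<in>V \<inter> W. \<forall>y\<in>V \<inter> W. dist (f x) (f y) \<le> C * dist x y powr \<alpha>))"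

definition Ck_holder_on ::
    "'n set \<Rightarrow> nat \<Rightarrow> real \<Rightarrow> (real^'n \<Rightarrow> 'b::real_normed_vector) \<Rightarrow> (real^'n) set \<Rightarrow> bool" where
  "Ck_holder_on I k \<alpha> f W \<longleftrightarrow>
     Ck_on I k f W \<and> (\<forall>js\<in>lists I. length js = k \<longrightarrow> locally_holder_on \<alpha> (partial_derivs js f) W)"

section \<open>Submanifolds\<close>

text \<open>
  \<open>graph_at R d X p\<close>: near \<open>p\<close>, after the linear change of coordinates \<open>L\<close>, the set \<open>X\<close> is the
  graph of a map \<open>g\<close> from an open subset \<open>W\<close> of \<open>R^d = coord_space I\<close> to
  \<open>R^(n-d) = coord_space (- I)\<close>, where \<open>g\<close> has the regularity prescribed by \<open>R\<close>.
\<close>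

definition graph_at ::
    "('n set \<Rightarrow> (real^'n \<Rightarrow> real^'n) \<Rightarrow> (real^'n) set \<Rightarrow> bool) \<Rightarrow> nat \<Rightarrow> (real^'n) set \<Rightarrow> real^'n \<Rightarrow> bool" where
  "graph_at R d X p \<longleftrightarrow>
     (\<exists>U L I W g. open U \<and> p \<in> U \<and> linear L \<and> bij L \<and> card I = d \<and>
        openin (top_of_set (coord_space I)) W \<and> R I g W \<and> g ` W \<subseteq> coord_space (- I) \<and>
        L ` (X \<inter> U) = (\<lambda>x. x + g x) ` W)"

definition Ck_holder_submanifold :: "nat \<Rightarrow> real \<Rightarrow> nat \<Rightarrow> (real^'n) set \<Rightarrow> bool" where
  "Ck_holder_submanifold k \<alpha> d X \<longleftrightarrow> (\<forall>p\<in>X. graph_at (\<lambda>I. Ck_holder_on I k \<alpha>) d X p)"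

definition Sing1 :: "(real^'n) set \<Rightarrow> (real^'n) set" where
  "Sing1 X = {x \<in> X. \<not> (\<exists>e. graph_at (\<lambda>I. Ck_on I 1) e X x)}"

text \<open>The velocity vectors of \<open>C^1\<close> curves in \<open>X\<close>; only used at points of \<open>X - Sing1 X\<close>.\<close>

definition tangent_space :: "(real^'n) set \<Rightarrow> real^'n \<Rightarrow> (real^'n) set" where
  "tangent_space X x =
     {v. \<exists>\<gamma> \<epsilon>. \<epsilon> > 0 \<and> \<gamma> C1_differentiable_on {-\<epsilon><..<\<epsilon>} \<and> \<gamma> ` {-\<epsilon><..<\<epsilon>} \<subseteq> X \<and>
        \<gamma> 0 = x \<and> (\<gamma> has_vector_derivative v) (at 0)}"

section \<open>The Grassmannian\<close>

definition Gr :: "nat \<Rightarrow> (real^'n) set set" where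
  "Gr d = {T. subspace T \<and> dim T = d}"

definition proj_matrix :: "(real^'n) set \<Rightarrow> real^'n^'n" where
  "proj_matrix T = (THE P. \<forall>x. P *v x \<in> T \<and> x - P *v x \<in> orthogonal_comp T)"

text \<open>The topology for which sending a subspace to its orthogonal projection is an embedding.\<close>

definition Gr_topology :: "nat \<Rightarrow> (real^'n) set topology" where
  "Gr_topology d = pullback_topology (Gr d) proj_matrix euclidean"

text \<open>
  The standard charts: \<open>Gr_chart T0\<close> is defined on the subspaces that are transverse to the
  orthogonal complement of \<open>T0\<close>. Such a subspace is the graph of a unique linear map from \<open>T0\<close>
  to this complement, which is extended by \<open>0\<close> on the complement to a matrix.
\<close>

definition Gr_chart_domain :: "(real^'n) set \<Rightarrow> (real^'n) set set" where
  "Gr_chart_domain T0 = {T \<in> Gr (dim T0). T \<inter> orthogonal_comp T0 = {0}}"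

definition Gr_chart :: "(real^'n) set \<Rightarrow> (real^'n) set \<Rightarrow> real^'n^'n" where
  "Gr_chart T0 T =
     (THE A. (\<forall>x\<in>T0. A *v x \<in> orthogonal_comp T0) \<and> (\<forall>y\<in>orthogonal_comp T0. A *v y = 0) \<and>
        T = {x + A *v x | x. x \<in> T0})"

text \<open>\<open>C^(k,\<alpha>)\<close> maps from an open subset of \<open>R^n\<close> to the manifold \<open>R^n \<times> Gr d\<close>, in local charts.\<close>

definition Ck_holder_into_Gr ::
    "nat \<Rightarrow> nat \<Rightarrow> real \<Rightarrow> (real^'n \<Rightarrow> (real^'n) \<times> (real^'n) set) \<Rightarrow> (real^'n) set \<Rightarrow> bool" where
  "Ck_holder_into_Gr d k \<alpha> F U \<longleftrightarrow>
     (\<forall>p\<in>U. \<exists>V T0. open V \<and> p \<in> V \<and> V \<subseteq> U \<and> T0 \<in> Gr d \<and> (\<forall>x\<in>V. snd (F x) \<in> Gr_chart_domain T0) \<and>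
        Ck_holder_on UNIV k \<alpha> (\<lambda>x. (fst (F x), Gr_chart T0 (snd (F x)))) V)"

definition Ck_holder_into_Gr_on_subset ::
    "nat \<Rightarrow> nat \<Rightarrow> real \<Rightarrow> (real^'n \<Rightarrow> (real^'n) \<times> (real^'n) set) \<Rightarrow> (real^'n) set \<Rightarrow> bool" where
  "Ck_holder_into_Gr_on_subset d k \<alpha> f A \<longleftrightarrow>
     (\<forall>p\<in>A. \<exists>U F. open U \<and> p \<in> U \<and> Ck_holder_into_Gr d k \<alpha> F U \<and> (\<forall>x\<in>A \<inter> U. F x = f x))"

section \<open>Nash transformation and tangent cones\<close>

definition nash_transformation :: "nat \<Rightarrow> (real^'n) set \<Rightarrow> ((real^'n) \<times> (real^'n) set) set" where
  "nash_transformation d X =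
     prod_topology (top_of_set X) (Gr_topology d)
       closure_of ((\<lambda>x. (x, tangent_space X x)) ` (X - Sing1 X))"

definition nash_topology :: "nat \<Rightarrow> (real^'n) set \<Rightarrow> ((real^'n) \<times> (real^'n) set) topology" where
  "nash_topology d X =
     subtopology (prod_topology (top_of_set X) (Gr_topology d)) (nash_transformation d X)"

definition nash_map :: "(real^'n) \<times> (real^'n) set \<Rightarrow> real^'n" where
  "nash_map = fst"

definition nash_inverse :: "nat \<Rightarrow> (real^'n) set \<Rightarrow> real^'n \<Rightarrow> (real^'n) \<times> (real^'n) set" where
  "nash_inverse d X = inv_into (nash_transformation d X) nash_map"

definition C3_cone :: "(real^'n) set \<Rightarrow> real^'n \<Rightarrow> (real^'n) set" where
  "C3_cone X p =
     {v. \<exists>x t. (\<forall>j::nat. x j \<in> X \<and> t j > 0) \<and> t \<longlonglongrightarrow> 0 \<and> (\<lambda>j. (1 / t j) *\<^sub>R (x j - p)) \<longlonglongrightarrow> v}"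

definition C4_cone :: "nat \<Rightarrow> (real^'n) set \<Rightarrow> real^'n \<Rightarrow> (real^'n) set" where
  "C4_cone d X p =
     \<Union>{T \<in> Gr d. \<exists>x. (\<forall>j::nat. x j \<in> X - Sing1 X) \<and> x \<longlonglongrightarrow> p \<and>
          limitin (Gr_topology d) (\<lambda>j. tangent_space X (x j)) T sequentially}"

definition C3_C4_coincide_linearly :: "nat \<Rightarrow> (real^'n) set \<Rightarrow> bool" where
  "C3_C4_coincide_linearly d X \<longleftrightarrow>
     (\<forall>p\<in>X. C4_cone d X p \<in> Gr d \<longrightarrow> C3_cone X p = C4_cone d X p)"

end

theory Submission
  imports Defs
begin

text \<open>
  If \<open>X\<close> is a submanifold, it is locally the image of a retraction \<open>G\<close> of constant rank, and both
  the tangent space and \<open>C\<^sub>3\<close> at \<open>q\<close> are the range of the derivative of \<open>G\<close> at \<open>q\<close>.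

  Conversely, the fibre of the Nash mapping over \<open>q\<close> is a single plane, which is \<open>C\<^sub>4\<close> and hence \<open>C\<^sub>3\<close>.
  Over the plane \<open>T0\<close> at \<open>p\<close> this plane is the graph of a matrix \<open>A q\<close>. Because \<open>C\<^sub>3\<close> is a plane transverse
  to the projection \<open>P\<close> onto \<open>T0\<close>, the restriction of \<open>P\<close> to \<open>X\<close> is open with discrete fibres. Two sheets over
  \<open>T0\<close> drift apart with speed \<open>norm (A x - A x')\<close>, which is at most a multiple of \<open>norm (x - x') powr \<alpha>\<close>; as they meet at
  \<open>p\<close> and \<open>\<alpha> < 1\<close> is arbitrary, their distance is flat at \<open>p\<close>, and by polynomial boundedness it vanishes.
  So \<open>X\<close> is locally the graph of a function, whose derivative is given by \<open>A\<close>, and it gains one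
  derivative by bootstrapping. Finally, the derivatives of highest order are definable and \<open>\<alpha>\<close>-Hoelder for all
  \<open>\<alpha> < 1\<close>, and polynomial boundedness makes them Lipschitz. Definability is only used in first-order form: no
  cell decomposition or monotonicity theorem is needed.
\<close>

section \<open>Definable predicates on Euclidean spaces\<close>

text \<open>The members of a structure are sets of lists, whereas the arguments quantify over
  points, pairs of points and real parameters. Definability is therefore phrased for predicates on
  arbitrary Euclidean types: a quantifier is a projection from a product type, and a first-order
  formula is certified rule by rule along its syntax. The obstacle on the way to a submanifold is
  that the ambient extension of the inverse Nash mapping depends on \<alpha> and need not be
  definable, so the Lipschitz bound cannot be reached there. The parametrization \<gamma> of
  \<open>X\<close> by its projection does not depend on \<alpha>; it inherits every class with
  \<open>\<alpha> < 1\<close> from the extensions, and its own definability then yields the bound.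
  It lives on an open cylinder of the whole space rather than on an open part of \<open>T0\<close>,
  so that one calculus on open sets serves both directions. Polynomial boundedness enters twice in
  the same shape: if a gap or a large difference quotient occurs at all, it occurs at a scale not
  smaller than a fixed power \<open>1 / s ^ N\<close>, and \<alpha> is chosen after
  \<open>N\<close>.\<close>

definition basis_list :: "'a::euclidean_space list" where
  "basis_list = (SOME bs. distinct bs \<and> set bs = Basis)"

lemma basis_list: "distinct (basis_list :: 'a::euclidean_space list)" "set (basis_list :: 'a list) = Basis"
proof -
  have "\<exists>bs :: 'a list. distinct bs \<and> set bs = Basis"
    using finite_distinct_list[OF finite_Basis] by blast
  then have "distinct (basis_list :: 'a list) \<and> set (basis_list :: 'a list) = Basis"
    unfolding basis_list_def by (rule someI_ex)
  then show "distinct (basis_list :: 'a list)" "set (basis_list :: 'a list) = Basis"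
    by blast+
qed

lemma length_basis_list [simp]: "length (basis_list :: 'a::euclidean_space list) = DIM('a)"
  using distinct_card[OF basis_list(1)] basis_list(2) by metis

lemma basis_list_nth_in [simp]: "i < DIM('a) \<Longrightarrow> (basis_list ! i :: 'a::euclidean_space) \<in> Basis"
  by (metis basis_list(2) length_basis_list nth_mem)

lemma Basis_nthE:
  assumes "b \<in> (Basis :: 'a::euclidean_space set)"
  obtains i where "i < DIM('a)" "b = basis_list ! i"
  using assms by (metis basis_list(2) in_set_conv_nth length_basis_list)

lemma sum_basis_list:
  "(\<Sum>b\<in>(Basis :: 'a::euclidean_space set). f b) = (\<Sum>i<DIM('a). f (basis_list ! i))"
proof -
  have "(\<Sum>b\<in>(Basis :: 'a set). f b) = sum_list (map f basis_list)"
    using basis_list by (metis sum_list_distinct_conv_sum_set)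
  then show ?thesis
    by (simp add: sum_list_sum_nth atLeast0LessThan)
qed

text \<open>The order of the basis is an arbitrary choice, and the order for a product type is
  unrelated to those of its factors. Passing from one order to another is a linear
  substitution.\<close>

definition coords :: "'a::euclidean_space \<Rightarrow> real list" where
  "coords x = map (\<lambda>b. x \<bullet> b) basis_list"

definition decode :: "real list \<Rightarrow> 'a::euclidean_space" where
  "decode xs = (\<Sum>i<DIM('a). xs ! i *\<^sub>R basis_list ! i)"

lemma length_coords [simp]: "length (coords (x :: 'a::euclidean_space)) = DIM('a)"
  by (simp add: coords_def)

lemma coords_nth: "i < DIM('a) \<Longrightarrow> coords (x :: 'a::euclidean_space) ! i = x \<bullet> basis_list ! i"
  by (simp add: coords_def)

lemma decode_coords [simp]: "decode (coords x) = (x :: 'a::euclidean_space)"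
proof -
  have "(decode (coords x) :: 'a) = (\<Sum>i<DIM('a). (x \<bullet> basis_list ! i) *\<^sub>R basis_list ! i)"
    unfolding decode_def by (intro sum.cong refl) (simp add: coords_nth)
  also have "\<dots> = (\<Sum>b\<in>Basis. (x \<bullet> b) *\<^sub>R b)"
    by (simp add: sum_basis_list)
  finally show ?thesis by (simp add: euclidean_representation)
qed

lemma decode_inner:
  "decode xs \<bullet> (y :: 'a::euclidean_space) = (\<Sum>i<DIM('a). xs ! i * (basis_list ! i \<bullet> y))"
  by (simp add: decode_def inner_sum_left)

lemma coords_decode [simp]:
  assumes "xs \<in> Rspace DIM('a)"
  shows "coords (decode xs :: 'a::euclidean_space) = xs"
proof (rule nth_equalityI)
  show "length (coords (decode xs :: 'a)) = length xs"
    using assms by (simp add: Rspace_def)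
next
  fix j assume "j < length (coords (decode xs :: 'a))"
  then have j: "j < DIM('a)" by simp
  have "coords (decode xs :: 'a) ! j = (\<Sum>i<DIM('a). xs ! i * (basis_list ! i \<bullet> (basis_list ! j :: 'a)))"
    using j by (simp add: coords_nth decode_inner)
  also have "\<dots> = (\<Sum>i<DIM('a). if i = j then xs ! i else 0)"
    using j by (intro sum.cong refl)
      (auto simp: inner_Basis nth_eq_iff_index_eq[OF basis_list(1)])
  also have "\<dots> = xs ! j" using j by simp
  finally show "coords (decode xs :: 'a) ! j = xs ! j" .
qed

lemma coords_in_Rspace [simp]: "coords (x :: 'a::euclidean_space) \<in> Rspace DIM('a)"
  by (simp add: Rspace_def)

subsection \<open>Polynomial functions\<close>

lemma poly_fun_mono: "poly_fun m f \<Longrightarrow> m \<le> n \<Longrightarrow> poly_fun n f"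
  by (induction rule: poly_fun.induct) (auto intro: poly_fun.intros)

lemma poly_fun_append: "poly_fun m f \<Longrightarrow> length xs = m \<Longrightarrow> f (xs @ ys) = f xs"
  by (induction rule: poly_fun.induct) (auto simp: nth_append)

lemma poly_fun_sum: "(\<And>i. i \<in> A \<Longrightarrow> poly_fun m (f i)) \<Longrightarrow> poly_fun m (\<lambda>xs. \<Sum>i\<in>A. f i xs)"
  by (induction A rule: infinite_finite_induct) (auto intro: poly_fun.intros)

lemma poly_fun_linear:
  "n \<le> m \<Longrightarrow> poly_fun m (\<lambda>xs. \<Sum>i<n. xs ! i * c i)"
  by (intro poly_fun_sum poly_fun.intros) auto

lemma poly_fun_linear_shift:
  "n + l \<le> m \<Longrightarrow> poly_fun m (\<lambda>xs. \<Sum>i<n. xs ! (l + i) * c i)"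
  by (intro poly_fun_sum poly_fun.intros) auto

lemma poly_fun_diff: "poly_fun m f \<Longrightarrow> poly_fun m g \<Longrightarrow> poly_fun m (\<lambda>xs. f xs - g xs)"
  using poly_fun.add[of m f "\<lambda>xs. (-1) * g xs"] poly_fun.mult[OF poly_fun.const[of m "-1"], of g]
  by simp

text \<open>Componentwise, because \<open>S_vimage\<close> takes a substitution in the form of one
  polynomial per target coordinate.\<close>

definition poly_map :: "('a::euclidean_space \<Rightarrow> 'b::euclidean_space) \<Rightarrow> bool" where
  "poly_map f \<longleftrightarrow> (\<forall>b\<in>Basis. \<exists>p. poly_fun DIM('a) p \<and> (\<forall>x. f x \<bullet> b = p (coords x)))"

lemma poly_mapI:
  fixes f :: "'a::euclidean_space \<Rightarrow> 'b::euclidean_space"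
  shows "(\<And>b. b \<in> Basis \<Longrightarrow> \<exists>p. poly_fun DIM('a) p \<and> (\<forall>x. f x \<bullet> b = p (coords x))) \<Longrightarrow> poly_map f"
  by (simp add: poly_map_def)

lemma poly_map_inner_ex:
  fixes f :: "'a::euclidean_space \<Rightarrow> 'b::euclidean_space"
  assumes "poly_map f"
  shows "\<exists>p. poly_fun DIM('a) p \<and> (\<forall>x. f x \<bullet> y = p (coords x))"
proof -
  obtain q where q: "\<And>b. b \<in> Basis \<Longrightarrow> poly_fun DIM('a) (q b)"
    "\<And>b x. b \<in> Basis \<Longrightarrow> f x \<bullet> b = q b (coords x)"
    using assms unfolding poly_map_def by metis
  have "f x \<bullet> y = (\<Sum>b\<in>Basis. q b (coords x) * (y \<bullet> b))" for x
    unfolding euclidean_inner[of "f x" y] by (intro sum.cong refl) (simp add: q)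
  moreover have "poly_fun DIM('a) (\<lambda>xs. \<Sum>b\<in>Basis. q b xs * (y \<bullet> b))"
    by (intro poly_fun_sum poly_fun.intros q)
  ultimately show ?thesis by blast
qed

lemma poly_map_linear_comp:
  fixes f :: "'a::euclidean_space \<Rightarrow> 'b::euclidean_space" and h :: "'b \<Rightarrow> 'c::euclidean_space"
  assumes "poly_map f" "linear h"
  shows "poly_map (\<lambda>x. h (f x))"
proof (rule poly_mapI)
  fix b :: 'c
  have "h (f x) \<bullet> b = f x \<bullet> adjoint h b" for x
    using adjoint_works[OF assms(2), of "f x" b] by simp
  then show "\<exists>p. poly_fun DIM('a) p \<and> (\<forall>x. h (f x) \<bullet> b = p (coords x))"
    using poly_map_inner_ex[OF assms(1), of "adjoint h b"] by simp
qed

lemma poly_map_id [intro]: "poly_map (\<lambda>x :: 'a::euclidean_space. x)"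
proof (rule poly_mapI)
  fix b :: 'a assume "b \<in> Basis"
  then obtain i where "i < DIM('a)" "b = basis_list ! i" by (rule Basis_nthE)
  then show "\<exists>p. poly_fun DIM('a) p \<and> (\<forall>x. x \<bullet> b = p (coords x))"
    by (intro exI[of _ "\<lambda>xs. xs ! i"]) (auto simp: coords_nth intro: poly_fun.intros)
qed

lemma poly_map_const [intro]: "poly_map (\<lambda>x. c)"
  by (rule poly_mapI) (auto intro: poly_fun.const)

lemma poly_map_add [intro]: "poly_map f \<Longrightarrow> poly_map g \<Longrightarrow> poly_map (\<lambda>x. f x + g x)"
  unfolding poly_map_def by (simp add: inner_add_left) (metis (no_types) poly_fun.add)

lemma poly_map_mult [intro]:
  fixes f g :: "'a::euclidean_space \<Rightarrow> real"
  shows "poly_map f \<Longrightarrow> poly_map g \<Longrightarrow> poly_map (\<lambda>x. f x * g x)"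
  unfolding poly_map_def by simp (metis (no_types) poly_fun.mult)

lemma poly_map_inner [intro]:
  fixes f g :: "'a::euclidean_space \<Rightarrow> 'b::euclidean_space"
  assumes f: "poly_map f" and g: "poly_map g"
  shows "poly_map (\<lambda>x. f x \<bullet> g x)"
proof (rule poly_mapI)
  fix b :: real assume "b \<in> Basis"
  obtain p where p: "\<And>b. b \<in> Basis \<Longrightarrow> poly_fun DIM('a) (p b)"
    "\<And>b x. b \<in> Basis \<Longrightarrow> f x \<bullet> b = p b (coords x)"
    using f unfolding poly_map_def by metis
  obtain q where q: "\<And>b. b \<in> Basis \<Longrightarrow> poly_fun DIM('a) (q b)"
    "\<And>b x. b \<in> Basis \<Longrightarrow> g x \<bullet> b = q b (coords x)"
    using g unfolding poly_map_def by metis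
  have "f x \<bullet> g x = (\<Sum>b\<in>Basis. p b (coords x) * q b (coords x))" for x
    unfolding euclidean_inner[of "f x" "g x"] by (intro sum.cong refl) (simp add: p q)
  moreover have "poly_fun DIM('a) (\<lambda>xs. \<Sum>b\<in>Basis. p b xs * q b xs)"
    by (intro poly_fun_sum poly_fun.intros p q)
  ultimately show "\<exists>p. poly_fun DIM('a) p \<and> (\<forall>x. (f x \<bullet> g x) \<bullet> b = p (coords x))"
    using \<open>b \<in> Basis\<close> by auto
qed

lemma poly_map_scaleR [intro]:
  fixes c :: "'a::euclidean_space \<Rightarrow> real" and f :: "'a \<Rightarrow> 'b::euclidean_space"
  assumes "poly_map c" "poly_map f"
  shows "poly_map (\<lambda>x. c x *\<^sub>R f x)"
proof (rule poly_mapI)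
  fix b :: 'b assume "b \<in> Basis"
  then obtain q where "poly_fun DIM('a) q" "\<And>x. f x \<bullet> b = q (coords x)"
    using assms(2) unfolding poly_map_def by metis
  moreover obtain p where "poly_fun DIM('a) p" "\<And>x. c x = p (coords x)"
    using assms(1) unfolding poly_map_def by auto
  ultimately show "\<exists>p. poly_fun DIM('a) p \<and> (\<forall>x. c x *\<^sub>R f x \<bullet> b = p (coords x))"
    by (intro exI[of _ "\<lambda>xs. p xs * q xs"]) (auto intro: poly_fun.mult)
qed

lemma poly_map_uminus [intro]: "poly_map f \<Longrightarrow> poly_map (\<lambda>x. - f x)"
  by (rule poly_map_linear_comp[OF _ bounded_linear.linear[OF bounded_linear_minus[OF bounded_linear_ident]]])

lemma poly_map_diff [intro]: "poly_map f \<Longrightarrow> poly_map g \<Longrightarrow> poly_map (\<lambda>x. f x - g x)"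
  using poly_map_add[of f "\<lambda>x. - g x"] poly_map_uminus[of g] by simp

lemma poly_map_fst [intro]: "poly_map f \<Longrightarrow> poly_map (\<lambda>x. fst (f x))"
  by (rule poly_map_linear_comp[OF _ linear_fst])

lemma poly_map_snd [intro]: "poly_map f \<Longrightarrow> poly_map (\<lambda>x. snd (f x))"
  by (rule poly_map_linear_comp[OF _ linear_snd])

lemma poly_map_Pair [intro]:
  fixes f :: "'a::euclidean_space \<Rightarrow> 'b::euclidean_space" and g :: "'a \<Rightarrow> 'c::euclidean_space"
  assumes "poly_map f" "poly_map g"
  shows "poly_map (\<lambda>x. (f x, g x))"
proof -
  have "linear (\<lambda>y :: 'b. (y, 0 :: 'c))" "linear (\<lambda>z :: 'c. (0 :: 'b, z))"
    by (auto intro!: linearI)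
  from poly_map_add[OF poly_map_linear_comp[OF assms(1) this(1)] poly_map_linear_comp[OF assms(2) this(2)]]
  show ?thesis by simp
qed

text \<open>\<open>poly_fun\<close> is a class of functions without syntax, so substitution is an
  induction over its generation.\<close>

lemma poly_map_compose:
  assumes h: "poly_map h" and f: "poly_map f"
  shows "poly_map (\<lambda>x :: 'a::euclidean_space. h (f x :: 'b::euclidean_space) :: 'c::euclidean_space)"
proof (rule poly_mapI)
  fix b :: 'c assume "b \<in> Basis"
  then obtain p where p: "poly_fun DIM('b) p" "\<And>y. h y \<bullet> b = p (coords y)"
    using h unfolding poly_map_def by metis
  have "\<exists>q. poly_fun DIM('a) q \<and> (\<forall>x. p (coords (f x)) = q (coords x))"
    using p(1)
  proof induction
    case (const c) then show ?case by (auto intro: poly_fun.const)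
  next
    case (coord i)
    then show ?case using f unfolding poly_map_def by (auto simp: coords_nth)
  next
    case (add g1 g2)
    then obtain q1 q2 where "poly_fun DIM('a) q1" "poly_fun DIM('a) q2"
      "\<And>x. g1 (coords (f x)) = q1 (coords x)" "\<And>x. g2 (coords (f x)) = q2 (coords x)" by blast
    then show ?case by (intro exI[of _ "\<lambda>x. q1 x + q2 x"]) (auto intro: poly_fun.add)
  next
    case (mult g1 g2)
    then obtain q1 q2 where "poly_fun DIM('a) q1" "poly_fun DIM('a) q2"
      "\<And>x. g1 (coords (f x)) = q1 (coords x)" "\<And>x. g2 (coords (f x)) = q2 (coords x)" by blast
    then show ?case by (intro exI[of _ "\<lambda>x. q1 x * q2 x"]) (auto intro: poly_fun.mult)
  qed
  then show "\<exists>q. poly_fun DIM('a) q \<and> (\<forall>x. h (f x) \<bullet> b = q (coords x))"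
    by (simp add: p(2))
qed

subsection \<open>Closure properties of definable predicates\<close>

context real_structure
begin

lemma
  assumes "1 \<le> m"
  shows S_subset: "A \<in> S m \<Longrightarrow> A \<subseteq> Rspace m"
    and S_space: "Rspace m \<in> S m"
    and S_Int: "A \<in> S m \<Longrightarrow> B \<in> S m \<Longrightarrow> A \<inter> B \<in> S m"
    and S_Diff: "A \<in> S m \<Longrightarrow> B \<in> S m \<Longrightarrow> A - B \<in> S m"
proof -
  interpret algebra "Rspace m" "S m" using boolean_algebra[OF assms] .
  show "A \<in> S m \<Longrightarrow> A \<subseteq> Rspace m" by (rule sets_into_space)
  show "Rspace m \<in> S m" by (rule top)
  show "A \<in> S m \<Longrightarrow> B \<in> S m \<Longrightarrow> A \<inter> B \<in> S m" by (rule Int)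
  show "A \<in> S m \<Longrightarrow> B \<in> S m \<Longrightarrow> A - B \<in> S m" by (rule Diff)
qed

lemma S_projection:
  assumes "1 \<le> m" "A \<in> S (m + l)"
  shows "take m ` A \<in> S m"
  using assms(2)
proof (induction l arbitrary: A)
  case 0
  then have "take m ` A = id ` A"
    using S_subset[OF assms(1)] by (intro image_cong) (auto simp: Rspace_def)
  then show ?case using 0 by simp
next
  case (Suc l)
  have "butlast ` A \<in> S (m + l)"
    using projection[of "m + l" A] Suc.prems assms(1) by simp
  from Suc.IH[OF this] have "take m ` butlast ` A \<in> S m" .
  moreover have "take m ` butlast ` A = take m ` A"
    unfolding image_image
  proof (rule image_cong[OF refl])
    fix xs assume "xs \<in> A"
    then have "length xs = Suc (m + l)"
      using S_subset[of "m + Suc l" A] Suc.prems assms(1) by (auto simp: Rspace_def)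
    then show "take m (butlast xs) = take m xs"
      by (simp add: butlast_conv_take min_def)
  qed
  ultimately show ?case by simp
qed

text \<open>The preimage is the projection of \<open>Rspace m\<close> times \<open>A\<close>
  intersected with the graph of the map, which is algebraic. The axioms mention no permutation or
  substitution of coordinates; all of them are instances of this lemma.\<close>

lemma S_vimage:
  assumes m: "1 \<le> m" and l: "1 \<le> l" and A: "A \<in> S l" and p: "\<And>i. i < l \<Longrightarrow> poly_fun m (p i)"
  shows "{xs \<in> Rspace m. map (\<lambda>i. p i xs) [0..<l] \<in> A} \<in> S m"
proof -
  define B where "B = {xs @ ys | xs ys. xs \<in> Rspace m \<and> ys \<in> A}"
  define Z where "Z = {zs \<in> Rspace (m + l). \<forall>f\<in>(\<lambda>i zs. zs ! (m + i) - p i zs) ` {..<l}. f zs = 0}"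
  have "B \<in> S (m + l)"
    unfolding B_def by (rule product[OF m l S_space[OF m] A])
  moreover have "Z \<in> S (m + l)"
  proof (rule algebraic)
    show "algebraic_set (m + l) Z"
      unfolding algebraic_set_def Z_def
      by (rule exI[of _ "(\<lambda>i zs. zs ! (m + i) - p i zs) ` {..<l}"])
        (auto intro!: poly_fun_diff poly_fun.coord intro: poly_fun_mono[OF p])
  qed (use m in simp)
  ultimately have "B \<inter> Z \<in> S (m + l)"
    using S_Int m by simp
  then have "take m ` (B \<inter> Z) \<in> S m"
    by (rule S_projection[OF m])
  moreover have "take m ` (B \<inter> Z) = {xs \<in> Rspace m. map (\<lambda>i. p i xs) [0..<l] \<in> A}"
  proof (intro equalityI subsetI)
    fix xs assume "xs \<in> take m ` (B \<inter> Z)"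
    then obtain zs where zs: "zs \<in> B" "zs \<in> Z" "xs = take m zs" by auto
    then obtain ys where ys: "zs = xs @ ys" "xs \<in> Rspace m" "ys \<in> A"
      unfolding B_def by (auto simp: Rspace_def)
    have len: "length xs = m" "length ys = l"
      using ys S_subset[OF l A] by (auto simp: Rspace_def)
    have "ys ! i = p i xs" if "i < l" for i
      using zs(2) that unfolding Z_def ys(1) by (auto simp: nth_append len poly_fun_append[OF p])
    then have "map (\<lambda>i. p i xs) [0..<l] = ys"
      by (intro nth_equalityI) (auto simp: len)
    then show "xs \<in> {xs \<in> Rspace m. map (\<lambda>i. p i xs) [0..<l] \<in> A}"
      using ys by simp
  next
    fix xs assume "xs \<in> {xs \<in> Rspace m. map (\<lambda>i. p i xs) [0..<l] \<in> A}"
    then have xs: "length xs = m" "map (\<lambda>i. p i xs) [0..<l] \<in> A" by (auto simp: Rspace_def)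
    then have "xs @ map (\<lambda>i. p i xs) [0..<l] \<in> B \<inter> Z"
      unfolding B_def Z_def by (auto simp: Rspace_def nth_append poly_fun_append[OF p])
    then show "xs \<in> take m ` (B \<inter> Z)"
      using xs by (intro image_eqI[of _ _ "xs @ map (\<lambda>i. p i xs) [0..<l]"]) auto
  qed
  ultimately show ?thesis by simp
qed

text \<open>A predicate rather than a set, so that the logical structure of a formula stays visible
  to the introduction rules below.\<close>

definition definable_pred :: "('a::euclidean_space \<Rightarrow> bool) \<Rightarrow> bool" where
  "definable_pred P \<longleftrightarrow> {xs \<in> Rspace DIM('a). P (decode xs)} \<in> S DIM('a)"

lemma definable_pred_not [intro]: "definable_pred P \<Longrightarrow> definable_pred (\<lambda>x. \<not> P x)"
proof -
  assume "definable_pred (P :: 'a \<Rightarrow> bool)"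
  moreover have "{xs \<in> Rspace DIM('a). \<not> P (decode xs)} =
      Rspace DIM('a) - {xs \<in> Rspace DIM('a). P (decode xs)}" by auto
  ultimately show ?thesis
    unfolding definable_pred_def by (simp add: S_Diff S_space Suc_le_eq)
qed

lemma definable_pred_conj [intro]: "definable_pred P \<Longrightarrow> definable_pred Q \<Longrightarrow> definable_pred (\<lambda>x. P x \<and> Q x)"
proof -
  assume "definable_pred (P :: 'a \<Rightarrow> bool)" "definable_pred Q"
  moreover have "{xs \<in> Rspace DIM('a). P (decode xs) \<and> Q (decode xs)} =
      {xs \<in> Rspace DIM('a). P (decode xs)} \<inter> {xs \<in> Rspace DIM('a). Q (decode xs)}" by auto
  ultimately show ?thesis
    unfolding definable_pred_def by (simp add: S_Int Suc_le_eq)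
qed

lemma definable_pred_disj [intro]: "definable_pred P \<Longrightarrow> definable_pred Q \<Longrightarrow> definable_pred (\<lambda>x. P x \<or> Q x)"
  using definable_pred_not[OF definable_pred_conj[OF definable_pred_not definable_pred_not], of P Q] by simp

lemma definable_pred_imp [intro]: "definable_pred P \<Longrightarrow> definable_pred Q \<Longrightarrow> definable_pred (\<lambda>x. P x \<longrightarrow> Q x)"
  unfolding imp_conv_disj by (intro definable_pred_disj definable_pred_not)

lemma definable_pred_vimage:
  fixes f :: "'a::euclidean_space \<Rightarrow> 'b::euclidean_space"
  assumes P: "definable_pred P" and f: "poly_map f"
  shows "definable_pred (\<lambda>x. P (f x))"
proof -
  have "\<exists>p. poly_fun DIM('a) p \<and> (\<forall>x. f x \<bullet> basis_list ! i = p (coords x))" if "i < DIM('b)" for i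
    using f that unfolding poly_map_def by auto
  then obtain p where p: "\<And>i. i < DIM('b) \<Longrightarrow> poly_fun DIM('a) (p i)"
    "\<And>i x. i < DIM('b) \<Longrightarrow> f x \<bullet> basis_list ! i = p i (coords x)" by metis
  have eq: "map (\<lambda>i. p i xs) [0..<DIM('b)] = coords (f (decode xs))" if "xs \<in> Rspace DIM('a)" for xs
  proof (rule nth_equalityI)
    fix i assume "i < length (map (\<lambda>i. p i xs) [0..<DIM('b)])"
    then show "map (\<lambda>i. p i xs) [0..<DIM('b)] ! i = coords (f (decode xs)) ! i"
      using p(2)[of i "decode xs"] that by (simp add: coords_nth)
  qed simp
  have "{xs \<in> Rspace DIM('a). map (\<lambda>i. p i xs) [0..<DIM('b)] \<in> {ys \<in> Rspace DIM('b). P (decode ys)}} \<in> S DIM('a)"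
    using P unfolding definable_pred_def by (intro S_vimage p) (auto simp: Suc_le_eq)
  also have "{xs \<in> Rspace DIM('a). map (\<lambda>i. p i xs) [0..<DIM('b)] \<in> {ys \<in> Rspace DIM('b). P (decode ys)}} =
      {xs \<in> Rspace DIM('a). P (f (decode xs))}"
    by (auto simp: eq)
  finally show ?thesis unfolding definable_pred_def .
qed

lemma definable_pred_ex [intro]:
  fixes P :: "'a::euclidean_space \<Rightarrow> 'b::euclidean_space \<Rightarrow> bool"
  assumes "definable_pred (\<lambda>z. P (fst z) (snd z))"
  shows "definable_pred (\<lambda>x. \<exists>y. P x y)"
proof -
  let ?m = "DIM('a)" and ?l = "DIM('b)"
  \<comment> \<open>Component \<open>i\<close> of the decoded pair, in the order chosen for the
    product type, as a linear form in the entries of \<open>xs @ ys\<close>.\<close>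
  define p where "p i xs = (\<Sum>j<?m. xs ! j * (basis_list ! j \<bullet> fst (basis_list ! i :: 'a \<times> 'b))) +
     (\<Sum>j<?l. xs ! (?m + j) * (basis_list ! j \<bullet> snd (basis_list ! i :: 'a \<times> 'b)))" for i xs
  have poly: "poly_fun (?m + ?l) (p i)" for i
    unfolding p_def by (intro poly_fun.add poly_fun_linear poly_fun_linear_shift) auto
  have eq: "map (\<lambda>i. p i (xs @ ys)) [0..<DIM('a \<times> 'b)] = coords (decode xs :: 'a, decode ys :: 'b)"
    if "xs \<in> Rspace ?m" "ys \<in> Rspace ?l" for xs ys
  proof (rule nth_equalityI)
    fix i assume "i < length (map (\<lambda>i. p i (xs @ ys)) [0..<DIM('a \<times> 'b)])"
    then have "i < ?m + ?l" by simp
    moreover have "length xs = ?m" using that by (simp add: Rspace_def)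
    ultimately show "map (\<lambda>i. p i (xs @ ys)) [0..<DIM('a \<times> 'b)] ! i = coords (decode xs :: 'a, decode ys :: 'b) ! i"
      by (simp add: coords_nth inner_prod_def decode_inner p_def nth_append)
  qed simp
  have "{zs \<in> Rspace (?m + ?l). map (\<lambda>i. p i zs) [0..<DIM('a \<times> 'b)] \<in>
      {xs \<in> Rspace DIM('a \<times> 'b). P (fst (decode xs :: 'a \<times> 'b)) (snd (decode xs :: 'a \<times> 'b))}} \<in> S (?m + ?l)"
    using assms unfolding definable_pred_def by (intro S_vimage poly) (auto simp: Suc_le_eq)
  then have "take ?m ` {zs \<in> Rspace (?m + ?l). map (\<lambda>i. p i zs) [0..<DIM('a \<times> 'b)] \<in>
      {xs \<in> Rspace DIM('a \<times> 'b). P (fst (decode xs :: 'a \<times> 'b)) (snd (decode xs :: 'a \<times> 'b))}} \<in> S ?m"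
    (is "take ?m ` ?C \<in> _")
    by (intro S_projection) (auto simp: Suc_le_eq)
  also have "take ?m ` ?C = {xs \<in> Rspace ?m. \<exists>y. P (decode xs) y}"
  proof (intro equalityI subsetI)
    fix xs assume "xs \<in> take ?m ` ?C"
    then obtain zs where zs: "zs \<in> ?C" "xs = take ?m zs" by blast
    define ys where "ys = drop ?m zs"
    have "length zs = ?m + ?l" using zs by (simp add: Rspace_def)
    then have len: "xs \<in> Rspace ?m" "ys \<in> Rspace ?l" and "zs = xs @ ys"
      by (auto simp: Rspace_def ys_def zs(2))
    with zs(1) have "P (decode xs) (decode ys)"
      by (simp add: eq[simplified])
    then show "xs \<in> {xs \<in> Rspace ?m. \<exists>y. P (decode xs) y}" using len by auto
  next
    fix xs assume "xs \<in> {xs \<in> Rspace ?m. \<exists>y. P (decode xs) y}"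
    then obtain y where xs: "xs \<in> Rspace ?m" and y: "P (decode xs) y" by auto
    have "xs @ coords y \<in> ?C"
      using xs y by (simp add: eq[simplified]) (simp add: Rspace_def)
    then show "xs \<in> take ?m ` ?C"
      using xs by (intro image_eqI[of _ _ "xs @ coords y"]) (auto simp: Rspace_def)
  qed
  finally show ?thesis unfolding definable_pred_def .
qed

lemma definable_pred_all [intro]:
  fixes P :: "'a::euclidean_space \<Rightarrow> 'b::euclidean_space \<Rightarrow> bool"
  assumes "definable_pred (\<lambda>z. P (fst z) (snd z))"
  shows "definable_pred (\<lambda>x. \<forall>y. P x y)"
  using definable_pred_not[OF definable_pred_ex[OF definable_pred_not[OF assms]]] by simp

lemma definable_pred_eq_0:
  fixes f :: "'a::euclidean_space \<Rightarrow> real"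
  assumes "poly_map f"
  shows "definable_pred (\<lambda>x. f x = 0)"
proof -
  obtain p where p: "poly_fun DIM('a) p" "\<And>x. f x = p (coords x)"
    using assms unfolding poly_map_def by auto
  have "algebraic_set DIM('a) {xs \<in> Rspace DIM('a). f (decode xs) = 0}"
    unfolding algebraic_set_def
    by (rule exI[of _ "{p}"]) (auto simp: p)
  then show ?thesis
    unfolding definable_pred_def by (intro algebraic) (auto simp: Suc_le_eq)
qed

text \<open>Algebraic sets only provide equations. The order is recovered from squares: the
  difference is nonnegative iff it has a real square root, and the root is quantified away.\<close>

lemma definable_pred_le [intro]:
  fixes f g :: "'a::euclidean_space \<Rightarrow> real"
  assumes "poly_map f" "poly_map g"
  shows "definable_pred (\<lambda>x. f x \<le> g x)"
proof -
  have "definable_pred (\<lambda>x. \<exists>t :: real. g x - f x - t * t = 0)"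
    by (intro definable_pred_ex definable_pred_eq_0 poly_map_diff poly_map_mult poly_map_compose[OF assms(1)]
        poly_map_compose[OF assms(2)] poly_map_fst poly_map_snd poly_map_id)
  moreover have "(\<exists>t :: real. g x - f x - t * t = 0) \<longleftrightarrow> f x \<le> g x" for x
  proof
    assume "f x \<le> g x"
    then show "\<exists>t :: real. g x - f x - t * t = 0"
      by (intro exI[of _ "sqrt (g x - f x)"]) simp
  qed (metis add.commute diff_eq_eq diff_ge_0_iff_ge diff_zero zero_le_square)
  ultimately show ?thesis by simp
qed

lemma definable_pred_less [intro]:
  fixes f g :: "'a::euclidean_space \<Rightarrow> real"
  assumes "poly_map f" "poly_map g"
  shows "definable_pred (\<lambda>x. f x < g x)"
  using definable_pred_not[OF definable_pred_le[OF assms(2,1)]] by (simp add: not_le)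

lemma definable_pred_eq [intro]:
  fixes f g :: "'a::euclidean_space \<Rightarrow> 'b::euclidean_space"
  assumes "poly_map f" "poly_map g"
  shows "definable_pred (\<lambda>x. f x = g x)"
proof -
  have "definable_pred (\<lambda>x. (f x - g x) \<bullet> (f x - g x) = 0)"
    by (intro definable_pred_eq_0 poly_map_inner poly_map_diff assms)
  then show ?thesis by simp
qed

text \<open>The norm is not polynomial; it is squared, which brings in a sign condition on
  \<open>g\<close>.\<close>

lemma definable_pred_norm_le [intro]:
  fixes f :: "'a::euclidean_space \<Rightarrow> 'b::euclidean_space"
  assumes "poly_map f" "poly_map g"
  shows "definable_pred (\<lambda>x. norm (f x) \<le> g x)"
proof -
  have "norm (f x) \<le> g x \<longleftrightarrow> 0 \<le> g x \<and> f x \<bullet> f x \<le> g x * g x" for x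
    by (simp add: norm_le_square power2_eq_square)
  then show ?thesis
    by (simp only:) (intro definable_pred_conj definable_pred_le poly_map_const poly_map_inner poly_map_mult assms)
qed

text \<open>The enumeration of indices behind \<open>coord_list\<close> and that of the basis behind
  \<open>decode\<close> are unrelated choices, hence the linear substitution
  \<open>p\<close>.\<close>

lemma definable_imp_definable_pred:
  fixes A :: "(real^'n) set"
  assumes "definable S A"
  shows "definable_pred (\<lambda>x. x \<in> A)"
proof -
  have "\<exists>js :: 'n list. distinct js \<and> set js = UNIV"
    using finite_distinct_list[OF finite, of "UNIV :: 'n set"] by blast
  from someI_ex[OF this] have ix: "distinct (index_list :: 'n list)" "set (index_list :: 'n list) = UNIV"
    unfolding index_list_def by blast+
  then have len: "length (index_list :: 'n list) = CARD('n)"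
    by (metis distinct_card)
  have inj: "coord_list x = coord_list y \<Longrightarrow> x = y" for x y :: "real^'n"
    using ix unfolding coord_list_def by (auto simp: vec_eq_iff)
  define p where "p i xs = (\<Sum>j<CARD('n). xs ! j * (basis_list ! j \<bullet> (axis (index_list ! i) 1 :: real^'n)))" for i xs
  have eq: "map (\<lambda>i. p i xs) [0..<CARD('n)] = coord_list (decode xs :: real^'n)" for xs
  proof (rule nth_equalityI)
    fix i assume "i < length (map (\<lambda>i. p i xs) [0..<CARD('n)])"
    then show "map (\<lambda>i. p i xs) [0..<CARD('n)] ! i = coord_list (decode xs :: real^'n) ! i"
      using decode_inner[of xs "axis (index_list ! i) 1 :: real^'n"]
      by (simp add: coord_list_def len p_def inner_axis)
  qed (simp add: coord_list_def len)
  have "{xs \<in> Rspace CARD('n). map (\<lambda>i. p i xs) [0..<CARD('n)] \<in> coord_list ` A} \<in> S CARD('n)"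
    using assms unfolding definable_def p_def by (intro S_vimage poly_fun_linear) (auto simp: Suc_le_eq)
  moreover have "coord_list (decode xs :: real^'n) \<in> coord_list ` A \<longleftrightarrow> decode xs \<in> A" for xs
    using inj by (auto simp: image_iff)
  ultimately show ?thesis
    unfolding definable_pred_def eq by simp
qed

end

section \<open>Growth of definable families of sets of reals\<close>

context polynomially_bounded_o_minimal
begin

text \<open>Polynomial boundedness is applied to the infimum of the slices.\<close>

lemma polynomially_bounded_slices:
  fixes E :: "real \<Rightarrow> real \<Rightarrow> bool"
  assumes E: "definable_pred (\<lambda>z. E (fst z) (snd z))"
    and nonempty: "\<And>s. \<exists>u. E s u" and nonneg: "\<And>s u. E s u \<Longrightarrow> 0 \<le> u"
  shows "\<exists>N. eventually (\<lambda>s. \<exists>u. E s u \<and> u \<le> s ^ N) at_top"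
proof -
  define f where "f s = Inf {u. E s u}" for s
  have bdd: "bdd_below {u. E s u}" for s
    using nonneg by (auto simp: bdd_below_def)
  \<comment> \<open>The greatest lower bound in first-order terms, so that the graph of
    \<open>f\<close> is seen to be definable.\<close>
  have f_eq: "r = f s \<longleftrightarrow> (\<forall>u. E s u \<longrightarrow> r \<le> u) \<and> (\<forall>v. (\<forall>u. E s u \<longrightarrow> v \<le> u) \<longrightarrow> v \<le> r)" for r s
  proof
    assume "r = f s"
    then show "(\<forall>u. E s u \<longrightarrow> r \<le> u) \<and> (\<forall>v. (\<forall>u. E s u \<longrightarrow> v \<le> u) \<longrightarrow> v \<le> r)"
      unfolding f_def using nonempty[of s] bdd[of s] by (auto intro: cInf_lower cInf_greatest)
  next
    assume r: "(\<forall>u. E s u \<longrightarrow> r \<le> u) \<and> (\<forall>v. (\<forall>u. E s u \<longrightarrow> v \<le> u) \<longrightarrow> v \<le> r)"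
    have "\<forall>u. E s u \<longrightarrow> f s \<le> u" using bdd[of s] unfolding f_def by (auto intro: cInf_lower)
    then have "f s \<le> r" using r by blast
    moreover have "r \<le> f s" using r nonempty[of s] unfolding f_def by (auto intro: cInf_greatest)
    ultimately show "r = f s" by simp
  qed
  have E': "definable_pred (\<lambda>x :: (real \<times> real) \<times> real. E (fst (fst x)) (snd x))"
    by (rule definable_pred_vimage[OF E, of "\<lambda>x. (fst (fst x), snd x)", simplified])
      (intro poly_map_Pair poly_map_fst poly_map_snd poly_map_id)
  have E'': "definable_pred (\<lambda>x :: ((real \<times> real) \<times> real) \<times> real. E (fst (fst (fst x))) (snd x))"
    by (rule definable_pred_vimage[OF E, of "\<lambda>x. (fst (fst (fst x)), snd x)", simplified])
      (intro poly_map_Pair poly_map_fst poly_map_snd poly_map_id)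
  have "definable_pred (\<lambda>z :: real \<times> real. (\<forall>u. E (fst z) u \<longrightarrow> snd z \<le> u) \<and>
      (\<forall>v. (\<forall>u. E (fst z) u \<longrightarrow> v \<le> u) \<longrightarrow> v \<le> snd z))"
    by (rule definable_pred_conj definable_pred_all definable_pred_imp E' E'' definable_pred_le poly_map_fst poly_map_snd poly_map_id)+
  then have graph: "definable_pred (\<lambda>z :: real \<times> real. snd z = f (fst z))"
    unfolding f_eq .
  define p where "p i xs = (\<Sum>j<2. xs ! j * ((if j = 0 then (1, 0) else (0, 1)) \<bullet> (basis_list ! i :: real \<times> real)))"
    for i and xs :: "real list"
  have eq: "map (\<lambda>i. p i xs) [0..<2] = coords (xs ! 0, xs ! 1)" for xs
  proof (rule nth_equalityI)
    fix i assume "i < length (map (\<lambda>i. p i xs) [0..<2])"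
    then show "map (\<lambda>i. p i xs) [0..<2] ! i = coords (xs ! 0, xs ! 1) ! i"
      by (auto simp: p_def coords_nth numeral_2_eq_2 inner_prod_def less_Suc_eq)
  qed simp
  have "{xs \<in> Rspace 2. map (\<lambda>i. p i xs) [0..<2] \<in> {ys \<in> Rspace 2. snd (decode ys :: real \<times> real) = f (fst (decode ys :: real \<times> real))}} \<in> S 2"
    using graph unfolding p_def definable_pred_def
    by (intro S_vimage poly_fun_linear) (simp_all add: numeral_2_eq_2)
  also have "{xs \<in> Rspace 2. map (\<lambda>i. p i xs) [0..<2] \<in> {ys \<in> Rspace 2. snd (decode ys :: real \<times> real) = f (fst (decode ys :: real \<times> real))}} =
      range (\<lambda>t. [t, f t])"
  proof -
    have "coords (a, b) \<in> Rspace 2" for a b :: real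
      using coords_in_Rspace[of "(a, b)"] by (simp add: numeral_2_eq_2)
    moreover have "xs \<in> range (\<lambda>t. [t, f t])" if "xs \<in> Rspace 2" "xs ! 1 = f (xs ! 0)" for xs
      using that by (intro image_eqI[of _ _ "xs ! 0"]) (auto simp: Rspace_def numeral_2_eq_2 length_Suc_conv)
    ultimately show ?thesis
      unfolding eq by (auto simp: Rspace_def)
  qed
  finally obtain N where N: "N \<ge> 1" "eventually (\<lambda>s. \<bar>f s\<bar> \<le> s ^ N) at_top"
    using polynomially_bounded by blast
  \<comment> \<open>The infimum need not be attained. One more factor \<open>s > 2\<close> gives the
    strict bound: \<open>f s \<le> s ^ N < s ^ N + 1 \<le> s ^ (N + 1)\<close>.\<close>
  have "eventually (\<lambda>s. \<exists>u. E s u \<and> u \<le> s ^ (N + 1)) at_top"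
    using N(2) eventually_gt_at_top[of 2]
  proof eventually_elim
    case (elim s)
    have "1 \<le> s ^ N" using elim(2) by (intro one_le_power) simp
    then have "s ^ N + 1 \<le> s * s ^ N" using elim(2) mult_right_mono[of 2 s "s ^ N"] by linarith
    then have "f s < s ^ (N + 1)" using elim(1) by simp
    then obtain u where "u \<in> {u. E s u}" "u < s ^ (N + 1)"
      unfolding f_def using cInf_lessD[of "{u. E s u}"] nonempty by blast
    then show ?case by (auto intro: less_imp_le)
  qed
  then show ?thesis by blast
qed

end

section \<open>Calculus of Hoelder classes\<close>

lemma has_vector_derivative_at_0_iff:
  "(\<phi> has_vector_derivative D) (at (0::real)) \<longleftrightarrow> ((\<lambda>t. (1 / t) *\<^sub>R (\<phi> t - \<phi> 0)) \<longlongrightarrow> D) (at 0)"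
proof -
  have eq: "norm (\<phi> (0 + h) - \<phi> 0 - h *\<^sub>R D) / norm h = norm ((1 / h) *\<^sub>R (\<phi> h - \<phi> 0) - D)" if "h \<noteq> 0" for h
  proof -
    have "(1 / h) *\<^sub>R (\<phi> h - \<phi> 0) - D = (1 / h) *\<^sub>R (\<phi> h - \<phi> 0 - h *\<^sub>R D)"
      using that by (simp add: scaleR_diff_right)
    then show ?thesis by simp
  qed
  have "(\<phi> has_vector_derivative D) (at 0) \<longleftrightarrow> (\<lambda>h. norm (\<phi> (0 + h) - \<phi> 0 - h *\<^sub>R D) / norm h) \<midarrow>0\<rightarrow> 0"
    by (simp add: has_vector_derivative_def has_derivative_at bounded_linear_scaleR_left)
  also have "\<dots> \<longleftrightarrow> (\<lambda>h. norm ((1 / h) *\<^sub>R (\<phi> h - \<phi> 0) - D)) \<midarrow>0\<rightarrow> 0"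
  proof (intro filterlim_cong refl)
    show "eventually (\<lambda>h. norm (\<phi> (0 + h) - \<phi> 0 - h *\<^sub>R D) / norm h = norm ((1 / h) *\<^sub>R (\<phi> h - \<phi> 0) - D)) (at 0)"
      unfolding eventually_at_filter by (rule always_eventually) (use eq in blast)
  qed
  finally show ?thesis
    by (simp only: tendsto_norm_zero_iff LIM_zero_iff)
qed

subsection \<open>Local Hoelder continuity\<close>

lemma locally_holder_on_subset: "locally_holder_on \<alpha> f W \<Longrightarrow> W' \<subseteq> W \<Longrightarrow> locally_holder_on \<alpha> f W'"
  unfolding locally_holder_on_def
proof
  fix p assume "p \<in> W'" "W' \<subseteq> W"
    and "\<forall>p\<in>W. \<exists>V C. open V \<and> p \<in> V \<and> (\<forall>x\<in>V \<inter> W. \<forall>y\<in>V \<inter> W. dist (f x) (f y) \<le> C * dist x y powr \<alpha>)"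
  then have "\<exists>V C. open V \<and> p \<in> V \<and> (\<forall>x\<in>V \<inter> W. \<forall>y\<in>V \<inter> W. dist (f x) (f y) \<le> C * dist x y powr \<alpha>)"
    by auto
  then obtain V C where "open V" "p \<in> V" "\<forall>x\<in>V \<inter> W. \<forall>y\<in>V \<inter> W. dist (f x) (f y) \<le> C * dist x y powr \<alpha>"
    by - (elim exE conjE, rule that)
  with \<open>W' \<subseteq> W\<close> show "\<exists>V C. open V \<and> p \<in> V \<and> (\<forall>x\<in>V \<inter> W'. \<forall>y\<in>V \<inter> W'. dist (f x) (f y) \<le> C * dist x y powr \<alpha>)"
    by (intro exI[of _ V] exI[of _ C]) auto
qed

lemma locally_holder_on_cong: "(\<And>x. x \<in> W \<Longrightarrow> f x = g x) \<Longrightarrow> locally_holder_on \<alpha> f W = locally_holder_on \<alpha> g W"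
  unfolding locally_holder_on_def by (intro ball_cong refl ex_cong1) auto

lemma locally_holder_onE:
  assumes "locally_holder_on \<alpha> f W" "p \<in> W"
  obtains V C where "open V" "p \<in> V" "0 \<le> C"
    "\<And>x y. x \<in> V \<Longrightarrow> x \<in> W \<Longrightarrow> y \<in> V \<Longrightarrow> y \<in> W \<Longrightarrow> dist (f x) (f y) \<le> C * dist x y powr \<alpha>"
proof -
  obtain V C where V: "open V" "p \<in> V" "\<forall>x\<in>V \<inter> W. \<forall>y\<in>V \<inter> W. dist (f x) (f y) \<le> C * dist x y powr \<alpha>"
    using bspec[OF assms(1)[unfolded locally_holder_on_def] assms(2)] by - (elim exE conjE, rule that)
  have "dist (f x) (f y) \<le> \<bar>C\<bar> * dist x y powr \<alpha>" if "x \<in> V" "x \<in> W" "y \<in> V" "y \<in> W" for x y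
  proof -
    have "dist (f x) (f y) \<le> C * dist x y powr \<alpha>" using V(3) that by blast
    also have "\<dots> \<le> \<bar>C\<bar> * dist x y powr \<alpha>" by (intro mult_right_mono) auto
    finally show ?thesis .
  qed
  then show ?thesis using that[of V "\<bar>C\<bar>"] V by auto
qed

lemma locally_holder_onI:
  assumes "\<And>p. p \<in> W \<Longrightarrow> \<exists>V C. open V \<and> p \<in> V \<and>
    (\<forall>x y. x \<in> V \<longrightarrow> x \<in> W \<longrightarrow> y \<in> V \<longrightarrow> y \<in> W \<longrightarrow> dist (f x) (f y) \<le> C * dist x y powr \<alpha>)"
  shows "locally_holder_on \<alpha> f W"
  unfolding locally_holder_on_def using assms by (metis IntD1 IntD2)

lemma locally_holder_on_mono:
  assumes "locally_holder_on \<beta> f W" "\<alpha> \<le> \<beta>"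
  shows "locally_holder_on \<alpha> f W"
proof (rule locally_holder_onI)
  fix p assume "p \<in> W"
  then obtain V C where V: "open V" "p \<in> V" "0 \<le> C"
    "\<And>x y. x \<in> V \<Longrightarrow> x \<in> W \<Longrightarrow> y \<in> V \<Longrightarrow> y \<in> W \<Longrightarrow> dist (f x) (f y) \<le> C * dist x y powr \<beta>"
    using locally_holder_onE[OF assms(1)] by metis
  \<comment> \<open>Two points of the ball of radius 1/2 have distance at most 1, where a larger
    exponent gives a smaller power.\<close>
  have "dist (f x) (f y) \<le> C * dist x y powr \<alpha>"
    if "x \<in> V \<inter> ball p (1/2)" "x \<in> W" "y \<in> V \<inter> ball p (1/2)" "y \<in> W" for x y
  proof -
    have "dist x y \<le> 1"
      using that dist_triangle_half_r[of p x 1 y] by (simp add: less_imp_le)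
    then have "dist x y powr \<beta> \<le> dist x y powr \<alpha>"
      using assms(2) by (intro powr_mono') auto
    then show ?thesis
      using V(4)[of x y] V(3) that mult_left_mono[of "dist x y powr \<beta>" "dist x y powr \<alpha>" C] by auto
  qed
  then show "\<exists>V C. open V \<and> p \<in> V \<and>
    (\<forall>x y. x \<in> V \<longrightarrow> x \<in> W \<longrightarrow> y \<in> V \<longrightarrow> y \<in> W \<longrightarrow> dist (f x) (f y) \<le> C * dist x y powr \<alpha>)"
    using V by (intro exI[of _ "V \<inter> ball p (1/2)"] exI[of _ C]) auto
qed

lemma locally_holder_on_const: "locally_holder_on \<alpha> (\<lambda>x. c) W"
  unfolding locally_holder_on_def by (auto intro!: exI[of _ UNIV] exI[of _ 0])

lemma locally_holder_on_linear:
  assumes "bounded_linear h" "locally_holder_on \<alpha> f W"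
  shows "locally_holder_on \<alpha> (\<lambda>x. h (f x)) W"
proof (rule locally_holder_onI)
  fix p assume "p \<in> W"
  interpret bounded_linear h by fact
  obtain K where K: "0 \<le> K" "\<And>x. norm (h x) \<le> norm x * K" using nonneg_bounded by blast
  obtain V C where V: "open V" "p \<in> V" "0 \<le> C"
    "\<And>x y. x \<in> V \<Longrightarrow> x \<in> W \<Longrightarrow> y \<in> V \<Longrightarrow> y \<in> W \<Longrightarrow> dist (f x) (f y) \<le> C * dist x y powr \<alpha>"
    using locally_holder_onE[OF assms(2) \<open>p \<in> W\<close>] by metis
  have "dist (h (f x)) (h (f y)) \<le> (C * K) * dist x y powr \<alpha>" if "x \<in> V" "x \<in> W" "y \<in> V" "y \<in> W" for x y
  proof -
    have "dist (h (f x)) (h (f y)) \<le> dist (f x) (f y) * K"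
      using K(2)[of "f x - f y"] by (simp add: dist_norm diff)
    also have "\<dots> \<le> (C * dist x y powr \<alpha>) * K" by (intro mult_right_mono V that K)
    finally show ?thesis by (simp add: mult_ac)
  qed
  then show "\<exists>V C. open V \<and> p \<in> V \<and>
    (\<forall>x y. x \<in> V \<longrightarrow> x \<in> W \<longrightarrow> y \<in> V \<longrightarrow> y \<in> W \<longrightarrow> dist (h (f x)) (h (f y)) \<le> C * dist x y powr \<alpha>)"
    using V by blast
qed

lemma locally_holder_on_add:
  fixes f g :: "'a::metric_space \<Rightarrow> 'b::real_normed_vector"
  assumes "locally_holder_on \<alpha> f W" "locally_holder_on \<alpha> g W"
  shows "locally_holder_on \<alpha> (\<lambda>x. f x + g x) W"
proof (rule locally_holder_onI)
  fix p assume "p \<in> W"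
  obtain V C where V: "open V" "p \<in> V" "0 \<le> C"
    "\<And>x y. x \<in> V \<Longrightarrow> x \<in> W \<Longrightarrow> y \<in> V \<Longrightarrow> y \<in> W \<Longrightarrow> dist (f x) (f y) \<le> C * dist x y powr \<alpha>"
    using locally_holder_onE[OF assms(1) \<open>p \<in> W\<close>] by metis
  obtain V' C' where V': "open V'" "p \<in> V'" "0 \<le> C'"
    "\<And>x y. x \<in> V' \<Longrightarrow> x \<in> W \<Longrightarrow> y \<in> V' \<Longrightarrow> y \<in> W \<Longrightarrow> dist (g x) (g y) \<le> C' * dist x y powr \<alpha>"
    using locally_holder_onE[OF assms(2) \<open>p \<in> W\<close>] by metis
  have "dist (f x + g x) (f y + g y) \<le> (C + C') * dist x y powr \<alpha>"
    if "x \<in> V \<inter> V'" "x \<in> W" "y \<in> V \<inter> V'" "y \<in> W" for x y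
    using V(4)[of x y] V'(4)[of x y] that dist_triangle_add[of "f x" "g x" "f y" "g y"]
    by (simp add: distrib_right)
  then show "\<exists>V C. open V \<and> p \<in> V \<and>
    (\<forall>x y. x \<in> V \<longrightarrow> x \<in> W \<longrightarrow> y \<in> V \<longrightarrow> y \<in> W \<longrightarrow> dist (f x + g x) (f y + g y) \<le> C * dist x y powr \<alpha>)"
    using V V' by (intro exI[of _ "V \<inter> V'"] exI[of _ "C + C'"]) auto
qed

lemma continuous_on_norm_bound:
  fixes f :: "'a::metric_space \<Rightarrow> 'b::real_normed_vector"
  assumes "continuous_on W f" "p \<in> W"
  obtains V where "open V" "p \<in> V" "\<And>x. x \<in> V \<Longrightarrow> x \<in> W \<Longrightarrow> norm (f x) \<le> norm (f p) + 1"
proof -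
  obtain d where d: "d > 0" "\<And>x. x \<in> W \<Longrightarrow> dist x p < d \<Longrightarrow> dist (f x) (f p) < 1"
    using assms unfolding continuous_on_iff by (metis zero_less_one)
  have "norm (f x) \<le> norm (f p) + 1" if "x \<in> ball p d" "x \<in> W" for x
    using d(2)[OF that(2)] that(1) norm_triangle_sub[of "f x" "f p"]
    by (simp add: dist_commute) (simp add: dist_norm norm_minus_commute)
  then show ?thesis using that[of "ball p d"] d(1) by auto
qed

text \<open>The Leibniz splitting needs local bounds on both factors, which continuity supplies near
  \<open>p\<close>. Continuity is a separate assumption since \<alpha> is arbitrary, and for
  \<open>\<alpha> = 0\<close> a Hoelder bound does not imply it.\<close>

lemma locally_holder_on_bilinear:
  fixes f :: "'a::metric_space \<Rightarrow> 'b::real_normed_vector" and g :: "'a \<Rightarrow> 'c::real_normed_vector"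
  assumes "bounded_bilinear pr" "continuous_on W f" "continuous_on W g"
    "locally_holder_on \<alpha> f W" "locally_holder_on \<alpha> g W"
  shows "locally_holder_on \<alpha> (\<lambda>x. pr (f x) (g x)) W"
proof (rule locally_holder_onI)
  fix p assume "p \<in> W"
  interpret bounded_bilinear pr by fact
  obtain K where K: "0 \<le> K" "\<And>a b. norm (pr a b) \<le> norm a * norm b * K" using nonneg_bounded by blast
  obtain V C where V: "open V" "p \<in> V" "0 \<le> C"
    "\<And>x y. x \<in> V \<Longrightarrow> x \<in> W \<Longrightarrow> y \<in> V \<Longrightarrow> y \<in> W \<Longrightarrow> dist (f x) (f y) \<le> C * dist x y powr \<alpha>"
    using locally_holder_onE[OF assms(4) \<open>p \<in> W\<close>] by metis
  obtain V' C' where V': "open V'" "p \<in> V'" "0 \<le> C'"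
    "\<And>x y. x \<in> V' \<Longrightarrow> x \<in> W \<Longrightarrow> y \<in> V' \<Longrightarrow> y \<in> W \<Longrightarrow> dist (g x) (g y) \<le> C' * dist x y powr \<alpha>"
    using locally_holder_onE[OF assms(5) \<open>p \<in> W\<close>] by metis
  obtain U where U: "open U" "p \<in> U" "\<And>x. x \<in> U \<Longrightarrow> x \<in> W \<Longrightarrow> norm (f x) \<le> norm (f p) + 1"
    using continuous_on_norm_bound[OF assms(2) \<open>p \<in> W\<close>] by blast
  obtain U' where U': "open U'" "p \<in> U'" "\<And>x. x \<in> U' \<Longrightarrow> x \<in> W \<Longrightarrow> norm (g x) \<le> norm (g p) + 1"
    using continuous_on_norm_bound[OF assms(3) \<open>p \<in> W\<close>] by blast
  let ?V = "V \<inter> V' \<inter> U \<inter> U'"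
  let ?C = "C * (norm (g p) + 1) * K + (norm (f p) + 1) * C' * K"
  have "dist (pr (f x) (g x)) (pr (f y) (g y)) \<le> ?C * dist x y powr \<alpha>"
    if "x \<in> ?V" "x \<in> W" "y \<in> ?V" "y \<in> W" for x y
  proof -
    have "pr (f x) (g x) - pr (f y) (g y) = pr (f x - f y) (g x) + pr (f y) (g x - g y)"
      by (simp add: diff_left diff_right)
    then have "dist (pr (f x) (g x)) (pr (f y) (g y)) \<le> norm (pr (f x - f y) (g x)) + norm (pr (f y) (g x - g y))"
      by (simp add: dist_norm norm_triangle_ineq)
    also have "\<dots> \<le> norm (f x - f y) * norm (g x) * K + norm (f y) * norm (g x - g y) * K"
      by (intro add_mono K)
    also have "\<dots> \<le> (C * dist x y powr \<alpha>) * (norm (g p) + 1) * K + (norm (f p) + 1) * (C' * dist x y powr \<alpha>) * K"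
      using that V(4)[of x y] V'(4)[of x y] U(3)[of y] U'(3)[of x] V(3) V'(3)
      by (intro add_mono mult_right_mono mult_mono K) (auto simp: dist_norm)
    finally show ?thesis by (simp add: algebra_simps)
  qed
  then show "\<exists>V C. open V \<and> p \<in> V \<and>
    (\<forall>x y. x \<in> V \<longrightarrow> x \<in> W \<longrightarrow> y \<in> V \<longrightarrow> y \<in> W \<longrightarrow> dist (pr (f x) (g x)) (pr (f y) (g y)) \<le> C * dist x y powr \<alpha>)"
    using V V' U U' by (intro exI[of _ ?V] exI[of _ ?C]) auto
qed

text \<open>A Lipschitz inner map preserves the exponent; two exponents below 1 would multiply to a
  smaller one.\<close>

lemma locally_holder_on_compose:
  fixes f :: "'b::metric_space \<Rightarrow> 'c::metric_space" and g :: "'a::metric_space \<Rightarrow> 'b"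
  assumes f: "locally_holder_on \<alpha> f V" and g: "locally_holder_on 1 g W" "continuous_on W g"
    and sub: "g ` W \<subseteq> V" and \<alpha>: "0 \<le> \<alpha>"
  shows "locally_holder_on \<alpha> (\<lambda>x. f (g x)) W"
proof (rule locally_holder_onI)
  fix p assume "p \<in> W"
  then have "g p \<in> V" using sub by blast
  obtain U C where U: "open U" "g p \<in> U" "0 \<le> C"
    "\<And>x y. x \<in> U \<Longrightarrow> x \<in> V \<Longrightarrow> y \<in> U \<Longrightarrow> y \<in> V \<Longrightarrow> dist (f x) (f y) \<le> C * dist x y powr \<alpha>"
    using locally_holder_onE[OF f \<open>g p \<in> V\<close>] by metis
  obtain U' C' where U': "open U'" "p \<in> U'" "0 \<le> C'"
    "\<And>x y. x \<in> U' \<Longrightarrow> x \<in> W \<Longrightarrow> y \<in> U' \<Longrightarrow> y \<in> W \<Longrightarrow> dist (g x) (g y) \<le> C' * dist x y powr 1"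
    using locally_holder_onE[OF g(1) \<open>p \<in> W\<close>] by metis
  obtain B where B: "open B" "B \<inter> W = g -` U \<inter> W"
    using g(2) U(1) unfolding continuous_on_open_invariant by metis
  have "p \<in> B" using B U(2) \<open>p \<in> W\<close> by blast
  have "dist (f (g x)) (f (g y)) \<le> (C * C' powr \<alpha>) * dist x y powr \<alpha>"
    if "x \<in> U' \<inter> B" "x \<in> W" "y \<in> U' \<inter> B" "y \<in> W" for x y
  proof -
    have "dist (f (g x)) (f (g y)) \<le> C * dist (g x) (g y) powr \<alpha>"
      using that B sub by (intro U(4)) auto
    also have "\<dots> \<le> C * (C' * dist x y) powr \<alpha>"
      using U'(4)[of x y] that \<alpha> U(3) by (intro mult_left_mono powr_mono2) auto
    finally show ?thesis using U'(3) by (simp add: powr_mult mult_ac)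
  qed
  then show "\<exists>V C. open V \<and> p \<in> V \<and>
    (\<forall>x y. x \<in> V \<longrightarrow> x \<in> W \<longrightarrow> y \<in> V \<longrightarrow> y \<in> W \<longrightarrow> dist (f (g x)) (f (g y)) \<le> C * dist x y powr \<alpha>)"
    using U' B \<open>p \<in> B\<close> by (intro exI[of _ "U' \<inter> B"] exI[of _ "C * C' powr \<alpha>"]) auto
qed

subsection \<open>Recursive description of the classes\<close>

text \<open>\<open>partial_derivs\<close> folds from the right, so the last index of a list is
  differentiated first. Peeling off that index turns the conditions of \<open>Ck_holder_on\<close>
  on all lists into a recursion on the first derivatives, which suits induction on \<open>k\<close>.
  Openness of the domain is kept out, so that restriction to subsets is immediate.\<close>

primrec holder_smooth :: "'n::finite set \<Rightarrow> nat \<Rightarrow> real \<Rightarrow> (real^'n \<Rightarrow> 'b::real_normed_vector) \<Rightarrow> (real^'n) set \<Rightarrow> bool" where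
  "holder_smooth I 0 \<alpha> f W \<longleftrightarrow> continuous_on W f \<and> locally_holder_on \<alpha> f W"
| "holder_smooth I (Suc k) \<alpha> f W \<longleftrightarrow> continuous_on W f \<and>
     (\<forall>i\<in>I. \<forall>x\<in>W. (\<lambda>t. f (x + t *\<^sub>R axis i 1)) differentiable (at 0)) \<and>
     (\<forall>i\<in>I. holder_smooth I k \<alpha> (partial_deriv i f) W)"

lemma holder_smooth_continuous: "holder_smooth I k \<alpha> f W \<Longrightarrow> continuous_on W f"
  by (cases k) auto

lemma partial_derivs_snoc: "partial_derivs (js @ [i]) f = partial_derivs js (partial_deriv i f)"
  by (simp add: partial_derivs_def)

lemma all_lists_snoc:
  shows "(\<forall>js\<in>lists I. length js \<le> Suc k \<longrightarrow> Q js) \<longleftrightarrow>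
      Q [] \<and> (\<forall>i\<in>I. \<forall>js\<in>lists I. length js \<le> k \<longrightarrow> Q (js @ [i]))"
    and "(\<forall>js\<in>lists I. length js < Suc k \<longrightarrow> Q js) \<longleftrightarrow>
      Q [] \<and> (\<forall>i\<in>I. \<forall>js\<in>lists I. length js < k \<longrightarrow> Q (js @ [i]))"
    and "(\<forall>js\<in>lists I. length js = Suc k \<longrightarrow> Q js) \<longleftrightarrow>
      (\<forall>i\<in>I. \<forall>js\<in>lists I. length js = k \<longrightarrow> Q (js @ [i]))"
proof -
  have *: "(\<forall>js\<in>lists I. R js) \<longleftrightarrow> R [] \<and> (\<forall>i\<in>I. \<forall>js\<in>lists I. R (js @ [i]))" for R
  proof
    assume R: "R [] \<and> (\<forall>i\<in>I. \<forall>js\<in>lists I. R (js @ [i]))"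
    show "\<forall>js\<in>lists I. R js"
    proof
      fix js assume "js \<in> lists I"
      then show "R js" using R by (cases js rule: rev_exhaust) auto
    qed
  qed auto
  show "(\<forall>js\<in>lists I. length js \<le> Suc k \<longrightarrow> Q js) \<longleftrightarrow>
      Q [] \<and> (\<forall>i\<in>I. \<forall>js\<in>lists I. length js \<le> k \<longrightarrow> Q (js @ [i]))"
    unfolding *[of "\<lambda>js. length js \<le> Suc k \<longrightarrow> Q js"] by simp
  show "(\<forall>js\<in>lists I. length js < Suc k \<longrightarrow> Q js) \<longleftrightarrow>
      Q [] \<and> (\<forall>i\<in>I. \<forall>js\<in>lists I. length js < k \<longrightarrow> Q (js @ [i]))"
    unfolding *[of "\<lambda>js. length js < Suc k \<longrightarrow> Q js"] by simp
  show "(\<forall>js\<in>lists I. length js = Suc k \<longrightarrow> Q js) \<longleftrightarrow>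
      (\<forall>i\<in>I. \<forall>js\<in>lists I. length js = k \<longrightarrow> Q (js @ [i]))"
    unfolding *[of "\<lambda>js. length js = Suc k \<longrightarrow> Q js"] by simp
qed

lemma Ck_holder_on_iff_holder_smooth:
  assumes "openin (top_of_set (coord_space I)) W"
  shows "Ck_holder_on I k \<alpha> f W \<longleftrightarrow> holder_smooth I k \<alpha> f W"
proof (induction k arbitrary: f)
  case 0
  show ?case
    using assms by (auto simp: Ck_holder_on_def Ck_on_def partial_derivs_def)
next
  case (Suc k)
  have nil: "partial_derivs [] f = f" by (simp add: partial_derivs_def)
  have "Ck_holder_on I (Suc k) \<alpha> f W \<longleftrightarrow> continuous_on W f \<and>
     (\<forall>i\<in>I. \<forall>x\<in>W. (\<lambda>t. f (x + t *\<^sub>R axis i 1)) differentiable (at 0)) \<and>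
     (\<forall>i\<in>I. Ck_holder_on I k \<alpha> (partial_deriv i f) W)"
    unfolding Ck_holder_on_def Ck_on_def all_lists_snoc partial_derivs_snoc nil using assms by blast
  then show ?case using Suc.IH by simp
qed

text \<open>Relative openness is enough because the directions \<open>axis i 1\<close> with
  \<open>i \<in> I\<close> do not leave \<open>coord_space I\<close>. Hence partial derivatives on
  \<open>W\<close> depend only on the values on \<open>W\<close>.\<close>

lemma eventually_line_in:
  assumes W: "openin (top_of_set (coord_space I)) W" and "x \<in> W" "i \<in> I"
  shows "eventually (\<lambda>t. x + t *\<^sub>R axis i 1 \<in> W) (nhds (0::real))"
proof -
  obtain V where V: "open V" "W = coord_space I \<inter> V" using W by (auto simp: openin_open)
  have "continuous (at 0) (\<lambda>t. x + t *\<^sub>R axis i 1)" by (intro continuous_intros)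
  then have "((\<lambda>t. x + t *\<^sub>R axis i 1) \<longlongrightarrow> x) (nhds 0)"
    by (simp add: continuous_at tendsto_nhds_iff)
  then have "eventually (\<lambda>t. x + t *\<^sub>R axis i 1 \<in> V) (nhds 0)"
    using V \<open>x \<in> W\<close> by (intro topological_tendstoD) auto
  moreover have "x + t *\<^sub>R axis i 1 \<in> coord_space I" for t
    using assms V by (auto simp: coord_space_def axis_def)
  ultimately show ?thesis by (simp add: V)
qed

lemma line_cong:
  assumes W: "openin (top_of_set (coord_space I)) W" and "x \<in> W" "i \<in> I" and "\<forall>x\<in>W. f x = g x"
  shows "((\<lambda>t. f (x + t *\<^sub>R axis i 1)) has_vector_derivative D) (at 0) \<longleftrightarrow>
         ((\<lambda>t. g (x + t *\<^sub>R axis i 1)) has_vector_derivative D) (at 0)"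
  using eventually_line_in[OF assms(1-3)] assms(2,4)
  by (intro has_vector_derivative_cong_ev refl) (auto elim: eventually_mono)

lemma partial_deriv_cong:
  assumes "openin (top_of_set (coord_space I)) W" and "x \<in> W" "i \<in> I" and "\<forall>x\<in>W. f x = g x"
  shows "partial_deriv i f x = partial_deriv i g x"
  unfolding partial_deriv_def vector_derivative_def by (simp only: line_cong[OF assms])

lemma holder_smooth_cong:
  assumes "openin (top_of_set (coord_space I)) W" and "\<And>x. x \<in> W \<Longrightarrow> f x = g x"
  shows "holder_smooth I k \<alpha> f W \<longleftrightarrow> holder_smooth I k \<alpha> g W"
  using assms(2)
proof (induction k arbitrary: f g)
  case 0
  then show ?case using locally_holder_on_cong[of W f g] continuous_on_cong[of W W f g] by simp
next
  case (Suc k)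
  have "holder_smooth I k \<alpha> (partial_deriv i f) W = holder_smooth I k \<alpha> (partial_deriv i g) W" if "i \<in> I" for i
    using partial_deriv_cong[OF assms(1) _ that, of _ f g] Suc.prems by (intro Suc.IH) simp
  moreover have eq: "\<forall>x\<in>W. f x = g x" using Suc.prems by blast
  have "(\<lambda>t. f (x + t *\<^sub>R axis i 1)) differentiable (at 0) \<longleftrightarrow>
      (\<lambda>t. g (x + t *\<^sub>R axis i 1)) differentiable (at 0)" if "i \<in> I" "x \<in> W" for i x
  proof
    assume "(\<lambda>t. f (x + t *\<^sub>R axis i 1)) differentiable (at 0)"
    then show "(\<lambda>t. g (x + t *\<^sub>R axis i 1)) differentiable (at 0)"
      unfolding vector_derivative_works[of "\<lambda>t. f (x + t *\<^sub>R axis i 1)"]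
      by (rule differentiableI_vector[OF iffD1[OF line_cong[OF assms(1) that(2,1) eq]]])
  next
    assume "(\<lambda>t. g (x + t *\<^sub>R axis i 1)) differentiable (at 0)"
    then show "(\<lambda>t. f (x + t *\<^sub>R axis i 1)) differentiable (at 0)"
      unfolding vector_derivative_works[of "\<lambda>t. g (x + t *\<^sub>R axis i 1)"]
      by (rule differentiableI_vector[OF iffD2[OF line_cong[OF assms(1) that(2,1) eq]]])
  qed
  ultimately show ?case
    using continuous_on_cong[of W W f g] Suc.prems by simp
qed

lemma holder_smooth_SucI:
  assumes "openin (top_of_set (coord_space I)) W" "continuous_on W f"
    and "\<And>i x. i \<in> I \<Longrightarrow> x \<in> W \<Longrightarrow> ((\<lambda>t. f (x + t *\<^sub>R axis i 1)) has_vector_derivative D i x) (at 0)"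
    and "\<And>i. i \<in> I \<Longrightarrow> holder_smooth I k \<alpha> (D i) W"
  shows "holder_smooth I (Suc k) \<alpha> f W"
proof -
  have "partial_deriv i f x = D i x" if "i \<in> I" "x \<in> W" for i x
    unfolding partial_deriv_def using assms(3)[OF that] by (rule vector_derivative_at)
  then have "holder_smooth I k \<alpha> (partial_deriv i f) W" if "i \<in> I" for i
    using holder_smooth_cong[OF assms(1), of "D i" "partial_deriv i f"] assms(4) that by metis
  then show ?thesis
    using assms(2,3) by (auto simp: has_vector_derivative_def differentiable_def)
qed

lemma holder_smooth_SucD:
  assumes "holder_smooth I (Suc k) \<alpha> f W" "i \<in> I" "x \<in> W"
  shows "((\<lambda>t. f (x + t *\<^sub>R axis i 1)) has_vector_derivative partial_deriv i f x) (at 0)"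
  using assms unfolding partial_deriv_def by (simp add: vector_derivative_works)

lemma holder_smooth_subset: "holder_smooth I k \<alpha> f W \<Longrightarrow> W' \<subseteq> W \<Longrightarrow> holder_smooth I k \<alpha> f W'"
  by (induction k arbitrary: f) (auto intro: continuous_on_subset locally_holder_on_subset)

lemma holder_smooth_subset_index: "holder_smooth J k \<alpha> f W \<Longrightarrow> I \<subseteq> J \<Longrightarrow> holder_smooth I k \<alpha> f W"
  by (induction k arbitrary: f) auto

lemma openin_coord_space_UNIV [simp]: "openin (top_of_set (coord_space UNIV)) V \<longleftrightarrow> open V"
  by (simp add: coord_space_def)

lemma holder_smooth_cong_open:
  assumes "open V" "\<And>x. x \<in> V \<Longrightarrow> f x = g x" "holder_smooth UNIV k \<alpha> f V"
  shows "holder_smooth UNIV k \<alpha> g V"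
  using holder_smooth_cong[of UNIV V f g k \<alpha>] assms openin_coord_space_UNIV by blast

lemma holder_smooth_const:
  fixes W :: "(real^'n) set" and c :: "'b::real_normed_vector"
  shows "holder_smooth I k \<alpha> (\<lambda>x. c) W"
proof (induction k arbitrary: c)
  case (Suc k)
  have "partial_deriv i (\<lambda>x :: real^'n. c) = (\<lambda>x. 0 :: 'b)" for i
    by (auto simp: partial_deriv_def)
  then show ?case using Suc by simp
qed (simp add: locally_holder_on_const)

section \<open>Coordinate subspaces and extension to open sets\<close>

definition coord_proj :: "'n set \<Rightarrow> real^'n \<Rightarrow> real^'n" where
  "coord_proj I x = (\<chi> i. if i \<in> I then x $ i else 0)"

lemma linear_coord_proj: "linear (coord_proj I)"
  by (auto intro!: linearI simp: coord_proj_def vec_eq_iff)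

lemma coord_proj_in [simp]: "coord_proj I x \<in> coord_space I"
  by (simp add: coord_proj_def coord_space_def)

lemma coord_proj_id [simp]: "x \<in> coord_space I \<Longrightarrow> coord_proj I x = x"
  by (auto simp: coord_proj_def coord_space_def vec_eq_iff)

lemma coord_proj_compl [simp]: "x \<in> coord_space (- I) \<Longrightarrow> coord_proj I x = 0"
  by (auto simp: coord_proj_def coord_space_def vec_eq_iff)

lemma subspace_coord_space: "subspace (coord_space I)"
  by (auto simp: subspace_def coord_space_def)

lemma dim_coord_space: "dim (coord_space I :: (real^'n) set) = card I"
  using dim_substandard_cart[where d = I and 'a = real] unfolding coord_space_def by (simp add: dim_vec_eq)

lemma open_vimage_coord_proj:
  assumes "openin (top_of_set (coord_space I)) W"
  shows "open (coord_proj I -` W)"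
proof -
  obtain V where V: "open V" "W = coord_space I \<inter> V" using assms by (auto simp: openin_open)
  have "coord_proj I -` W = coord_proj I -` V" by (auto simp: V)
  moreover have "continuous_on UNIV (coord_proj I)"
    using linear_coord_proj by (rule linear_continuous_on_compose[OF continuous_on_id])
  ultimately show ?thesis using V(1) by (metis open_vimage)
qed

text \<open>The function is made constant along the remaining coordinates, so its partial
  derivatives in these directions vanish. The result lives on an open set of the whole space, where
  total derivatives and the composition rule are available.\<close>

lemma holder_smooth_extend:
  assumes "openin (top_of_set (coord_space I)) W" "holder_smooth I k \<alpha> f W" "0 \<le> \<alpha>"
  shows "holder_smooth UNIV k \<alpha> (\<lambda>x. f (coord_proj I x)) (coord_proj I -` W)"
proof -
  have cont: "continuous_on A (coord_proj I)" for A :: "(real^'a) set"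
    using linear_coord_proj by (rule linear_continuous_on_compose[OF continuous_on_id])
  have cont_f: "continuous_on (coord_proj I -` W) (\<lambda>x. f (coord_proj I x))" if "continuous_on W f"
    for f :: "real^'a \<Rightarrow> 'b"
    using continuous_on_compose2[OF that cont, of "coord_proj I -` W"] by auto
  show ?thesis
    using assms(2)
  proof (induction k arbitrary: f)
    case 0
    have "dist (coord_proj I x) (coord_proj I y) \<le> 1 * dist x y powr 1" for x y :: "real^'a"
      unfolding dist_norm linear_diff[OF linear_coord_proj, symmetric]
      by (auto intro!: norm_le_componentwise_cart simp: coord_proj_def)
    then have "locally_holder_on 1 (coord_proj I) (coord_proj I -` W)"
      unfolding locally_holder_on_def by blast
    then show ?case
      using 0 locally_holder_on_compose[of \<alpha> f W "coord_proj I" "coord_proj I -` W"] assms(3) cont cont_f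
      by auto
  next
    case (Suc k)
    have line: "coord_proj I (x + t *\<^sub>R axis i 1) = coord_proj I x + (if i \<in> I then t *\<^sub>R axis i 1 else 0)"
      for x i t by (auto simp: coord_proj_def vec_eq_iff axis_def)
    show ?case
    proof (rule holder_smooth_SucI[where D = "\<lambda>i x. if i \<in> I then partial_deriv i f (coord_proj I x) else 0"])
      fix i x assume "x \<in> coord_proj I -` W"
      then show "((\<lambda>t. f (coord_proj I (x + t *\<^sub>R axis i 1))) has_vector_derivative
          (if i \<in> I then partial_deriv i f (coord_proj I x) else 0)) (at 0)"
        using holder_smooth_SucD[OF Suc.prems, of i "coord_proj I x"] by (auto simp: line)
    next
      fix i :: 'a
      show "holder_smooth UNIV k \<alpha> (\<lambda>x. if i \<in> I then partial_deriv i f (coord_proj I x) else 0) (coord_proj I -` W)"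
        using Suc.IH[of "partial_deriv i f"] Suc.prems holder_smooth_const by (cases "i \<in> I") auto
    qed (use Suc.prems cont_f open_vimage_coord_proj[OF assms(1)] in auto)
  qed
qed

subsection \<open>Continuous partial derivatives\<close>

text \<open>The coordinates of \<open>h\<close> are switched on one after another. In each step the
  linear term is subtracted from \<open>f\<close> on a segment parallel to an axis, and the mean
  value inequality bounds the rest by the oscillation of a single \<open>D i\<close>.\<close>

lemma has_derivative_partial_derivs:
  fixes f :: "real^'n \<Rightarrow> 'b::real_normed_vector"
  assumes V: "open V" "x \<in> V"
    and pd: "\<And>i x. x \<in> V \<Longrightarrow> ((\<lambda>t. f (x + t *\<^sub>R axis i 1)) has_vector_derivative D i x) (at 0)"
    and cont: "\<And>i. continuous_on V (D i)"
  shows "(f has_derivative (\<lambda>h. \<Sum>i\<in>UNIV. h $ i *\<^sub>R D i x)) (at x)"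
  unfolding has_derivative_at_alt
proof (intro conjI allI impI)
  show "bounded_linear (\<lambda>h. \<Sum>i\<in>UNIV. h $ i *\<^sub>R D i x)"
    by (intro bounded_linear_sum bounded_linear_compose[OF bounded_linear_scaleR_left] bounded_linear_vec_nth)
next
  fix e :: real assume "0 < e"
  \<comment> \<open>The final error is \<epsilon> times the sum of the
    \<open>\<bar>h $ i\<bar>\<close>, which is at most \<open>CARD('n) * norm h\<close>.\<close>
  define \<epsilon> where "\<epsilon> = e / CARD('n)"
  have \<epsilon>: "0 < \<epsilon>" using \<open>0 < e\<close> by (simp add: \<epsilon>_def)
  have "\<exists>d>0. \<forall>y\<in>V. dist y x < d \<longrightarrow> dist (D i y) (D i x) < \<epsilon>" for i
    using cont[of i] V(2) \<epsilon> unfolding continuous_on_iff by blast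
  then obtain \<delta> where \<delta>: "\<And>i. \<delta> i > 0" "\<And>i y. y \<in> V \<Longrightarrow> dist y x < \<delta> i \<Longrightarrow> dist (D i y) (D i x) < \<epsilon>"
    by metis
  obtain r where r: "r > 0" "ball x r \<subseteq> V" using V open_contains_ball by blast
  define d where "d = min r (Min (range \<delta>))"
  have d: "d > 0" "d \<le> r" "\<And>i. d \<le> \<delta> i" using r \<delta>(1) by (auto simp: d_def Min_gr_iff min.coboundedI2)
  have inV: "x + h \<in> V" if "norm h < d" for h
    using that d r by (auto simp: dist_norm subset_eq)
  have Dbound: "norm (D i (x + h) - D i x) \<le> \<epsilon>" if "norm h < d" for i h
    using \<delta>(2)[of "x + h" i] inV[OF that] that d(3)[of i] by (auto simp: dist_norm)
  have main: "norm (f (x + h) - f x - (\<Sum>i\<in>J. h $ i *\<^sub>R D i x)) \<le> \<epsilon> * (\<Sum>i\<in>J. \<bar>h $ i\<bar>)"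
    if "finite J" "\<forall>i. i \<notin> J \<longrightarrow> h $ i = 0" "norm h < d" for J h
    using that
  proof (induction J arbitrary: h rule: finite_induct)
    case empty
    then have "h = 0" by (simp add: vec_eq_iff)
    then show ?case by simp
  next
    case (insert i J)
    define h' where "h' = (\<chi> j. if j = i then 0 else h $ j)"
    have hh: "h = h' + (h $ i) *\<^sub>R axis i 1" by (auto simp: h'_def vec_eq_iff axis_def)
    have small: "norm (h' + s *\<^sub>R axis i 1) < d" if "\<bar>s\<bar> \<le> \<bar>h $ i\<bar>" for s
    proof -
      have "norm (h' + s *\<^sub>R axis i 1) \<le> norm h"
        using that by (intro norm_le_componentwise_cart) (auto simp: h'_def axis_def)
      then show ?thesis using insert.prems(2) by simp
    qed
    have IH: "norm (f (x + h') - f x - (\<Sum>j\<in>J. h' $ j *\<^sub>R D j x)) \<le> \<epsilon> * (\<Sum>j\<in>J. \<bar>h' $ j\<bar>)"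
      using insert.prems(1) small[of 0] by (intro insert.IH) (auto simp: h'_def)
    have hJ: "h' $ j = h $ j" if "j \<in> J" for j
      using that insert.hyps by (auto simp: h'_def)
    define \<phi> where "\<phi> s = f (x + h' + s *\<^sub>R axis i 1) - s *\<^sub>R D i x" for s
    have der: "(\<phi> has_derivative (\<lambda>t. t *\<^sub>R (D i (x + h' + s *\<^sub>R axis i 1) - D i x))) (at s within S)"
      if "\<bar>s\<bar> \<le> \<bar>h $ i\<bar>" for s S
    proof -
      have "((\<lambda>t. f ((x + h' + s *\<^sub>R axis i 1) + t *\<^sub>R axis i 1)) has_vector_derivative
          D i (x + h' + s *\<^sub>R axis i 1)) (at (s - s))"
        using pd[OF inV[OF small[OF that]]] by (simp add: add.assoc)
      moreover have shift: "((\<lambda>t. t - s) has_vector_derivative 1) (at s)"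
        by (auto intro!: derivative_eq_intros)
      ultimately have "((\<lambda>t. f ((x + h' + s *\<^sub>R axis i 1) + (t - s) *\<^sub>R axis i 1)) has_vector_derivative
          D i (x + h' + s *\<^sub>R axis i 1)) (at s)"
        using vector_diff_chain_at[of "\<lambda>t. t - s" 1 s "\<lambda>t. f ((x + h' + s *\<^sub>R axis i 1) + t *\<^sub>R axis i 1)"
            "D i (x + h' + s *\<^sub>R axis i 1)", OF shift] by (simp add: o_def)
      then have "((\<lambda>t. f (x + h' + t *\<^sub>R axis i 1)) has_vector_derivative
          D i (x + h' + s *\<^sub>R axis i 1)) (at s)"
        by (simp add: scaleR_diff_left add.assoc)
      moreover have "((\<lambda>t. t *\<^sub>R D i x) has_vector_derivative D i x) (at s)"
        by (auto intro!: derivative_eq_intros)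
      ultimately have "(\<phi> has_vector_derivative (D i (x + h' + s *\<^sub>R axis i 1) - D i x)) (at s within S)"
        unfolding \<phi>_def by (rule has_vector_derivative_at_within[OF has_vector_derivative_diff])
      then show ?thesis by (simp add: has_vector_derivative_def)
    qed
    have seg: "\<bar>s\<bar> \<le> \<bar>h $ i\<bar>" if "s \<in> closed_segment 0 (h $ i)" for s
      using that by (auto simp: closed_segment_eq_real_ivl split: if_splits)
    have "norm (\<phi> (h $ i) - \<phi> 0) \<le> \<epsilon> * norm (h $ i - 0)"
    proof (rule differentiable_bound[OF convex_closed_segment[of 0 "h $ i"]])
      fix s assume "s \<in> closed_segment 0 (h $ i)"
      then show "(\<phi> has_derivative (\<lambda>t. t *\<^sub>R (D i (x + h' + s *\<^sub>R axis i 1) - D i x)))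
          (at s within closed_segment 0 (h $ i))"
        "onorm (\<lambda>t. t *\<^sub>R (D i (x + h' + s *\<^sub>R axis i 1) - D i x)) \<le> \<epsilon>"
        using der seg Dbound[OF small] by (auto simp: onorm_scaleR_left[OF bounded_linear_ident] onorm_id add.assoc)
    qed auto
    moreover have "f (x + h) = \<phi> (h $ i) + h $ i *\<^sub>R D i x" "f (x + h') = \<phi> 0"
      unfolding \<phi>_def by (subst hh) (auto simp: add.assoc)
    ultimately have "norm (f (x + h) - f (x + h') - h $ i *\<^sub>R D i x) \<le> \<epsilon> * \<bar>h $ i\<bar>" by simp
    moreover have "f (x + h) - f x - (\<Sum>i\<in>insert i J. h $ i *\<^sub>R D i x) =
        (f (x + h) - f (x + h') - h $ i *\<^sub>R D i x) + (f (x + h') - f x - (\<Sum>j\<in>J. h' $ j *\<^sub>R D j x))"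
      using insert.hyps hJ by (simp add: algebra_simps)
    ultimately have "norm (f (x + h) - f x - (\<Sum>i\<in>insert i J. h $ i *\<^sub>R D i x)) \<le>
        \<epsilon> * \<bar>h $ i\<bar> + \<epsilon> * (\<Sum>j\<in>J. \<bar>h' $ j\<bar>)"
      using IH by (metis (no_types, lifting) add_mono norm_triangle_le)
    also have "\<dots> = \<epsilon> * (\<Sum>i\<in>insert i J. \<bar>h $ i\<bar>)"
      using insert.hyps hJ by (simp add: distrib_left)
    finally show ?case .
  qed
  show "\<exists>d>0. \<forall>y. norm (y - x) < d \<longrightarrow>
      norm (f y - f x - (\<Sum>i\<in>UNIV. (y - x) $ i *\<^sub>R D i x)) \<le> e * norm (y - x)"
  proof (intro exI[of _ d] conjI d(1) allI impI)
    fix y assume y: "norm (y - x) < d"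
    have "norm (f y - f x - (\<Sum>i\<in>UNIV. (y - x) $ i *\<^sub>R D i x)) \<le> \<epsilon> * (\<Sum>i\<in>UNIV. \<bar>(y - x) $ i\<bar>)"
      using main[of UNIV "y - x"] y by simp
    also have "\<dots> \<le> \<epsilon> * (\<Sum>i\<in>(UNIV :: 'n set). norm (y - x))"
      using \<epsilon> by (intro mult_left_mono sum_mono component_le_norm_cart) auto
    also have "\<dots> = e * norm (y - x)" by (simp add: \<epsilon>_def)
    finally show "norm (f y - f x - (\<Sum>i\<in>UNIV. (y - x) $ i *\<^sub>R D i x)) \<le> e * norm (y - x)" .
  qed
qed

lemma holder_smooth_has_derivative:
  fixes f :: "real^'n \<Rightarrow> 'b::real_normed_vector"
  assumes "open V" "holder_smooth UNIV (Suc k) \<alpha> f V" "x \<in> V"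
  shows "(f has_derivative (\<lambda>h. \<Sum>i\<in>UNIV. h $ i *\<^sub>R partial_deriv i f x)) (at x)"
  using assms by (intro has_derivative_partial_derivs[OF assms(1)] holder_smooth_SucD[OF assms(2)]) (auto intro: holder_smooth_continuous)

text \<open>Stated for bare partial derivatives, since the bootstrap argument requires the Lipschitz
  property before any Hoelder class of the map is known.\<close>

lemma locally_Lipschitz_partial_derivs:
  fixes f :: "real^'n \<Rightarrow> 'b::real_normed_vector"
  assumes V: "open V"
    and pd: "\<And>i x. x \<in> V \<Longrightarrow> ((\<lambda>t. f (x + t *\<^sub>R axis i 1)) has_vector_derivative D i x) (at 0)"
    and cont: "\<And>i. continuous_on V (D i)"
  shows "locally_holder_on 1 f V"
proof (rule locally_holder_onI)
  fix p assume p: "p \<in> V"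
  have "\<exists>U. open U \<and> p \<in> U \<and> (\<forall>x\<in>U \<inter> V. norm (D i x) \<le> norm (D i p) + 1)" for i
  proof -
    from continuous_on_norm_bound[OF cont p] show ?thesis by (metis IntD1 IntD2)
  qed
  then obtain U where U: "\<And>i. open (U i)" "\<And>i. p \<in> U i"
    "\<And>i x. x \<in> U i \<Longrightarrow> x \<in> V \<Longrightarrow> norm (D i x) \<le> norm (D i p) + 1"
    by (metis IntI)
  have "open (V \<inter> (\<Inter>i. U i))" "p \<in> V \<inter> (\<Inter>i. U i)" using U V p by (auto intro!: open_Int open_INT)
  then obtain r where r: "r > 0" "ball p r \<subseteq> V \<inter> (\<Inter>i. U i)" by (rule openE)
  define M where "M = (\<Sum>i\<in>(UNIV :: 'n set). norm (D i p) + 1)"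
  have on: "onorm (\<lambda>h. \<Sum>i\<in>UNIV. h $ i *\<^sub>R D i x) \<le> M" if "x \<in> ball p r" for x
  proof (rule onorm_le)
    fix h :: "real^'n"
    have "norm (\<Sum>i\<in>UNIV. h $ i *\<^sub>R D i x) \<le> (\<Sum>i\<in>UNIV. norm h * (norm (D i p) + 1))"
    proof (intro sum_norm_le)
      fix i :: 'n
      have "norm (D i x) \<le> norm (D i p) + 1" using U(3)[of x i] r that by blast
      then show "norm (h $ i *\<^sub>R D i x) \<le> norm h * (norm (D i p) + 1)"
        by (auto intro!: mult_mono component_le_norm_cart)
    qed
    then show "norm (\<Sum>i\<in>UNIV. h $ i *\<^sub>R D i x) \<le> M * norm h"
      by (simp add: M_def sum_distrib_left[symmetric] mult.commute)
  qed
  have "norm (f x - f y) \<le> M * norm (x - y)" if "x \<in> ball p r" "y \<in> ball p r" for x y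
    using that r on
    by (intro differentiable_bound[OF convex_ball, of p r f "\<lambda>x h. \<Sum>i\<in>UNIV. h $ i *\<^sub>R D i x"])
      (auto intro!: has_derivative_at_withinI[OF has_derivative_partial_derivs[OF V _ pd cont]])
  then show "\<exists>U C. open U \<and> p \<in> U \<and>
    (\<forall>x y. x \<in> U \<longrightarrow> x \<in> V \<longrightarrow> y \<in> U \<longrightarrow> y \<in> V \<longrightarrow> dist (f x) (f y) \<le> C * dist x y powr 1)"
    using r by (intro exI[of _ "ball p r"] exI[of _ M]) (auto simp: dist_norm)
qed

lemma holder_smooth_locally_Lipschitz:
  fixes f :: "real^'n \<Rightarrow> 'b::real_normed_vector"
  assumes "open V" "holder_smooth UNIV (Suc k) \<alpha> f V"
  shows "locally_holder_on 1 f V"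
  using assms by (intro locally_Lipschitz_partial_derivs[OF assms(1) holder_smooth_SucD[OF assms(2)]]) (auto intro: holder_smooth_continuous)

lemma holder_smooth_locally_holder:
  fixes f :: "real^'n \<Rightarrow> 'b::real_normed_vector"
  assumes "open V" "holder_smooth UNIV k \<alpha> f V" "\<alpha> \<le> 1"
  shows "locally_holder_on \<alpha> f V"
  using assms locally_holder_on_mono[OF holder_smooth_locally_Lipschitz, of V _ \<alpha> f \<alpha>] by (cases k) auto

text \<open>Only the base case has content: continuous first derivatives make the function locally
  Lipschitz, hence \<alpha>-Hoelder when \<open>\<alpha> \<le> 1\<close>.\<close>

lemma holder_smooth_Suc_imp:
  fixes f :: "real^'n \<Rightarrow> 'b::real_normed_vector"
  assumes "open V" "\<alpha> \<le> 1"
  shows "holder_smooth UNIV (Suc k) \<alpha> f V \<Longrightarrow> holder_smooth UNIV k \<alpha> f V"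
proof (induction k arbitrary: f)
  case 0
  then show ?case using holder_smooth_locally_holder[OF assms(1) 0 assms(2)] by simp
qed simp

lemma holder_smooth_mono_order:
  fixes f :: "real^'n \<Rightarrow> 'b::real_normed_vector"
  assumes "open V" "\<alpha> \<le> 1"
  shows "holder_smooth UNIV k \<alpha> f V \<Longrightarrow> j \<le> k \<Longrightarrow> holder_smooth UNIV j \<alpha> f V"
proof (induction k)
  case (Suc k)
  then show ?case using holder_smooth_Suc_imp[OF assms Suc.prems(1)] by (cases "j = Suc k") auto
qed simp

lemma holder_smooth_mono_exponent:
  assumes "holder_smooth I k \<beta> f V" "\<alpha> \<le> \<beta>"
  shows "holder_smooth I k \<alpha> f V"
  using assms by (induction k arbitrary: f) (auto intro: locally_holder_on_mono)

lemma holder_smooth_SucI_derivative: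
  fixes f :: "real^'n \<Rightarrow> 'b::real_normed_vector"
  assumes "open V" and der: "\<And>x. x \<in> V \<Longrightarrow> (f has_derivative f' x) (at x)"
    and "\<And>i. holder_smooth UNIV k \<alpha> (\<lambda>x. f' x (axis i 1)) V"
  shows "holder_smooth UNIV (Suc k) \<alpha> f V"
proof (rule holder_smooth_SucI[where D = "\<lambda>i x. f' x (axis i 1)"])
  show "continuous_on V f"
    using der has_derivative_continuous by (metis continuous_at_imp_continuous_on)
next
  fix i x assume "x \<in> V"
  have "(f has_derivative f' x) (at (x + 0 *\<^sub>R axis i 1))" using der[OF \<open>x \<in> V\<close>] by simp
  moreover have "((\<lambda>t. x + t *\<^sub>R axis i 1) has_vector_derivative axis i 1) (at 0)"
    by (auto intro!: derivative_eq_intros)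
  ultimately show "((\<lambda>t. f (x + t *\<^sub>R axis i 1)) has_vector_derivative f' x (axis i 1)) (at 0)"
    using vector_derivative_diff_chain_within[of "\<lambda>t. x + t *\<^sub>R axis i 1" "axis i 1" 0 UNIV f "f' x"]
    by (simp add: o_def has_derivative_at_withinI)
qed (use assms in auto)

subsection \<open>Closure properties of the classes\<close>

lemma holder_smooth_linear:
  fixes f :: "real^'n \<Rightarrow> 'b::real_normed_vector"
  assumes h: "bounded_linear h" and "open V"
  shows "holder_smooth UNIV k \<alpha> f V \<Longrightarrow> holder_smooth UNIV k \<alpha> (\<lambda>x. h (f x)) V"
proof (induction k arbitrary: f)
  case 0
  then show ?case
    by (auto intro: locally_holder_on_linear[OF h] bounded_linear.continuous_on[OF h])
next
  case (Suc k)
  show ?case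
  proof (rule holder_smooth_SucI)
    show "((\<lambda>t. h (f (x + t *\<^sub>R axis i 1))) has_vector_derivative h (partial_deriv i f x)) (at 0)"
      if "x \<in> V" for i x
      using bounded_linear.has_vector_derivative[OF h holder_smooth_SucD[OF Suc.prems _ that]] by simp
  qed (use Suc assms in \<open>auto intro: bounded_linear.continuous_on[OF h]\<close>)
qed

lemma holder_smooth_add:
  fixes f g :: "real^'n \<Rightarrow> 'b::real_normed_vector"
  assumes "open V"
  shows "holder_smooth UNIV k \<alpha> f V \<Longrightarrow> holder_smooth UNIV k \<alpha> g V \<Longrightarrow> holder_smooth UNIV k \<alpha> (\<lambda>x. f x + g x) V"
proof (induction k arbitrary: f g)
  case 0
  then show ?case using locally_holder_on_add by (auto intro: continuous_on_add)
next
  case (Suc k)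
  show ?case
  proof (rule holder_smooth_SucI)
    show "((\<lambda>t. f (x + t *\<^sub>R axis i 1) + g (x + t *\<^sub>R axis i 1)) has_vector_derivative
        (partial_deriv i f x + partial_deriv i g x)) (at 0)" if "x \<in> V" for i x
      using holder_smooth_SucD[OF Suc.prems(1) _ that] holder_smooth_SucD[OF Suc.prems(2) _ that] by (auto intro: has_vector_derivative_add)
  qed (use Suc assms in \<open>auto intro: continuous_on_add\<close>)
qed

lemma holder_smooth_sum:
  fixes f :: "'i \<Rightarrow> real^'n \<Rightarrow> 'b::real_normed_vector"
  assumes "open V" "\<And>i. i \<in> A \<Longrightarrow> holder_smooth UNIV k \<alpha> (f i) V"
  shows "holder_smooth UNIV k \<alpha> (\<lambda>x. \<Sum>i\<in>A. f i x) V"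
  using assms(2) by (induction A rule: infinite_finite_induct) (auto intro: holder_smooth_const holder_smooth_add[OF assms(1)])

lemma holder_smooth_uminus: "open V \<Longrightarrow> holder_smooth UNIV k \<alpha> f V \<Longrightarrow> holder_smooth UNIV k \<alpha> (\<lambda>x. - f x) V"
  by (rule holder_smooth_linear[OF bounded_linear_minus[OF bounded_linear_ident]])

lemma holder_smooth_diff: "open V \<Longrightarrow> holder_smooth UNIV k \<alpha> f V \<Longrightarrow> holder_smooth UNIV k \<alpha> g V \<Longrightarrow> holder_smooth UNIV k \<alpha> (\<lambda>x. f x - g x) V"
  using holder_smooth_add[of V k \<alpha> f "\<lambda>x. - g x"] holder_smooth_uminus[of V k \<alpha> g] by simp

lemma holder_smooth_bilinear:
  fixes f :: "real^'n \<Rightarrow> 'b::real_normed_vector" and g :: "real^'n \<Rightarrow> 'c::real_normed_vector"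
  assumes pr: "bounded_bilinear pr" and V: "open V" and \<alpha>: "\<alpha> \<le> 1"
  shows "holder_smooth UNIV k \<alpha> f V \<Longrightarrow> holder_smooth UNIV k \<alpha> g V \<Longrightarrow> holder_smooth UNIV k \<alpha> (\<lambda>x. pr (f x) (g x)) V"
proof (induction k arbitrary: f g)
  case 0
  then show ?case
    using locally_holder_on_bilinear[OF pr] by (auto intro: bounded_bilinear.continuous_on[OF pr])
next
  case (Suc k)
  show ?case
  proof (rule holder_smooth_SucI)
    show "((\<lambda>t. pr (f (x + t *\<^sub>R axis i 1)) (g (x + t *\<^sub>R axis i 1))) has_vector_derivative
        (pr (f x) (partial_deriv i g x) + pr (partial_deriv i f x) (g x))) (at 0)" if "x \<in> V" for i x
      using bounded_bilinear.has_vector_derivative[OF pr holder_smooth_SucD[OF Suc.prems(1) _ that] holder_smooth_SucD[OF Suc.prems(2) _ that]]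
      by simp
    show "holder_smooth UNIV k \<alpha> (\<lambda>x. pr (f x) (partial_deriv i g x) + pr (partial_deriv i f x) (g x)) V" for i
      using holder_smooth_Suc_imp[OF V \<alpha> Suc.prems(1)] holder_smooth_Suc_imp[OF V \<alpha> Suc.prems(2)] Suc.prems
      by (intro holder_smooth_add[OF V] Suc.IH) simp_all
    show "continuous_on V (\<lambda>x. pr (f x) (g x))"
      using Suc.prems by (auto intro: bounded_bilinear.continuous_on[OF pr])
  qed (use V in auto)
qed

text \<open>The Lipschitz property of \<open>g\<close> is a separate assumption: from order 1 on it
  follows from the class, but the induction on \<open>k\<close> descends to order 0, where the class
  only gives exponent \<alpha>.\<close>

lemma holder_smooth_compose:
  fixes f :: "real^'m \<Rightarrow> 'b::real_normed_vector" and g :: "real^'n \<Rightarrow> real^'m"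
  assumes V: "open V" and W: "open W" and \<alpha>: "0 \<le> \<alpha>" "\<alpha> \<le> 1" and sub: "g ` W \<subseteq> V"
    and lip: "locally_holder_on 1 g W"
  shows "holder_smooth UNIV k \<alpha> f V \<Longrightarrow> holder_smooth UNIV k \<alpha> g W \<Longrightarrow> holder_smooth UNIV k \<alpha> (\<lambda>x. f (g x)) W"
proof (induction k arbitrary: f)
  case 0
  then show ?case
    using locally_holder_on_compose[OF _ lip _ sub \<alpha>(1)] sub by (auto intro: continuous_on_compose2)
next
  case (Suc k)
  have IH: "holder_smooth UNIV k \<alpha> (\<lambda>x. partial_deriv j f (g x)) W" for j
    using Suc.prems holder_smooth_Suc_imp[OF W \<alpha>(2) Suc.prems(2)] by (intro Suc.IH) simp_all
  show ?case
  proof (rule holder_smooth_SucI)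
    fix i x assume x: "x \<in> W"
    have "(f has_derivative (\<lambda>h. \<Sum>j\<in>UNIV. h $ j *\<^sub>R partial_deriv j f (g x))) (at (g (x + 0 *\<^sub>R axis i 1)))"
      using holder_smooth_has_derivative[OF V Suc.prems(1), of "g x"] sub x by auto
    then show "((\<lambda>t. f (g (x + t *\<^sub>R axis i 1))) has_vector_derivative
        (\<Sum>j\<in>UNIV. (partial_deriv i g x) $ j *\<^sub>R partial_deriv j f (g x))) (at 0)"
      using vector_derivative_diff_chain_within[OF holder_smooth_SucD[OF Suc.prems(2) _ x], of i f
          "\<lambda>h. \<Sum>j\<in>UNIV. h $ j *\<^sub>R partial_deriv j f (g x)"]
      by (simp add: o_def has_derivative_at_withinI)
  next
    fix i
    show "holder_smooth UNIV k \<alpha> (\<lambda>x. \<Sum>j\<in>UNIV. (partial_deriv i g x) $ j *\<^sub>R partial_deriv j f (g x)) W"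
      using Suc.prems(2)
      by (intro holder_smooth_sum[OF W] holder_smooth_bilinear[OF bounded_bilinear_scaleR W \<alpha>(2)] IH
        holder_smooth_linear[OF bounded_linear_vec_nth W]) auto
  qed (use Suc.prems sub W in \<open>auto intro: continuous_on_compose2\<close>)
qed

text \<open>Order \<open>Suc k\<close> with exponent 1 is immediate since the first derivatives are
  constant; lower orders and exponents follow by monotonicity.\<close>

lemma holder_smooth_affine:
  fixes h :: "real^'n \<Rightarrow> 'b::real_normed_vector"
  assumes "bounded_linear h" "\<alpha> \<le> 1"
  shows "holder_smooth UNIV k \<alpha> h UNIV"
proof -
  have "holder_smooth UNIV (Suc k) 1 h UNIV" for k
    by (rule holder_smooth_SucI_derivative[OF open_UNIV]) (auto intro: bounded_linear.has_derivative[OF assms(1) has_derivative_ident] holder_smooth_const)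
  from holder_smooth_mono_exponent[OF this assms(2)] show ?thesis
    by (rule holder_smooth_Suc_imp[OF open_UNIV assms(2)])
qed

lemma holder_smooth_Pair:
  fixes f :: "real^'n \<Rightarrow> 'b::real_normed_vector" and g :: "real^'n \<Rightarrow> 'c::real_normed_vector"
  assumes "open V" "holder_smooth UNIV k \<alpha> f V" "holder_smooth UNIV k \<alpha> g V"
  shows "holder_smooth UNIV k \<alpha> (\<lambda>x. (f x, g x)) V"
proof -
  have "bounded_linear (\<lambda>y :: 'b. (y, 0 :: 'c))" "bounded_linear (\<lambda>z :: 'c. (0 :: 'b, z))"
    by (auto intro!: bounded_linear_Pair bounded_linear_ident bounded_linear_zero)
  from holder_smooth_add[OF assms(1) holder_smooth_linear[OF this(1) assms(1,2)] holder_smooth_linear[OF this(2) assms(1,3)]]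
  show ?thesis by simp
qed

lemma holder_smooth_local:
  assumes "open V" "\<And>p. p \<in> V \<Longrightarrow> \<exists>U. open U \<and> p \<in> U \<and> U \<subseteq> V \<and> holder_smooth UNIV k \<alpha> f U"
  shows "holder_smooth UNIV k \<alpha> f V"
  using assms(2)
proof (induction k arbitrary: f)
  case 0
  have "continuous_on V f"
  proof (rule continuous_at_imp_continuous_on, rule ballI)
    fix p assume "p \<in> V"
    then obtain U where "open U" "p \<in> U" "continuous_on U f" using 0[of p] by auto
    then show "isCont f p" by (simp add: continuous_on_eq_continuous_at)
  qed
  moreover have "locally_holder_on \<alpha> f V"
    unfolding locally_holder_on_def
  proof
    fix p assume "p \<in> V"
    then obtain U where U: "open U" "p \<in> U" "U \<subseteq> V" "locally_holder_on \<alpha> f U" using 0[of p] by auto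
    from locally_holder_onE[OF U(4,2)] obtain A C where "open A" "p \<in> A"
      "\<And>x y. x \<in> A \<Longrightarrow> x \<in> U \<Longrightarrow> y \<in> A \<Longrightarrow> y \<in> U \<Longrightarrow> dist (f x) (f y) \<le> C * dist x y powr \<alpha>"
      by metis
    then show "\<exists>A C. open A \<and> p \<in> A \<and> (\<forall>x\<in>A \<inter> V. \<forall>y\<in>A \<inter> V. dist (f x) (f y) \<le> C * dist x y powr \<alpha>)"
      using U by (intro exI[of _ "A \<inter> U"] exI[of _ C]) auto
  qed
  ultimately show ?case by simp
next
  case (Suc k)
  have "continuous_on V f"
  proof (rule continuous_at_imp_continuous_on, rule ballI)
    fix p assume "p \<in> V"
    then obtain U where "open U" "p \<in> U" "continuous_on U f" using Suc.prems[of p] by auto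
    then show "isCont f p" by (simp add: continuous_on_eq_continuous_at)
  qed
  moreover have "(\<lambda>t. f (x + t *\<^sub>R axis i 1)) differentiable at 0" if "x \<in> V" for x i
    using Suc.prems[OF that] by auto
  moreover have "holder_smooth UNIV k \<alpha> (partial_deriv i f) V" for i
  proof (rule Suc.IH)
    fix p assume "p \<in> V"
    then show "\<exists>U. open U \<and> p \<in> U \<and> U \<subseteq> V \<and> holder_smooth UNIV k \<alpha> (partial_deriv i f) U"
      using Suc.prems[of p] by auto
  qed
  ultimately show ?case by simp
qed

subsection \<open>Matrices\<close>

lemma bounded_bilinear_matrix_matrix_mult:
  "bounded_bilinear ((**) :: real^'n^'m \<Rightarrow> real^'p^'n \<Rightarrow> real^'p^'m)"
  unfolding bilinear_conv_bounded_bilinear[symmetric] bilinear_def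
  by (intro conjI allI linearI)
    (simp_all add: matrix_matrix_mult_def vec_eq_iff sum.distrib[symmetric] sum_distrib_left distrib_left distrib_right mult.left_commute mult.assoc)

lemma bounded_bilinear_matrix_vector_mult:
  "bounded_bilinear ((*v) :: real^'n^'m \<Rightarrow> real^'n \<Rightarrow> real^'m)"
  unfolding bilinear_conv_bounded_bilinear[symmetric] bilinear_def
  by (intro conjI allI linearI)
    (simp_all add: matrix_vector_mult_def vec_eq_iff sum.distrib[symmetric] sum_distrib_left distrib_left distrib_right mult.left_commute mult.assoc)

lemma matrix_vector_mult_bound:
  obtains K where "K > 0" "\<And>(A :: real^'n^'m) x. norm (A *v x) \<le> K * norm A * norm x"
proof -
  obtain K where "0 < K" "\<And>(A :: real^'n^'m) x. norm (A *v x) \<le> norm A * norm x * K"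
    using bounded_bilinear.pos_bounded[OF bounded_bilinear_matrix_vector_mult] by - (elim exE conjE, intro that, auto)
  then show ?thesis using that[of K] by (simp add: mult_ac)
qed

text \<open>Both parts rest on the resolvent identity
  \<open>R y - R x = R y ** (K x - K y) ** R x\<close>. It gives continuity, the Hoelder bound and,
  in the limit of difference quotients, the derivative, which is again a product of
  \<open>R\<close>, a derivative of \<open>K\<close>, and \<open>R\<close>; so the induction on
  \<open>k\<close> closes.\<close>

lemma
  fixes K R :: "real^'m \<Rightarrow> real^'n^'n"
  assumes inv: "\<And>x. x \<in> V \<Longrightarrow> K x ** R x = mat 1" "\<And>x. x \<in> V \<Longrightarrow> R x ** K x = mat 1"
  shows continuous_on_matrix_inverse: "continuous_on V K \<Longrightarrow> continuous_on V R"
    and holder_smooth_matrix_inverse: "open V \<Longrightarrow> \<alpha> \<le> 1 \<Longrightarrow> holder_smooth UNIV k \<alpha> K V \<Longrightarrow> holder_smooth UNIV k \<alpha> R V"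
proof -
  have bb: "bounded_bilinear ((**) :: real^'n^'n \<Rightarrow> real^'n^'n \<Rightarrow> real^'n^'n)"
    by (rule bounded_bilinear_matrix_matrix_mult)
  obtain C where C: "0 < C" "\<And>(A :: real^'n^'n) (B :: real^'n^'n). norm (A ** B) \<le> norm A * norm B * C"
    using bounded_bilinear.pos_bounded[OF bb] by auto
  have diff: "R y - R x = R y ** (K x - K y) ** R x" if "x \<in> V" "y \<in> V" for x y
  proof -
    have "R y ** (K x - K y) ** R x = R y ** (K x ** R x) - (R y ** K y) ** R x"
      by (simp add: bounded_bilinear.diff_left[OF bb] bounded_bilinear.diff_right[OF bb] matrix_mul_assoc)
    then show ?thesis using inv that by simp
  qed
  have bound: "norm (R y - R x) \<le> C * C * norm (R y) * norm (K x - K y) * norm (R x)" if "x \<in> V" "y \<in> V" for x y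
  proof -
    have "norm (R y - R x) \<le> norm (R y ** (K x - K y)) * norm (R x) * C"
      unfolding diff[OF that] by (rule C)
    also have "\<dots> \<le> (norm (R y) * norm (K x - K y) * C) * norm (R x) * C"
      using C by (intro mult_right_mono) auto
    finally show ?thesis by (simp add: mult_ac)
  qed
  show cont: "continuous_on V R" if K: "continuous_on V K"
    unfolding continuous_on_def
  proof
    fix x assume x: "x \<in> V"
    have in_V: "eventually (\<lambda>y. y \<in> V) (at x within V)"
      by (simp add: eventually_at_filter)
    have lim: "((\<lambda>y. norm (K x - K y)) \<longlongrightarrow> 0) (at x within V)"
      using K x unfolding continuous_on_def by (auto intro!: tendsto_eq_intros)
    have lim': "((\<lambda>y. c * norm (K x - K y) * norm (R x)) \<longlongrightarrow> 0) (at x within V)" for c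
      using tendsto_mult[OF tendsto_mult[OF tendsto_const lim] tendsto_const[of "norm (R x)"], of c] by simp
    \<comment> \<open>Once this quantity is below 1/2,
      \<open>norm (R y) \<le> norm (R x) + norm (R y) / 2\<close>. This bounds \<open>R y\<close>
      near \<open>x\<close> before its continuity is known.\<close>
    from lim'[of "C * C"]
    have ev: "eventually (\<lambda>y. C * C * norm (K x - K y) * norm (R x) < 1/2) (at x within V)"
      by (rule order_tendstoD) simp
    have "eventually (\<lambda>y. norm (R y - R x) \<le> C * C * (2 * norm (R x)) * norm (K x - K y) * norm (R x)) (at x within V)"
      using ev in_V
    proof eventually_elim
      case (elim y)
      show ?case
      proof (cases "y \<in> V")
        case True
        have "norm (R y) \<le> norm (R x) + norm (R y - R x)"
          by (metis add.commute norm_triangle_sub)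
        also have "norm (R y - R x) \<le> norm (R y) * (C * C * norm (K x - K y) * norm (R x))"
          using bound[OF x True] by (simp add: mult_ac)
        also have "\<dots> \<le> norm (R y) * (1/2)"
          using elim(1) by (intro mult_left_mono) auto
        finally have "norm (R y) \<le> 2 * norm (R x)" by simp
        then have "C * C * norm (R y) * norm (K x - K y) * norm (R x) \<le>
            C * C * (2 * norm (R x)) * norm (K x - K y) * norm (R x)"
          using C by (intro mult_right_mono mult_left_mono) auto
        then show ?thesis using bound[OF x True] by linarith
      qed (use elim(2) in auto)
    qed
    moreover have "((\<lambda>y. C * C * (2 * norm (R x)) * norm (K x - K y) * norm (R x)) \<longlongrightarrow> 0) (at x within V)"
      by (rule lim')
    ultimately have "((\<lambda>y. R y - R x) \<longlongrightarrow> 0) (at x within V)"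
      by (rule Lim_null_comparison)
    then show "(R \<longlongrightarrow> R x) (at x within V)" by (simp add: LIM_zero_iff)
  qed
  assume V: "open V" and \<alpha>: "\<alpha> \<le> 1"
  show "holder_smooth UNIV k \<alpha> K V \<Longrightarrow> holder_smooth UNIV k \<alpha> R V"
  proof (induction k)
    case 0
    then have contK: "continuous_on V K" and hK: "locally_holder_on \<alpha> K V" by auto
    have "locally_holder_on \<alpha> R V"
    proof (rule locally_holder_onI)
      fix p assume p: "p \<in> V"
      obtain U where U: "open U" "p \<in> U" "\<And>x. x \<in> U \<Longrightarrow> x \<in> V \<Longrightarrow> norm (R x) \<le> norm (R p) + 1"
        using continuous_on_norm_bound[OF cont[OF contK] p] by blast
      obtain A B where A: "open A" "p \<in> A" "0 \<le> B"
        "\<And>x y. x \<in> A \<Longrightarrow> x \<in> V \<Longrightarrow> y \<in> A \<Longrightarrow> y \<in> V \<Longrightarrow> dist (K x) (K y) \<le> B * dist x y powr \<alpha>"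
        using locally_holder_onE[OF hK p] by metis
      let ?M = "norm (R p) + 1"
      have "dist (R x) (R y) \<le> (C * C * ?M * B * ?M) * dist x y powr \<alpha>"
        if "x \<in> U \<inter> A" "x \<in> V" "y \<in> U \<inter> A" "y \<in> V" for x y
      proof -
        have "dist (R x) (R y) \<le> C * C * norm (R x) * norm (K y - K x) * norm (R y)"
          using bound[of y x] that by (simp add: dist_norm)
        also have "\<dots> \<le> C * C * ?M * (B * dist x y powr \<alpha>) * ?M"
          using that U(3)[of x] U(3)[of y] A(4)[of x y] C A(3)
          by (intro mult_mono) (auto simp: dist_norm norm_minus_commute intro!: mult_nonneg_nonneg)
        finally show ?thesis by (simp add: mult_ac)
      qed
      then show "\<exists>V' C. open V' \<and> p \<in> V' \<and>
        (\<forall>x y. x \<in> V' \<longrightarrow> x \<in> V \<longrightarrow> y \<in> V' \<longrightarrow> y \<in> V \<longrightarrow> dist (R x) (R y) \<le> C * dist x y powr \<alpha>)"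
        using U A by (intro exI[of _ "U \<inter> A"] exI[of _ "C * C * ?M * B * ?M"]) auto
    qed
    then show ?case using cont[OF contK] by simp
  next
    case (Suc k)
    have contR: "continuous_on V R" using Suc.prems by (intro cont) auto
    have IH: "holder_smooth UNIV k \<alpha> R V" by (rule Suc.IH[OF holder_smooth_Suc_imp[OF V \<alpha> Suc.prems]])
    show ?case
    proof (rule holder_smooth_SucI)
      fix i x assume x: "x \<in> V"
      have ev: "eventually (\<lambda>t. x + t *\<^sub>R axis i 1 \<in> V) (at 0)"
        using eventually_line_in[of UNIV V x i] V x by (simp add: eventually_at_filter eventually_mono)
      have "isCont R x" using contR V x by (simp add: continuous_on_eq_continuous_at)
      moreover have "((\<lambda>t. x + t *\<^sub>R axis i 1) \<longlongrightarrow> x) (at 0)" by (auto intro!: tendsto_eq_intros)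
      ultimately have "((\<lambda>t. R (x + t *\<^sub>R axis i 1)) \<longlongrightarrow> R x) (at 0)"
        using isCont_tendsto_compose by blast
      moreover have "((\<lambda>t. (1 / t) *\<^sub>R (K (x + t *\<^sub>R axis i 1) - K x)) \<longlongrightarrow> partial_deriv i K x) (at 0)"
        using holder_smooth_SucD[OF Suc.prems _ x, of i] unfolding has_vector_derivative_at_0_iff by simp
      ultimately have "((\<lambda>t. - (R (x + t *\<^sub>R axis i 1) ** ((1 / t) *\<^sub>R (K (x + t *\<^sub>R axis i 1) - K x)) ** R x)) \<longlongrightarrow>
          - (R x ** partial_deriv i K x ** R x)) (at 0)"
        by (intro tendsto_minus bounded_bilinear.tendsto[OF bb] tendsto_const)
      moreover have "eventually (\<lambda>t. - (R (x + t *\<^sub>R axis i 1) ** ((1 / t) *\<^sub>R (K (x + t *\<^sub>R axis i 1) - K x)) ** R x) =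
          (1 / t) *\<^sub>R (R (x + t *\<^sub>R axis i 1) - R x)) (at 0)"
        using ev
      proof eventually_elim
        case (elim t)
        show ?case unfolding diff[OF x elim]
          by (simp add: bounded_bilinear.diff_right[OF bb] bounded_bilinear.diff_left[OF bb]
              bounded_bilinear.scaleR_right[OF bb] bounded_bilinear.scaleR_left[OF bb] scaleR_diff_right)
      qed
      ultimately show "((\<lambda>t. R (x + t *\<^sub>R axis i 1)) has_vector_derivative - (R x ** partial_deriv i K x ** R x)) (at 0)"
        unfolding has_vector_derivative_at_0_iff using filterlim_cong by force
    next
      show "holder_smooth UNIV k \<alpha> (\<lambda>x. - (R x ** partial_deriv i K x ** R x)) V" for i
        using Suc.prems by (intro holder_smooth_uminus[OF V] holder_smooth_bilinear[OF bb V \<alpha>] IH) auto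
    qed (use V contR in auto)
  qed
qed

section \<open>The Grassmannian\<close>

lemma orthogonal_comp_Int:
  assumes "x \<in> T" "x \<in> orthogonal_comp T"
  shows "x = 0"
  using assms by (auto simp: orthogonal_comp_def orthogonal_def)

lemma inner_orthogonal_comp: "x \<in> T \<Longrightarrow> y \<in> orthogonal_comp T \<Longrightarrow> x \<bullet> y = 0"
  by (auto simp: orthogonal_comp_def orthogonal_def)

text \<open>\<open>proj_matrix\<close> is a definite description of a matrix. Besides the pointwise
  orthogonal decomposition this requires its linearity, which follows from uniqueness of the
  decomposition.\<close>

lemma proj_matrix:
  fixes T :: "(real^'n) set"
  assumes T: "subspace T"
  shows proj_matrix_in: "proj_matrix T *v x \<in> T"
    and proj_matrix_compl: "x - proj_matrix T *v x \<in> orthogonal_comp T"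
proof -
  have "\<exists>y. y \<in> T \<and> x - y \<in> orthogonal_comp T" for x
  proof -
    obtain y z where yz: "y \<in> span T" "\<And>w. w \<in> span T \<Longrightarrow> orthogonal z w" "x = y + z"
      using orthogonal_subspace_decomp_exists by blast
    moreover have "span T = T" using T by (rule span_eq_iff[THEN iffD2])
    ultimately have "y \<in> T" "x - y \<in> orthogonal_comp T"
      by (auto simp: orthogonal_comp_def orthogonal_commute)
    then show ?thesis by blast
  qed
  then obtain \<pi> where \<pi>: "\<And>x. \<pi> x \<in> T" "\<And>x. x - \<pi> x \<in> orthogonal_comp T" by metis
  have uniq: "y = \<pi> x" if "y \<in> T" "x - y \<in> orthogonal_comp T" for x y
  proof -
    have "y - \<pi> x \<in> T" using that \<pi> T by (simp add: subspace_diff)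
    moreover have "(x - \<pi> x) - (x - y) \<in> orthogonal_comp T"
      by (rule subspace_diff[OF subspace_orthogonal_comp \<pi>(2) that(2)])
    then have "y - \<pi> x \<in> orthogonal_comp T" by simp
    ultimately have "y - \<pi> x = 0" by (rule orthogonal_comp_Int)
    then show ?thesis by simp
  qed
  have "linear \<pi>"
  proof (rule linearI)
    fix x y
    have "(x - \<pi> x) + (y - \<pi> y) \<in> orthogonal_comp T"
      by (intro subspace_add subspace_orthogonal_comp \<pi>)
    then have "(x + y) - (\<pi> x + \<pi> y) \<in> orthogonal_comp T" by (simp add: algebra_simps)
    then show "\<pi> (x + y) = \<pi> x + \<pi> y"
      by (intro uniq[symmetric] subspace_add T \<pi>)
  next
    fix c x
    have "c *\<^sub>R (x - \<pi> x) \<in> orthogonal_comp T"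
      by (intro subspace_mul subspace_orthogonal_comp \<pi>)
    then have "c *\<^sub>R x - c *\<^sub>R \<pi> x \<in> orthogonal_comp T" by (simp add: algebra_simps)
    then show "\<pi> (c *\<^sub>R x) = c *\<^sub>R \<pi> x"
      by (intro uniq[symmetric] subspace_mul T \<pi>)
  qed
  then have mat: "matrix \<pi> *v x = \<pi> x" for x by simp
  have "\<forall>x. proj_matrix T *v x \<in> T \<and> x - proj_matrix T *v x \<in> orthogonal_comp T"
    unfolding proj_matrix_def
  proof (rule theI)
    show "\<forall>x. matrix \<pi> *v x \<in> T \<and> x - matrix \<pi> *v x \<in> orthogonal_comp T"
      by (simp add: mat \<pi>)
  next
    fix P assume "\<forall>x. P *v x \<in> T \<and> x - P *v x \<in> orthogonal_comp T"
    then have "P *v x = matrix \<pi> *v x" for x using uniq[of "P *v x" x] by (simp add: mat)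
    then show "P = matrix \<pi>" by (simp add: matrix_eq)
  qed
  then show "proj_matrix T *v x \<in> T" "x - proj_matrix T *v x \<in> orthogonal_comp T" by auto
qed

lemma proj_matrix_unique:
  assumes "subspace T" "y \<in> T" "x - y \<in> orthogonal_comp T"
  shows "proj_matrix T *v x = y"
proof -
  have "y - proj_matrix T *v x \<in> T"
    using assms proj_matrix_in[OF assms(1)] by (simp add: subspace_diff)
  moreover have "(x - proj_matrix T *v x) - (x - y) \<in> orthogonal_comp T"
    by (rule subspace_diff[OF subspace_orthogonal_comp proj_matrix_compl[OF assms(1)] assms(3)])
  then have "y - proj_matrix T *v x \<in> orthogonal_comp T" by simp
  ultimately have "y - proj_matrix T *v x = 0" by (rule orthogonal_comp_Int)
  then show ?thesis by simp
qed

lemma proj_matrix_id: "subspace T \<Longrightarrow> x \<in> T \<Longrightarrow> proj_matrix T *v x = x"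
  by (rule proj_matrix_unique) (auto simp: subspace_0[OF subspace_orthogonal_comp])

lemma proj_matrix_orthogonal: "subspace T \<Longrightarrow> x \<in> orthogonal_comp T \<Longrightarrow> proj_matrix T *v x = 0"
  by (rule proj_matrix_unique) (auto simp: subspace_0)

lemma norm_proj_matrix:
  assumes "subspace T"
  shows "norm (proj_matrix T *v x) \<le> norm x" "norm (x - proj_matrix T *v x) \<le> norm x"
proof -
  let ?y = "proj_matrix T *v x"
  have "?y \<bullet> (x - ?y) = 0"
    using proj_matrix_in[OF assms] proj_matrix_compl[OF assms] by (rule inner_orthogonal_comp)
  then have "(norm ?y)\<^sup>2 + (norm (x - ?y))\<^sup>2 = (norm x)\<^sup>2"
    using norm_add_Pythagorean[of ?y "x - ?y"] by (simp add: orthogonal_def)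
  then have "(norm ?y)\<^sup>2 \<le> (norm x)\<^sup>2" "(norm (x - ?y))\<^sup>2 \<le> (norm x)\<^sup>2"
    using zero_le_power2[of "norm ?y"] zero_le_power2[of "norm (x - ?y)"] by linarith+
  then show "norm ?y \<le> norm x" "norm (x - ?y) \<le> norm x"
    by (auto intro: power2_le_imp_le)
qed

lemma proj_matrix_inj:
  assumes "subspace T" "subspace T'" "proj_matrix T = proj_matrix T'"
  shows "T = T'"
proof -
  have "T = {x. proj_matrix T *v x = x}" if "subspace T" for T :: "(real^'a) set"
    using proj_matrix_in[OF that] proj_matrix_id[OF that] by auto metis
  then show ?thesis using assms by metis
qed

subsection \<open>Charts\<close>

definition graph_over :: "(real^'n) set \<Rightarrow> real^'n^'n \<Rightarrow> (real^'n) set" where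
  "graph_over T0 A = {x + A *v x | x. x \<in> T0}"

text \<open>The normalization built into \<open>Gr_chart\<close>: the extension by 0 on the
  complement makes the matrix unique for a given plane.\<close>

definition chart_matrix :: "(real^'n) set \<Rightarrow> real^'n^'n \<Rightarrow> bool" where
  "chart_matrix T0 A \<longleftrightarrow> (\<forall>x\<in>T0. A *v x \<in> orthogonal_comp T0) \<and> (\<forall>y\<in>orthogonal_comp T0. A *v y = 0)"

lemma
  assumes T0: "subspace T0" and A: "chart_matrix T0 A"
  shows proj_graph_over: "x \<in> T0 \<Longrightarrow> proj_matrix T0 *v (x + A *v x) = x"
    and chart_matrix_proj: "A *v (proj_matrix T0 *v x) = A *v x"
    and subspace_graph_over: "subspace (graph_over T0 A)"
    and dim_graph_over: "dim (graph_over T0 A) = dim T0"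
    and graph_over_transverse: "graph_over T0 A \<inter> orthogonal_comp T0 = {0}"
    and Gr_chart_graph_over: "Gr_chart T0 (graph_over T0 A) = A"
proof -
  show proj: "proj_matrix T0 *v (x + A *v x) = x" if "x \<in> T0" for x
    using that A by (intro proj_matrix_unique[OF T0]) (auto simp: chart_matrix_def)
  show AP: "A *v (proj_matrix T0 *v x) = A *v x" for x
  proof -
    have "A *v (x - proj_matrix T0 *v x) = 0"
      using A proj_matrix_compl[OF T0] by (simp add: chart_matrix_def)
    then show ?thesis by (simp add: matrix_vector_mult_diff_distrib)
  qed
  have im: "graph_over T0 A = (\<lambda>x. x + A *v x) ` T0" by (auto simp: graph_over_def)
  have lin: "linear (\<lambda>x. x + A *v x)"
    by (intro linear_compose_add linear_id[unfolded id_def] matrix_vector_mul_linear)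
  show "subspace (graph_over T0 A)" unfolding im by (rule linear_subspace_image[OF lin T0])
  have "inj_on (\<lambda>x. x + A *v x) T0" by (rule inj_on_inverseI) (rule proj)
  then show "dim (graph_over T0 A) = dim T0" unfolding im
    by (intro dim_image_eq[OF lin]) (simp add: span_eq_iff[THEN iffD2, OF T0])
  show "graph_over T0 A \<inter> orthogonal_comp T0 = {0}"
  proof -
    have "y = 0" if "y \<in> graph_over T0 A" "y \<in> orthogonal_comp T0" for y
    proof -
      from that(1) obtain x where x: "x \<in> T0" "y = x + A *v x" by (auto simp: graph_over_def)
      then show ?thesis using proj[of x] proj_matrix_orthogonal[OF T0 that(2)] by simp
    qed
    moreover have "0 \<in> graph_over T0 A" using subspace_0[OF T0] by (force simp: graph_over_def)
    ultimately show ?thesis using subspace_0[OF subspace_orthogonal_comp[of T0]] by auto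
  qed
  show "Gr_chart T0 (graph_over T0 A) = A"
    unfolding Gr_chart_def
  proof (rule the_equality)
    show "(\<forall>x\<in>T0. A *v x \<in> orthogonal_comp T0) \<and> (\<forall>y\<in>orthogonal_comp T0. A *v y = 0) \<and>
      graph_over T0 A = {x + A *v x |x. x \<in> T0}"
      using A by (auto simp: chart_matrix_def graph_over_def)
  next
    fix B assume B: "(\<forall>x\<in>T0. B *v x \<in> orthogonal_comp T0) \<and> (\<forall>y\<in>orthogonal_comp T0. B *v y = 0) \<and>
      graph_over T0 A = {x + B *v x |x. x \<in> T0}"
    have BA: "B *v u = A *v u" if u: "u \<in> T0" for u
    proof -
      have "u + A *v u \<in> {x + B *v x |x. x \<in> T0}"
        using u B by (auto simp: graph_over_def)
      then obtain u' where u': "u' \<in> T0" "u + A *v u = u' + B *v u'" by auto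
      have "proj_matrix T0 *v (u' + B *v u') = u'"
        using u' B by (intro proj_matrix_unique[OF T0]) auto
      then have "u = u'" using u' proj[OF u] by simp
      then show ?thesis using u' by simp
    qed
    have "B *v v = A *v v" for v
    proof -
      have "B *v (v - proj_matrix T0 *v v) = 0"
        using B proj_matrix_compl[OF T0] by auto
      then have "B *v v = B *v (proj_matrix T0 *v v)" by (simp add: matrix_vector_mult_diff_distrib)
      also have "\<dots> = A *v (proj_matrix T0 *v v)" by (rule BA[OF proj_matrix_in[OF T0]])
      finally show ?thesis by (simp add: AP)
    qed
    then show "B = A" by (simp add: matrix_eq)
  qed
qed

text \<open>\<open>C\<close> is reparametrized by \<open>T0\<close> so that \<open>M\<close>
  followed by the projection to \<open>T0\<close> becomes the identity there. In the chart
  computation this makes the matrix that has to be inverted equal to the identity at the base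
  point.\<close>

lemma exists_section:
  fixes T0 :: "(real^'n) set" and M :: "real^'n^'n"
  assumes T0: "subspace T0" and C: "subspace C" and dim: "dim C = dim T0"
    and tr: "\<And>v. v \<in> C \<Longrightarrow> M *v v \<in> orthogonal_comp T0 \<Longrightarrow> v = 0"
  shows "\<exists>E :: real^'n^'n. (\<lambda>x. E *v x) ` T0 = C \<and> (\<forall>y\<in>orthogonal_comp T0. E *v y = 0) \<and>
    (\<forall>x\<in>T0. proj_matrix T0 *v (M *v (E *v x)) = x)"
proof -
  define h where "h v = proj_matrix T0 *v (M *v v)" for v
  have lin: "linear h" unfolding h_def
    by (intro linear_compose[OF matrix_vector_mul_linear matrix_vector_mul_linear, unfolded o_def])
  have ker: "v = 0" if "v \<in> C" "h v = 0" for v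
  proof -
    have "M *v v \<in> orthogonal_comp T0"
      using proj_matrix_compl[OF T0, of "M *v v"] that(2) by (simp add: h_def)
    then show ?thesis using tr that by blast
  qed
  have inj: "inj_on h C"
  proof (rule inj_onI)
    fix v w assume vw: "v \<in> C" "w \<in> C" "h v = h w"
    have "h (v - w) = h v - h w" by (rule linear_diff[OF lin])
    also have "\<dots> = 0" using vw(3) by (rule right_minus_eq[THEN iffD2])
    finally have "v - w = 0" by (rule ker[OF subspace_diff[OF C vw(1,2)]])
    then show "v = w" by simp
  qed
  have "h ` C = T0"
  proof (rule subspace_dim_equal)
    show "subspace (h ` C)" by (rule linear_subspace_image[OF lin C])
    show "h ` C \<subseteq> T0" using proj_matrix_in[OF T0] by (auto simp: h_def)
    show "dim T0 \<le> dim (h ` C)"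
      using dim_image_eq[OF lin, of C] inj dim by (simp add: span_eq_iff[THEN iffD2, OF C])
  qed (rule T0)
  obtain g where g: "range g \<subseteq> C" "linear g" "\<And>v. v \<in> C \<Longrightarrow> g (h v) = v"
    using linear_exists_left_inverse_on[OF lin C inj] by blast
  define E where "E = matrix (\<lambda>x. g (proj_matrix T0 *v x))"
  have "linear (\<lambda>x. g (proj_matrix T0 *v x))"
    using linear_compose[OF matrix_vector_mul_linear g(2)] by (simp add: o_def)
  then have E: "E *v x = g (proj_matrix T0 *v x)" for x by (simp add: E_def)
  show ?thesis
  proof (intro exI[of _ E] conjI ballI)
    have "(\<lambda>x. E *v x) ` T0 = g ` T0"
      by (intro image_cong refl) (simp add: E proj_matrix_id[OF T0])
    also have "\<dots> = C" unfolding \<open>h ` C = T0\<close>[symmetric] image_image using g(3) by simp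
    finally show "(\<lambda>x. E *v x) ` T0 = C" .
    fix y assume "y \<in> orthogonal_comp T0"
    from proj_matrix_orthogonal[OF T0 this] show "E *v y = 0"
      by (simp add: E linear_0[OF g(2)])
  next
    fix x assume x: "x \<in> T0"
    then obtain v where v: "v \<in> C" "x = h v" using \<open>h ` C = T0\<close> by blast
    then have "E *v x = v" using g(3)[of v] x by (simp add: E proj_matrix_id[OF T0])
    then show "proj_matrix T0 *v (M *v (E *v x)) = x" using v(2) by (simp add: h_def)
  qed
qed

lemma matrix_inv_mult:
  fixes K :: "real^'n^'n"
  assumes "det K \<noteq> 0"
  shows "K ** matrix_inv K = mat 1" "matrix_inv K ** K = mat 1"
  using assms unfolding invertible_det_nz[symmetric] invertible_def matrix_inv_def
  by (metis (mono_tags, lifting) someI_ex)+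

lemma continuous_on_det:
  fixes K :: "'a::topological_space \<Rightarrow> real^'n^'n"
  assumes "continuous_on V K"
  shows "continuous_on V (\<lambda>x. det (K x))"
  unfolding det_def by (intro continuous_intros assms)

text \<open>With \<open>E\<close> chosen such that \<open>N x = M x ** E\<close> satisfies \<open>P ** N p = P\<close>, the matrix
  \<open>K x = P ** N x + (mat 1 - P)\<close> is invertible near \<open>p\<close>, and the chart is
  \<open>(mat 1 - P) ** N x ** inverse (K x) ** P\<close>.\<close>

lemma holder_smooth_Gr_chart_image:
  fixes M :: "real^'m \<Rightarrow> real^'n^'n"
  assumes V: "open V" "p \<in> V" and M: "holder_smooth UNIV k \<alpha> M V" and \<alpha>: "\<alpha> \<le> 1"
    and T0: "subspace T0" and C: "subspace C" and dim: "dim C = dim T0"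
    and tr: "\<And>v. v \<in> C \<Longrightarrow> M p *v v \<in> orthogonal_comp T0 \<Longrightarrow> v = 0"
  obtains V' where "open V'" "p \<in> V'" "V' \<subseteq> V"
    "\<And>x. x \<in> V' \<Longrightarrow> \<exists>A. chart_matrix T0 A \<and> (\<lambda>v. M x *v v) ` C = graph_over T0 A"
    "holder_smooth UNIV k \<alpha> (\<lambda>x. Gr_chart T0 ((\<lambda>v. M x *v v) ` C)) V'"
proof -
  obtain E :: "real^'n^'n" where E: "(\<lambda>x. E *v x) ` T0 = C" "\<And>y. y \<in> orthogonal_comp T0 \<Longrightarrow> E *v y = 0"
    "\<And>x. x \<in> T0 \<Longrightarrow> proj_matrix T0 *v (M p *v (E *v x)) = x"
    using exists_section[OF T0 C dim, of "M p"] tr by metis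
  define P where "P = proj_matrix T0"
  define N where "N x = M x ** E" for x
  define K where "K x = P ** N x + (mat 1 - P)" for x
  define R where "R x = matrix_inv (K x)" for x
  define A where "A x = (mat 1 - P) ** (N x ** (R x ** P))" for x
  have bb: "bounded_bilinear ((**) :: real^'n^'n \<Rightarrow> real^'n^'n \<Rightarrow> real^'n^'n)"
    by (rule bounded_bilinear_matrix_matrix_mult)
  note Pin = proj_matrix_in[OF T0, folded P_def] and Pc = proj_matrix_compl[OF T0, folded P_def]
    and Pid = proj_matrix_id[OF T0, folded P_def] and P0 = proj_matrix_orthogonal[OF T0, folded P_def]
  have holder_smooth_N: "holder_smooth UNIV k \<alpha> N V"
    unfolding N_def by (intro holder_smooth_bilinear[OF bb V(1) \<alpha>] M holder_smooth_const)
  have holder_smooth_K: "holder_smooth UNIV k \<alpha> K V"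
    unfolding K_def by (intro holder_smooth_add[OF V(1)] holder_smooth_bilinear[OF bb V(1) \<alpha>] holder_smooth_N holder_smooth_const)
  have Kv: "K x *v v = P *v (N x *v v) + (v - P *v v)" for x v
    by (simp add: K_def matrix_vector_mult_add_rdistrib matrix_vector_mult_diff_rdistrib matrix_vector_mul_assoc)
  have N0: "N x *v y = 0" if "y \<in> orthogonal_comp T0" for x y
    using E(2)[OF that] by (simp add: N_def matrix_vector_mul_assoc[symmetric])
  have NP: "N x *v v = N x *v (P *v v)" for x v
    using N0[OF Pc, of x v] by (simp add: matrix_vector_mult_diff_distrib)
  have "K p *v v = v" for v
  proof -
    have "P *v (N p *v (P *v v)) = P *v v"
      using E(3)[OF Pin, of v] by (simp add: N_def P_def matrix_vector_mul_assoc[symmetric])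
    then show ?thesis by (simp add: Kv NP[of p v])
  qed
  then have "K p = mat 1" by (simp add: matrix_eq)
  \<comment> \<open>Invertibility persists near \<open>p\<close> because \<open>K p\<close> is the
    identity and the determinant is continuous.\<close>
  define V' where "V' = {x \<in> V. det (K x) \<noteq> 0}"
  have "open V'"
  proof -
    have "continuous_on V (\<lambda>x. det (K x))" by (intro continuous_on_det holder_smooth_continuous[OF holder_smooth_K])
    then have "open ((\<lambda>x. det (K x)) -` (- {0}) \<inter> V)"
      using V(1) by (subst (asm) continuous_on_open_vimage) auto
    moreover have "V' = (\<lambda>x. det (K x)) -` (- {0}) \<inter> V" by (auto simp: V'_def)
    ultimately show ?thesis by simp
  qed
  have pV: "p \<in> V'" using V(2) by (simp add: V'_def \<open>K p = mat 1\<close>)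
  have "V' \<subseteq> V" by (auto simp: V'_def)
  have graph: "chart_matrix T0 (A x) \<and> (\<lambda>v. M x *v v) ` C = graph_over T0 (A x)" if x: "x \<in> V'" for x
  proof -
    have KR: "K x *v (R x *v v) = v" and RK: "R x *v (K x *v v) = v" for v
      using matrix_inv_mult[of "K x"] x unfolding R_def V'_def by (auto simp: matrix_vector_mul_assoc)
    \<comment> \<open>The complement part of \<open>R x *v u\<close> is a difference of two vectors
      of \<open>T0\<close>, hence zero; so the inverse maps \<open>T0\<close> into itself.\<close>
    have RT: "R x *v u \<in> T0" if "u \<in> T0" for u
    proof -
      let ?v = "R x *v u"
      have "u = P *v (N x *v ?v) + (?v - P *v ?v)" using KR[of u] by (simp add: Kv)
      then have "?v - P *v ?v = u - P *v (N x *v ?v)" by (simp add: algebra_simps)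
      also have "\<dots> \<in> T0" using that Pin by (intro subspace_diff[OF T0])
      finally have "?v - P *v ?v = 0" using Pc orthogonal_comp_Int by blast
      then show ?thesis using Pin[of ?v] by simp
    qed
    have Av: "A x *v v = N x *v (R x *v (P *v v)) - P *v (N x *v (R x *v (P *v v)))" for v
      by (simp add: A_def matrix_vector_mul_assoc[symmetric] matrix_vector_mult_diff_rdistrib)
    have NR: "u + A x *v u = N x *v (R x *v u)" if "u \<in> T0" for u
    proof -
      have "u = P *v (N x *v (R x *v u))"
        using KR[of u] Pid[OF RT[OF that]] by (simp add: Kv)
      then show ?thesis by (simp add: Av Pid[OF that])
    qed
    have "chart_matrix T0 (A x)"
      unfolding chart_matrix_def using Pc P0 by (auto simp: Av)
    moreover have "(\<lambda>v. M x *v v) ` C = (\<lambda>u. N x *v u) ` T0"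
      unfolding E(1)[symmetric] image_image by (simp add: N_def matrix_vector_mul_assoc)
    moreover have "(\<lambda>u. N x *v u) ` T0 = graph_over T0 (A x)"
    proof (intro equalityI subsetI)
      fix y assume "y \<in> (\<lambda>u. N x *v u) ` T0"
      then obtain v where v: "v \<in> T0" "y = N x *v v" by auto
      have "K x *v v \<in> T0"
        using v Pin by (auto simp: Kv Pid)
      then have "y = K x *v v + A x *v (K x *v v)" using v NR[of "K x *v v"] by (simp add: RK)
      then show "y \<in> graph_over T0 (A x)" using \<open>K x *v v \<in> T0\<close> by (auto simp: graph_over_def)
    next
      fix y assume "y \<in> graph_over T0 (A x)"
      then obtain u where "u \<in> T0" "y = u + A x *v u" by (auto simp: graph_over_def)
      then show "y \<in> (\<lambda>u. N x *v u) ` T0" using NR RT by auto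
    qed
    ultimately show ?thesis by simp
  qed
  have holder_smooth: "holder_smooth UNIV k \<alpha> (\<lambda>x. Gr_chart T0 ((\<lambda>v. M x *v v) ` C)) V'"
  proof -
    have "holder_smooth UNIV k \<alpha> R V'"
      using matrix_inv_mult by (intro holder_smooth_matrix_inverse[OF _ _ \<open>open V'\<close> \<alpha> holder_smooth_subset[OF holder_smooth_K \<open>V' \<subseteq> V\<close>]])
        (auto simp: R_def V'_def)
    then have CA: "holder_smooth UNIV k \<alpha> A V'"
      unfolding A_def using holder_smooth_subset[OF holder_smooth_N \<open>V' \<subseteq> V\<close>]
      by (intro holder_smooth_bilinear[OF bb \<open>open V'\<close> \<alpha>] holder_smooth_const)
    have "A x = Gr_chart T0 ((\<lambda>v. M x *v v) ` C)" if "x \<in> V'" for x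
      using graph[OF that] Gr_chart_graph_over[OF T0, of "A x"] by simp
    then show ?thesis by (rule holder_smooth_cong_open[OF \<open>open V'\<close> _ CA])
  qed
  show ?thesis
    by (rule that[OF \<open>open V'\<close> pV \<open>V' \<subseteq> V\<close> _ holder_smooth]) (use graph in blast)
qed

text \<open>That a transverse plane is a graph is the preceding result for the constant family
  \<open>mat 1\<close> with the plane itself as \<open>C\<close>.\<close>

lemma Gr_chart_domain_graph:
  assumes T0: "subspace T0" and T: "T \<in> Gr_chart_domain T0"
  shows "chart_matrix T0 (Gr_chart T0 T)" "graph_over T0 (Gr_chart T0 T) = T"
proof -
  have "subspace T" "dim T = dim T0" "T \<inter> orthogonal_comp T0 = {0}"
    using T by (auto simp: Gr_chart_domain_def Gr_def)
  then obtain A where A: "chart_matrix T0 A" "(\<lambda>v. (mat 1 :: real^'a^'a) *v v) ` T = graph_over T0 A"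
    using holder_smooth_Gr_chart_image[OF open_UNIV UNIV_I holder_smooth_const[of UNIV 0 0 "mat 1 :: real^'a^'a" UNIV] zero_le_one T0, of T]
    by (metis (no_types, lifting) IntI matrix_vector_mul_lid singletonD)
  then have "graph_over T0 A = T" by simp
  with A(1) Gr_chart_graph_over[OF T0 A(1)]
  show "chart_matrix T0 (Gr_chart T0 T)" "graph_over T0 (Gr_chart T0 T) = T" by auto
qed

lemma graph_over_in_Gr_chart_domain:
  assumes "subspace T0" "chart_matrix T0 A"
  shows "graph_over T0 A \<in> Gr_chart_domain T0"
  using subspace_graph_over[OF assms] dim_graph_over[OF assms] graph_over_transverse[OF assms]
  by (simp add: Gr_chart_domain_def Gr_def)

subsection \<open>The topology of the Grassmannian\<close>

text \<open>Split \<open>v = y + z\<close> along the first plane. The part \<open>y\<close> is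
  carried to the second plane by exchanging \<open>A\<close> for \<open>B\<close> over the same base
  vector. The part \<open>z\<close> has a small projection \<open>w\<close> to the second plane,
  since \<open>w\<close> is close to a vector of the first plane, to which \<open>z\<close> is
  orthogonal. Each part contributes \<open>\<delta> * norm v\<close>.\<close>

lemma norm_proj_matrix_diff:
  assumes T0: "subspace T0" and A: "chart_matrix T0 A" and B: "chart_matrix T0 B"
    and \<delta>: "\<And>x. norm ((A - B) *v x) \<le> \<delta> * norm x" "0 \<le> \<delta>"
  shows "norm (proj_matrix (graph_over T0 A) *v v - proj_matrix (graph_over T0 B) *v v) \<le> 2 * \<delta> * norm v"
proof -
  let ?P = "proj_matrix (graph_over T0 A)" and ?Q = "proj_matrix (graph_over T0 B)"
  note sA = subspace_graph_over[OF T0 A] and sB = subspace_graph_over[OF T0 B]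
  have \<delta>': "norm (A *v x - B *v x) \<le> \<delta> * norm x" for x
    using \<delta>(1)[of x] by (simp add: matrix_vector_mult_diff_rdistrib)
  define y z where "y = ?P *v v" and "z = v - ?P *v v"
  have small: "norm u \<le> norm (u + D *v u)" if "u \<in> T0" "chart_matrix T0 D" for u D
    using norm_proj_matrix(1)[OF T0, of "u + D *v u"] proj_graph_over[OF T0 that(2,1)] by simp
  obtain u where u: "u \<in> T0" "y = u + A *v u"
    using proj_matrix_in[OF sA, of v] by (auto simp: y_def graph_over_def)
  define y' where "y' = u + B *v u"
  have "y' \<in> graph_over T0 B" using u by (auto simp: y'_def graph_over_def)
  then have Qy': "?Q *v y' = y'" by (rule proj_matrix_id[OF sB])
  have "norm (y - y') \<le> \<delta> * norm u"
    using \<delta>'[of u] by (simp add: u y'_def)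
  also have "\<dots> \<le> \<delta> * norm v"
    using small[OF u(1) A, folded u(2)] norm_proj_matrix(1)[OF sA, of v, folded y_def] \<delta>(2)
    by (intro mult_left_mono) auto
  finally have yy': "norm (y - y') \<le> \<delta> * norm v" .
  have "y - ?Q *v y = (y - y') - ?Q *v (y - y')" by (simp add: matrix_vector_mult_diff_distrib Qy')
  then have 1: "norm (y - ?Q *v y) \<le> \<delta> * norm v"
    using norm_proj_matrix(2)[OF sB, of "y - y'"] yy' by (simp only:)
  define w where "w = ?Q *v z"
  obtain u' where u': "u' \<in> T0" "w = u' + B *v u'"
    using proj_matrix_in[OF sB, of z] by (auto simp: w_def graph_over_def)
  have "w \<bullet> (z - w) = 0"
    unfolding w_def using proj_matrix_in[OF sB] proj_matrix_compl[OF sB] by (rule inner_orthogonal_comp)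
  moreover have "(u' + A *v u') \<bullet> z = 0"
  proof (rule inner_orthogonal_comp)
    show "u' + A *v u' \<in> graph_over T0 A" using u' by (auto simp: graph_over_def)
    show "z \<in> orthogonal_comp (graph_over T0 A)" unfolding z_def by (rule proj_matrix_compl[OF sA])
  qed
  ultimately have "w \<bullet> w = (w - (u' + A *v u')) \<bullet> z" by (simp add: inner_diff_left inner_diff_right)
  also have "\<dots> \<le> norm (w - (u' + A *v u')) * norm z" by (rule norm_cauchy_schwarz)
  also have "\<dots> \<le> (\<delta> * norm u') * norm v"
    using \<delta>'[of u'] norm_proj_matrix(2)[OF sA, of v] \<delta>(2)
    by (intro mult_mono) (auto simp: u' z_def norm_minus_commute)
  also have "\<dots> \<le> (\<delta> * norm w) * norm v"
    using small[OF u'(1) B] \<delta>(2) u'(2) by (intro mult_right_mono mult_left_mono) auto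
  finally have "norm w * norm w \<le> norm w * (\<delta> * norm v)"
    by (simp add: norm_eq_sqrt_inner mult_ac)
  then have 2: "norm w \<le> \<delta> * norm v"
    using \<delta>(2) by (cases "w = 0") auto
  have "v = y + z" by (simp add: y_def z_def)
  then have "?Q *v v = ?Q *v y + w" by (simp only: matrix_vector_right_distrib w_def)
  then have "?P *v v - ?Q *v v = (y - ?Q *v y) - w"
    by (simp add: y_def)
  then have "norm (?P *v v - ?Q *v v) \<le> norm (y - ?Q *v y) + norm w"
    using norm_triangle_ineq4[of "y - ?Q *v y" w] by simp
  then show ?thesis using 1 2 by simp
qed

lemma tendsto_matrixI:
  fixes f :: "'a \<Rightarrow> real^'n^'m"
  assumes "\<And>v. ((\<lambda>x. f x *v v) \<longlongrightarrow> L *v v) F"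
  shows "(f \<longlongrightarrow> L) F"
proof (intro vec_tendstoI)
  fix i j
  have "((\<lambda>x. (f x *v axis j 1) $ i) \<longlongrightarrow> (L *v axis j 1) $ i) F"
    by (intro tendsto_vec_nth assms)
  then show "((\<lambda>x. f x $ i $ j) \<longlongrightarrow> L $ i $ j) F"
    by (simp add: matrix_vector_mult_basis column_def)
qed

lemma continuous_on_proj_matrix_graph_over:
  fixes A :: "'a::metric_space \<Rightarrow> real^'n^'n"
  assumes T0: "subspace T0" and A: "\<And>x. x \<in> V \<Longrightarrow> chart_matrix T0 (A x)" and cont: "continuous_on V A"
  shows "continuous_on V (\<lambda>x. proj_matrix (graph_over T0 (A x)))"
  unfolding continuous_on_def
proof
  fix x assume x: "x \<in> V"
  obtain K where K: "K > 0" "\<And>(B :: real^'n^'n) v. norm (B *v v) \<le> K * norm B * norm v"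
    using matrix_vector_mult_bound by blast
  show "((\<lambda>x. proj_matrix (graph_over T0 (A x))) \<longlongrightarrow> proj_matrix (graph_over T0 (A x))) (at x within V)"
  proof (rule tendsto_matrixI)
    fix v :: "real^'n"
    have "((\<lambda>y. A y - A x) \<longlongrightarrow> 0) (at x within V)"
      using cont x by (simp add: continuous_on_def LIM_zero_iff)
    then have "((\<lambda>y. 2 * (K * norm (A y - A x)) * norm v) \<longlongrightarrow> 2 * (K * norm (0 :: real^'n^'n)) * norm v) (at x within V)"
      by (intro tendsto_intros)
    then have lim: "((\<lambda>y. 2 * (K * norm (A y - A x)) * norm v) \<longlongrightarrow> 0) (at x within V)" by simp
    have "eventually (\<lambda>y. norm (proj_matrix (graph_over T0 (A y)) *v v - proj_matrix (graph_over T0 (A x)) *v v)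
        \<le> 2 * (K * norm (A y - A x)) * norm v) (at x within V)"
      unfolding eventually_at_filter
      using K by (intro always_eventually allI impI norm_proj_matrix_diff[OF T0] A x) auto
    then have "((\<lambda>y. proj_matrix (graph_over T0 (A y)) *v v - proj_matrix (graph_over T0 (A x)) *v v) \<longlongrightarrow> 0) (at x within V)"
      using lim by (rule Lim_null_comparison)
    then show "((\<lambda>y. proj_matrix (graph_over T0 (A y)) *v v) \<longlongrightarrow> proj_matrix (graph_over T0 (A x)) *v v) (at x within V)"
      by (simp add: LIM_zero_iff)
  qed
qed

lemma topspace_Gr_topology [simp]: "topspace (Gr_topology d) = Gr d"
  by (simp add: Gr_topology_def topspace_pullback_topology)

lemma openin_Gr_topology:
  "openin (Gr_topology d) U \<longleftrightarrow> (\<exists>O'. open O' \<and> U = proj_matrix -` O' \<inter> Gr d)"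
  by (simp add: Gr_topology_def openin_pullback_topology)

lemma limitin_Gr_topology:
  "limitin (Gr_topology d) f T F \<longleftrightarrow>
     T \<in> Gr d \<and> eventually (\<lambda>x. f x \<in> Gr d) F \<and> ((\<lambda>x. proj_matrix (f x)) \<longlongrightarrow> proj_matrix T) F"
proof
  assume lim: "limitin (Gr_topology d) f T F"
  have T: "T \<in> Gr d" using lim by (simp add: limitin_def)
  moreover have "eventually (\<lambda>x. f x \<in> Gr d) F"
    using limitinD[OF lim, of "Gr d"] T openin_topspace[of "Gr_topology d"] by simp
  moreover have "((\<lambda>x. proj_matrix (f x)) \<longlongrightarrow> proj_matrix T) F"
  proof (rule topological_tendstoI)
    fix O' :: "(real^'a^'a) set" assume O': "open O'" "proj_matrix T \<in> O'"
    then have "eventually (\<lambda>x. f x \<in> proj_matrix -` O' \<inter> Gr d) F"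
      using T by (intro limitinD[OF lim]) (auto simp: openin_Gr_topology)
    then show "eventually (\<lambda>x. proj_matrix (f x) \<in> O') F" by (rule eventually_mono) auto
  qed
  ultimately show "T \<in> Gr d \<and> eventually (\<lambda>x. f x \<in> Gr d) F \<and> ((\<lambda>x. proj_matrix (f x)) \<longlongrightarrow> proj_matrix T) F"
    by blast
next
  assume R: "T \<in> Gr d \<and> eventually (\<lambda>x. f x \<in> Gr d) F \<and> ((\<lambda>x. proj_matrix (f x)) \<longlongrightarrow> proj_matrix T) F"
  show "limitin (Gr_topology d) f T F"
    unfolding limitin_def
  proof (intro conjI allI impI)
    fix U assume "openin (Gr_topology d) U \<and> T \<in> U"
    then obtain O' where O': "open O'" "U = proj_matrix -` O' \<inter> Gr d" "proj_matrix T \<in> O'"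
      by (auto simp: openin_Gr_topology)
    have "eventually (\<lambda>x. proj_matrix (f x) \<in> O') F" using R O' by (auto dest: topological_tendstoD)
    then show "eventually (\<lambda>x. f x \<in> U) F" using R O'(2) by (auto elim: eventually_elim2)
  qed (use R in simp)
qed

lemma continuous_map_Gr_topology:
  assumes "\<And>x. x \<in> X \<Longrightarrow> f x \<in> Gr d" "continuous_on X (\<lambda>x. proj_matrix (f x))"
  shows "continuous_map (top_of_set X) (Gr_topology d) f"
  unfolding Gr_topology_def using assms
  by (intro continuous_map_pullback') (auto simp: o_def)

text \<open>The condition \<open>tangent_space X x \<in> Gr d\<close> appears because
  \<open>Sing1\<close> accepts submanifold points of any dimension, while a closure only sees points
  of the topological space, that is, planes of dimension \<open>d\<close>.\<close>

lemma in_nash_transformation_iff: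
  "(p, T) \<in> nash_transformation d X \<longleftrightarrow> p \<in> X \<and> T \<in> Gr d \<and>
     (\<forall>e>0. \<exists>x\<in>X - Sing1 X. tangent_space X x \<in> Gr d \<and> dist x p < e \<and>
        dist (proj_matrix (tangent_space X x)) (proj_matrix T) < e)"
proof
  assume cl: "(p, T) \<in> nash_transformation d X"
  then have pT: "p \<in> X" "T \<in> Gr d" by (auto simp: nash_transformation_def in_closure_of)
  moreover have "\<exists>x\<in>X - Sing1 X. tangent_space X x \<in> Gr d \<and> dist x p < e \<and>
        dist (proj_matrix (tangent_space X x)) (proj_matrix T) < e" if "e > 0" for e
  proof -
    let ?U = "(X \<inter> ball p e) \<times> (proj_matrix -` ball (proj_matrix T) e \<inter> Gr d)"
    have "openin (prod_topology (top_of_set X) (Gr_topology d)) ?U"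
      by (auto simp: openin_prod_Times_iff openin_open_Int openin_Gr_topology)
    moreover have "(p, T) \<in> ?U" using pT that by simp
    ultimately have "\<exists>y. y \<in> (\<lambda>x. (x, tangent_space X x)) ` (X - Sing1 X) \<and> y \<in> ?U"
      using cl[unfolded nash_transformation_def in_closure_of, THEN conjunct2, THEN spec, of ?U] by simp
    then show ?thesis by (auto simp: dist_commute)
  qed
  ultimately show "p \<in> X \<and> T \<in> Gr d \<and> (\<forall>e>0. \<exists>x\<in>X - Sing1 X. tangent_space X x \<in> Gr d \<and> dist x p < e \<and>
        dist (proj_matrix (tangent_space X x)) (proj_matrix T) < e)" by blast
next
  assume R: "p \<in> X \<and> T \<in> Gr d \<and> (\<forall>e>0. \<exists>x\<in>X - Sing1 X. tangent_space X x \<in> Gr d \<and> dist x p < e \<and>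
        dist (proj_matrix (tangent_space X x)) (proj_matrix T) < e)"
  show "(p, T) \<in> nash_transformation d X"
    unfolding nash_transformation_def in_closure_of
  proof (intro conjI allI impI)
    fix O' assume "(p, T) \<in> O' \<and> openin (prod_topology (top_of_set X) (Gr_topology d)) O'"
    then obtain U V where UV: "openin (top_of_set X) U" "openin (Gr_topology d) V" "p \<in> U" "T \<in> V" "U \<times> V \<subseteq> O'"
      unfolding openin_prod_topology_alt by blast
    then obtain U' V' where U': "open U'" "U = X \<inter> U'" and V': "open V'" "V = proj_matrix -` V' \<inter> Gr d"
      by (auto simp: openin_open openin_Gr_topology)
    obtain e1 where e1: "e1 > 0" "ball p e1 \<subseteq> U'" using U' UV(3) by (auto elim: openE)
    obtain e2 where e2: "e2 > 0" "ball (proj_matrix T) e2 \<subseteq> V'" using V' UV(4) by (auto elim: openE)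
    obtain x where "x \<in> X - Sing1 X" "tangent_space X x \<in> Gr d" "dist x p < min e1 e2"
        "dist (proj_matrix (tangent_space X x)) (proj_matrix T) < min e1 e2"
      using R e1(1) e2(1) by (metis min_less_iff_conj)
    then have "(x, tangent_space X x) \<in> U \<times> V" 
      using e1(2) e2(2) by (auto simp: U' V' dist_commute subset_eq)
    then show "\<exists>y. y \<in> (\<lambda>x. (x, tangent_space X x)) ` (X - Sing1 X) \<and> y \<in> O'"
      using UV(5) \<open>x \<in> X - Sing1 X\<close> by blast
  qed (use R in simp)
qed

text \<open>Limits of sequences and closure points agree since both factors are metric, the second
  one through \<open>proj_matrix\<close>; the sequence is taken from neighbourhoods of radius
  \<open>1 / Suc j\<close>.\<close>

lemma C4_cone_eq_Union_nash:
  assumes "p \<in> X"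
  shows "C4_cone d X p = \<Union>{T. (p, T) \<in> nash_transformation d X}"
proof -
  have "(\<exists>x. (\<forall>j::nat. x j \<in> X - Sing1 X) \<and> x \<longlonglongrightarrow> p \<and>
          limitin (Gr_topology d) (\<lambda>j. tangent_space X (x j)) T sequentially) \<longleftrightarrow> (p, T) \<in> nash_transformation d X"
    if T: "T \<in> Gr d" for T
  proof
    assume "\<exists>x. (\<forall>j::nat. x j \<in> X - Sing1 X) \<and> x \<longlonglongrightarrow> p \<and>
          limitin (Gr_topology d) (\<lambda>j. tangent_space X (x j)) T sequentially"
    then obtain x where x: "\<And>j::nat. x j \<in> X - Sing1 X" "x \<longlonglongrightarrow> p"
      "eventually (\<lambda>j. tangent_space X (x j) \<in> Gr d) sequentially"
      "(\<lambda>j. proj_matrix (tangent_space X (x j))) \<longlonglongrightarrow> proj_matrix T"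
      by (auto simp: limitin_Gr_topology)
    have "\<exists>y\<in>X - Sing1 X. tangent_space X y \<in> Gr d \<and> dist y p < e \<and>
        dist (proj_matrix (tangent_space X y)) (proj_matrix T) < e" if "e > 0" for e
    proof -
      have "eventually (\<lambda>j. tangent_space X (x j) \<in> Gr d \<and> dist (x j) p < e \<and>
        dist (proj_matrix (tangent_space X (x j))) (proj_matrix T) < e) sequentially"
        using x(3) tendstoD[OF x(2) that] tendstoD[OF x(4) that] by (intro eventually_conj)
      from eventually_happens[OF this] show ?thesis using x(1) by auto
    qed
    then show "(p, T) \<in> nash_transformation d X"
      using assms T by (auto simp: in_nash_transformation_iff)
  next
    assume "(p, T) \<in> nash_transformation d X"
    then have "\<exists>x\<in>X - Sing1 X. tangent_space X x \<in> Gr d \<and> dist x p < 1 / Suc j \<and>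
        dist (proj_matrix (tangent_space X x)) (proj_matrix T) < 1 / Suc j" for j
      unfolding in_nash_transformation_iff by simp
    then obtain x where x: "\<And>j. x j \<in> X - Sing1 X" "\<And>j. tangent_space X (x j) \<in> Gr d"
      "\<And>j. dist (x j) p < 1 / Suc j" "\<And>j. dist (proj_matrix (tangent_space X (x j))) (proj_matrix T) < 1 / Suc j"
      by metis
    have lim0: "(\<lambda>j. 1 / Suc j) \<longlonglongrightarrow> 0" using LIMSEQ_inverse_real_of_nat by (simp add: divide_inverse)
    have "x \<longlonglongrightarrow> p"
      by (rule metric_tendsto_imp_tendsto[OF lim0]) (use x(3) in \<open>auto intro!: always_eventually less_imp_le\<close>)
    moreover have "(\<lambda>j. proj_matrix (tangent_space X (x j))) \<longlonglongrightarrow> proj_matrix T"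
      by (rule metric_tendsto_imp_tendsto[OF lim0]) (use x(4) in \<open>auto intro!: always_eventually less_imp_le\<close>)
    ultimately show "\<exists>x. (\<forall>j::nat. x j \<in> X - Sing1 X) \<and> x \<longlonglongrightarrow> p \<and>
          limitin (Gr_topology d) (\<lambda>j. tangent_space X (x j)) T sequentially"
      using x(1,2) T by (intro exI[of _ x]) (simp add: limitin_Gr_topology)
  qed
  moreover have "T \<in> Gr d" if "(p, T) \<in> nash_transformation d X" for T
    using that by (simp add: in_nash_transformation_iff)
  ultimately show ?thesis
    unfolding C4_cone_def by (intro arg_cong[where f = Union]) blast
qed

section \<open>Sets whose tangent cones are planes\<close>

text \<open>All planes near \<open>p\<close> are described over the one plane \<open>T0\<close>.
  Here \<open>A\<close> carries pointwise information only; its Hoelder bound enters in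
  \<open>sheet_distance\<close>. Compactness of a ball in \<open>X\<close> makes extrema
  attained.\<close>

locale flat_cones =
  fixes X T0 :: "(real^'n) set" and A :: "real^'n \<Rightarrow> real^'n^'n" and p :: "real^'n" and r0 :: real
  assumes T0: "subspace T0" and p_in: "p \<in> X" and r0: "0 < r0"
    and compact: "compact (X \<inter> cball p r0)"
    and chart: "\<And>x. x \<in> X \<Longrightarrow> norm (x - p) \<le> r0 \<Longrightarrow> chart_matrix T0 (A x)"
    and cone: "\<And>x. x \<in> X \<Longrightarrow> norm (x - p) \<le> r0 \<Longrightarrow> C3_cone X x = graph_over T0 (A x)"
begin

definition P :: "real^'n \<Rightarrow> real^'n" where "P v = proj_matrix T0 *v v"

lemma linear_P: "linear P"
  unfolding P_def by (rule matrix_vector_mul_linear)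

lemma P_in: "P v \<in> T0"
  unfolding P_def by (rule proj_matrix_in[OF T0])

lemma P_id: "v \<in> T0 \<Longrightarrow> P v = v"
  unfolding P_def by (rule proj_matrix_id[OF T0])

lemma norm_P: "norm (P v) \<le> norm v"
  unfolding P_def by (rule norm_proj_matrix(1)[OF T0])

lemma P_diff: "P (x - y) = P x - P y"
  by (rule linear_diff[OF linear_P])

lemma tendsto_P: "(f \<longlongrightarrow> l) F \<Longrightarrow> ((\<lambda>x. P (f x)) \<longlongrightarrow> P l) F"
  unfolding P_def by (rule bounded_linear.tendsto[OF matrix_vector_mul_bounded_linear])

text \<open>The deviation of \<open>w\<close> from the tangent plane at \<open>x\<close>, measured along the complement of \<open>T0\<close>.\<close>

definition dev :: "real^'n \<Rightarrow> real^'n \<Rightarrow> real^'n" where "dev x w = w - P w - A x *v w"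

lemma A_P: "x \<in> X \<Longrightarrow> norm (x - p) \<le> r0 \<Longrightarrow> A x *v P w = A x *v w"
  unfolding P_def by (rule chart_matrix_proj[OF T0 chart])

lemma dev_tangent:
  assumes "x \<in> X" "norm (x - p) \<le> r0" "v \<in> graph_over T0 (A x)"
  shows "dev x v = 0"
proof -
  obtain u where u: "u \<in> T0" "v = u + A x *v u" using assms(3) by (auto simp: graph_over_def)
  have "P v = u" unfolding u(2) P_def by (rule proj_graph_over[OF T0 chart[OF assms(1,2)] u(1)])
  moreover have "A x *v v = A x *v u" using A_P[OF assms(1,2), of v] \<open>P v = u\<close> by simp
  ultimately show ?thesis by (simp add: dev_def u(2))
qed

text \<open>A sequence in \<open>X\<close> violating the estimate has, after normalization, a
  convergent subsequence of directions on the unit sphere. The limit lies in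
  \<open>C3_cone X x\<close>, where \<open>dev x\<close> vanishes, yet its deviation is at least
  \<epsilon>.\<close>

lemma dev_small:
  assumes x: "x \<in> X" "norm (x - p) \<le> r0" and "\<epsilon> > 0"
  shows "\<exists>\<delta>>0. \<forall>y\<in>X. norm (y - x) < \<delta> \<longrightarrow> norm (dev x (y - x)) \<le> \<epsilon> * norm (y - x)"
proof (rule ccontr)
  assume neg: "\<not> ?thesis"
  have "\<exists>y\<in>X. norm (y - x) < 1 / Suc j \<and> \<epsilon> * norm (y - x) < norm (dev x (y - x))" for j
  proof (rule ccontr)
    assume "\<not> (\<exists>y\<in>X. norm (y - x) < 1 / Suc j \<and> \<epsilon> * norm (y - x) < norm (dev x (y - x)))"
    then have "\<forall>y\<in>X. norm (y - x) < 1 / Suc j \<longrightarrow> norm (dev x (y - x)) \<le> \<epsilon> * norm (y - x)"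
      by (meson not_less)
    moreover have "0 < 1 / real (Suc j)" by simp
    ultimately show False using neg by blast
  qed
  then obtain y where y: "\<And>j. y j \<in> X" "\<And>j. norm (y j - x) < 1 / Suc j"
    "\<And>j. \<epsilon> * norm (y j - x) < norm (dev x (y j - x))" by metis
  define t where "t j = norm (y j - x)" for j
  have t: "t j > 0" for j
  proof -
    have "y j \<noteq> x" using y(3)[of j] by (auto simp: dev_def linear_0[OF linear_P])
    then show ?thesis by (simp add: t_def)
  qed
  define u where "u j = (1 / t j) *\<^sub>R (y j - x)" for j
  have dev_scale: "dev x (c *\<^sub>R w) = c *\<^sub>R dev x w" for c w
    by (simp add: dev_def linear_cmul[OF linear_P] matrix_vector_mult_scaleR scaleR_diff_right)
  have du: "\<epsilon> < norm (dev x (u j))" for j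
    using y(3)[of j] t[of j] by (simp add: u_def dev_scale t_def[symmetric] pos_less_divide_eq)
  have "u j \<in> sphere 0 1" for j using t[of j] by (simp add: u_def t_def[symmetric])
  then obtain v \<sigma> where v: "strict_mono \<sigma>" "(u \<circ> \<sigma>) \<longlonglongrightarrow> v"
    using compact_sphere[of "0 :: real^'n" 1] unfolding compact_def by metis
  have "t \<longlonglongrightarrow> 0"
  proof (rule tendsto_sandwich[OF _ _ tendsto_const])
    show "eventually (\<lambda>j. t j \<le> 1 / Suc j) sequentially"
      using y(2) by (auto simp: t_def intro!: always_eventually less_imp_le)
    show "(\<lambda>j. 1 / real (Suc j)) \<longlonglongrightarrow> 0"
      using LIMSEQ_inverse_real_of_nat by (simp add: divide_inverse)
  qed (use t in \<open>auto intro!: always_eventually less_imp_le\<close>)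
  then have "(t \<circ> \<sigma>) \<longlonglongrightarrow> 0" using v(1) by (rule LIMSEQ_subseq_LIMSEQ)
  then have "v \<in> C3_cone X x"
    unfolding C3_cone_def using v(2) y(1) t
    by (intro CollectI exI[of _ "y \<circ> \<sigma>"] exI[of _ "t \<circ> \<sigma>"]) (auto simp: u_def o_def)
  then have "dev x v = 0" using dev_tangent[OF x] cone[OF x] by simp
  have "((\<lambda>j. norm (dev x ((u \<circ> \<sigma>) j))) \<longlonglongrightarrow> norm (dev x v))"
    unfolding dev_def
    by (intro tendsto_norm tendsto_diff v(2) tendsto_P bounded_linear.tendsto[OF matrix_vector_mul_bounded_linear])
  then have "\<epsilon> \<le> norm (dev x v)"
    using du by (intro LIMSEQ_le_const) (auto intro: less_imp_le)
  then show False using \<open>dev x v = 0\<close> \<open>\<epsilon> > 0\<close> by simp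
qed

text \<open>Displacements in \<open>X\<close> near \<open>x\<close> are almost tangent, and on a
  graph over \<open>T0\<close> the projection controls the norm. In particular \<open>x\<close> is
  isolated in its fibre of \<open>P\<close>. The constants depend on \<open>x\<close>.\<close>

lemma norm_le_P:
  assumes x: "x \<in> X" "norm (x - p) \<le> r0"
  shows "\<exists>\<delta>>0. \<exists>C>0. \<forall>y\<in>X. norm (y - x) < \<delta> \<longrightarrow> norm (y - x) \<le> C * norm (P (y - x))"
proof -
  obtain K where K: "K > 0" "\<And>(B :: real^'n^'n) v. norm (B *v v) \<le> K * norm B * norm v"
    using matrix_vector_mult_bound by blast
  obtain \<delta> where \<delta>: "\<delta> > 0" "\<And>y. y \<in> X \<Longrightarrow> norm (y - x) < \<delta> \<Longrightarrow> norm (dev x (y - x)) \<le> 1/2 * norm (y - x)"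
    using dev_small[OF x, of "1/2"] by auto
  have "norm w \<le> (2 * (1 + K * norm (A x))) * norm (P w)" if "norm (dev x w) \<le> 1/2 * norm w" for w
  proof -
    have "w = dev x w + (P w + A x *v P w)" by (simp add: dev_def A_P[OF x])
    then have "norm w \<le> norm (dev x w) + (norm (P w) + norm (A x *v P w))"
      by (metis norm_triangle_mono norm_triangle_ineq order_refl)
    also have "\<dots> \<le> 1/2 * norm w + (norm (P w) + K * norm (A x) * norm (P w))"
      using that K(2) by (intro add_mono) auto
    finally show ?thesis by (simp add: algebra_simps)
  qed
  moreover have "0 < 2 * (1 + K * norm (A x))" using K(1) by (intro mult_pos_pos add_pos_nonneg) auto
  ultimately show ?thesis using \<delta> by (intro exI[of _ \<delta>] conjI exI[of _ "2 * (1 + K * norm (A x))"]) auto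
qed

text \<open>The error is measured by the displacement of the projection, because later the
  projection is moved and the points of \<open>X\<close> follow it.\<close>

lemma dev_small_P:
  assumes x: "x \<in> X" "norm (x - p) \<le> r0" and "\<epsilon> > 0"
  shows "\<exists>\<delta>>0. \<forall>y\<in>X. norm (y - x) < \<delta> \<longrightarrow> norm (dev x (y - x)) \<le> \<epsilon> * norm (P (y - x))"
proof -
  obtain \<delta> C where C: "\<delta> > 0" "C > 0" "\<And>y. y \<in> X \<Longrightarrow> norm (y - x) < \<delta> \<Longrightarrow> norm (y - x) \<le> C * norm (P (y - x))"
    using norm_le_P[OF x] by blast
  obtain \<delta>' where \<delta>': "\<delta>' > 0"
    "\<And>y. y \<in> X \<Longrightarrow> norm (y - x) < \<delta>' \<Longrightarrow> norm (dev x (y - x)) \<le> \<epsilon> / C * norm (y - x)"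
    using dev_small[OF x, of "\<epsilon> / C"] \<open>\<epsilon> > 0\<close> C(2) by auto
  have "norm (dev x (y - x)) \<le> \<epsilon> * norm (P (y - x))" if y: "y \<in> X" "norm (y - x) < min \<delta> \<delta>'" for y
  proof -
    have "norm (dev x (y - x)) \<le> \<epsilon> / C * norm (y - x)" using \<delta>'(2) y by simp
    also have "\<dots> \<le> \<epsilon> / C * (C * norm (P (y - x)))"
      using C y \<open>\<epsilon> > 0\<close> by (intro mult_left_mono) auto
    finally show ?thesis using C(2) by simp
  qed
  then show ?thesis using C(1) \<delta>'(1) by (intro exI[of _ "min \<delta> \<delta>'"]) auto
qed

text \<open>A point of the image nearest to \<open>y\<close> would have tangent vectors pointing towards \<open>y\<close>.\<close>

lemma P_locally_open:
  assumes x: "x \<in> X" "norm (x - p) < r0" and "s > 0"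
  shows "\<exists>\<delta>>0. \<forall>y\<in>T0. norm (y - P x) < \<delta> \<longrightarrow> (\<exists>z\<in>X. norm (z - x) < s \<and> P z = y)"
proof -
  obtain \<delta> C where C: "\<delta> > 0" "C > 0" "\<And>y. y \<in> X \<Longrightarrow> norm (y - x) < \<delta> \<Longrightarrow> norm (y - x) \<le> C * norm (P (y - x))"
    using norm_le_P[of x] x by (metis less_imp_le)
  define s' where "s' = Min {s, \<delta>, r0 - norm (x - p)} / 2"
  have s': "s' > 0" "s' < s" "s' < \<delta>" "s' < r0 - norm (x - p)"
    using assms C by (auto simp: s'_def min_def)
  have near: "norm (z - p) \<le> r0" if "norm (z - x) \<le> s'" for z
    using norm_triangle_ineq[of "z - x" "x - p"] that s' by simp
  have compK: "compact (X \<inter> cball x s')"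
  proof -
    have "X \<inter> cball x s' = (X \<inter> cball p r0) \<inter> cball x s'"
      using near by (auto simp: dist_norm norm_minus_commute)
    then show ?thesis using compact by (metis closed_cball compact_Int_closed)
  qed
  \<comment> \<open>The bound on \<open>norm (y - P x)\<close> keeps the minimizer \<open>z\<close>
    off the boundary of the ball: it yields \<open>norm (P (z - x)) < s' / C\<close>, which forces
    \<open>norm (z - x) < s'\<close>, so small moves from \<open>z\<close> remain
    admissible.\<close>
  have "\<exists>z\<in>X. norm (z - x) < s \<and> P z = y" if y: "y \<in> T0" "norm (y - P x) < s' / C / 2" for y
  proof -
    have "continuous_on (X \<inter> cball x s') (\<lambda>z. norm (P z - y))"
      by (intro continuous_on_norm continuous_on_diff linear_continuous_on_compose[OF continuous_on_id linear_P] continuous_on_const)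
    moreover have "x \<in> X \<inter> cball x s'" using x s' by simp
    ultimately obtain z where z': "z \<in> X \<inter> cball x s'" "\<forall>w\<in>X \<inter> cball x s'. norm (P z - y) \<le> norm (P w - y)"
      using continuous_attains_inf[OF compK] by blast
    then have z: "z \<in> X" "norm (z - x) \<le> s'"
      by (auto simp: dist_norm norm_minus_commute)
    have z_min: "norm (P z - y) \<le> norm (P w - y)" if "w \<in> X" "norm (w - x) \<le> s'" for w
      using z'(2) that by (auto simp: dist_norm norm_minus_commute[of x])
    have "norm (P z - y) < s' / C / 2"
      using z_min[OF x(1)] s' y by (simp add: norm_minus_commute)
    then have "norm (P (z - x)) < s' / C"
      using y norm_triangle_ineq[of "P z - y" "y - P x"] by (simp add: P_diff)
    then have "C * norm (P (z - x)) < s'" using C(2) by (simp add: field_simps)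
    then have zs: "norm (z - x) < s'" using C(3)[OF z(1)] z(2) s' by simp
    have "P z = y"
    proof (rule ccontr)
      assume "P z \<noteq> y"
      define u where "u = y - P z"
      have u: "u \<in> T0" "norm u > 0" using y P_in \<open>P z \<noteq> y\<close> by (auto simp: u_def intro!: subspace_diff[OF T0])
      have zr: "norm (z - p) \<le> r0" using near z by simp
      have "u + A z *v u \<in> C3_cone X z"
        unfolding cone[OF z(1) zr] using u by (auto simp: graph_over_def)
      then obtain w t where w: "\<And>j::nat. w j \<in> X" "\<And>j. t j > 0" "t \<longlonglongrightarrow> 0"
        "(\<lambda>j. (1 / t j) *\<^sub>R (w j - z)) \<longlonglongrightarrow> u + A z *v u"
        by (auto simp: C3_cone_def)
      have Pu: "P (u + A z *v u) = u" unfolding P_def by (rule proj_graph_over[OF T0 chart[OF z(1) zr] u(1)])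
      have "(\<lambda>j. t j *\<^sub>R ((1 / t j) *\<^sub>R (w j - z))) \<longlonglongrightarrow> 0 *\<^sub>R (u + A z *v u)"
        by (intro tendsto_scaleR w)
      moreover have "t j *\<^sub>R ((1 / t j) *\<^sub>R (w j - z)) = w j - z" for j using w(2)[of j] by simp
      ultimately have "(\<lambda>j. w j - z) \<longlonglongrightarrow> 0" by simp
      then have "eventually (\<lambda>j. norm (w j - z) < s' - norm (z - x)) sequentially"
        using zs tendstoD[of "\<lambda>j. w j - z" 0 sequentially "s' - norm (z - x)"] by (simp add: dist_norm)
      moreover have "eventually (\<lambda>j. t j < 1) sequentially"
        using w(3) by (rule order_tendstoD) simp
      moreover have "(\<lambda>j. P ((1 / t j) *\<^sub>R (w j - z))) \<longlonglongrightarrow> u"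
        using tendsto_P[OF w(4)] Pu by simp
      then have "eventually (\<lambda>j. norm (P ((1 / t j) *\<^sub>R (w j - z)) - u) < norm u / 2) sequentially"
        using u(2) tendstoD[of "\<lambda>j. P ((1 / t j) *\<^sub>R (w j - z))" u sequentially "norm u / 2"] by (simp add: dist_norm)
      ultimately have "eventually (\<lambda>j. norm (w j - z) < s' - norm (z - x) \<and> t j < 1 \<and>
          norm (P ((1 / t j) *\<^sub>R (w j - z)) - u) < norm u / 2) sequentially"
        by (intro eventually_conj)
      from eventually_happens[OF this] obtain j where j: "norm (w j - z) < s' - norm (z - x)" "t j < 1"
        "norm (P ((1 / t j) *\<^sub>R (w j - z)) - u) < norm u / 2" by auto
      define e where "e = P ((1 / t j) *\<^sub>R (w j - z)) - u"
      have "t j *\<^sub>R (u + e) = P (w j) - P z"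
        using w(2)[of j] by (simp add: e_def linear_cmul[OF linear_P] P_diff)
      \<comment> \<open>A move by \<open>t j\<close> along a tangent vector over
        \<open>u = y - P z\<close> shortens the distance to \<open>y\<close> by
        \<open>t j * norm u\<close>, and the error \<open>e\<close> spoils at most half of this
        gain.\<close>
      then have eq: "P (w j) - y = t j *\<^sub>R e - (1 - t j) *\<^sub>R u"
        by (simp add: u_def algebra_simps)
      have "norm (P (w j) - y) \<le> norm (t j *\<^sub>R e) + norm ((1 - t j) *\<^sub>R u)"
        unfolding eq by (rule norm_triangle_ineq4)
      also have "\<dots> = t j * norm e + (1 - t j) * norm u" using w(2)[of j] j(2) by simp
      also have "t j * norm e \<le> t j * (norm u / 2)"
        using j(3) w(2)[of j] by (intro mult_left_mono) (auto simp: e_def)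
      also have "t j * (norm u / 2) + (1 - t j) * norm u = norm u - t j * norm u / 2"
        by (simp add: algebra_simps)
      also have "\<dots> < norm u" using w(2)[of j] u(2) by simp
      finally have "norm (P (w j) - y) < norm (P z - y)" by (simp add: u_def norm_minus_commute)
      moreover have "norm (w j - x) \<le> s'"
        using j(1) norm_triangle_ineq[of "w j - z" "z - x"] by simp
      ultimately show False using z_min[OF w(1)[of j]] by simp
    qed
    then show ?thesis using z(1) zs s' by (intro bexI[of _ z]) auto
  qed
  then show ?thesis using s' C(2) by (intro exI[of _ "s' / C / 2"]) auto
qed

text \<open>The functional
  \<open>norm (x - x') powr (1 - \<alpha>) - c * norm (P x - P p)\<close> on pairs of points with the same projection
  cannot have a positive maximum, since it increases when the pair is moved towards \<open>p\<close>.\<close>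

lemma sheet_distance:
  assumes r1: "0 < r1" "r1 < r0" and C: "0 < C"
    and sep: "\<And>x. x \<in> X \<Longrightarrow> norm (x - p) \<le> r1 \<Longrightarrow> norm (x - p) \<le> C * norm (P x - P p)"
    and \<alpha>: "0 < \<alpha>" "\<alpha> < 1" and s: "0 < s" and H: "0 \<le> H"
    and holder: "\<And>x y v. x \<in> X \<Longrightarrow> norm (x - p) < s \<Longrightarrow> y \<in> X \<Longrightarrow> norm (y - p) < s \<Longrightarrow>
      norm (A x *v v - A y *v v) \<le> H * norm (x - y) powr \<alpha> * norm v"
  shows "\<exists>c\<ge>0. \<exists>\<rho>>0. \<forall>x\<in>X. \<forall>x'\<in>X. norm (x - p) \<le> r1 \<longrightarrow> norm (x' - p) \<le> r1 \<longrightarrow> P x = P x' \<longrightarrow>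
    norm (P x - P p) < \<rho> \<longrightarrow> norm (x - x') powr (1 - \<alpha>) \<le> c * norm (P x - P p)"
proof -
  define \<beta> where "\<beta> = 1 - \<alpha>"
  have \<beta>: "0 < \<beta>" using \<alpha> by (simp add: \<beta>_def)
  \<comment> \<open>Moving the pair towards \<open>p\<close>, the difference of the slopes costs at
    most \<open>\<beta> * H * norm h\<close> in the first term of the functional; the additional
    \<beta> is a reserve for the deviations of the two sheets.\<close>
  define c where "c = \<beta> * (H + 1)"
  have c: "0 \<le> c" using \<beta> H by (simp add: c_def)
  \<comment> \<open>Together with \<open>sep\<close>, projections within \<rho> of
    \<open>P p\<close> place both points in the open balls of radius \<open>r1\<close> and
    \<open>s\<close>, so a maximizing pair is interior and the Hoelder bound applies to it.\<close>
  define \<rho> where "\<rho> = min r1 s / (2 * C)"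
  have \<rho>: "\<rho> > 0" "C * \<rho> < r1" "C * \<rho> < s" using r1 s C by (auto simp: \<rho>_def min_def field_simps)
  define K where "K = X \<inter> cball p r1"
  have compK: "compact K"
  proof -
    have "K = (X \<inter> cball p r0) \<inter> cball p r1" using r1 by (auto simp: K_def)
    then show ?thesis using compact by (metis closed_cball compact_Int_closed)
  qed
  have K_iff: "x \<in> K \<longleftrightarrow> x \<in> X \<and> norm (x - p) \<le> r1" for x
    by (auto simp: K_def dist_norm norm_minus_commute)
  define Z where "Z = {z \<in> K \<times> K. P (fst z) = P (snd z) \<and> norm (P (fst z) - P p) \<le> \<rho>}"
  define \<Phi> where "\<Phi> z = norm (fst z - snd z) powr \<beta> - c * norm (P (fst z) - P p)" for z
  have contP: "continuous_on UNIV (\<lambda>z :: (real^'n) \<times> (real^'n). P (fst z))"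
    "continuous_on UNIV (\<lambda>z :: (real^'n) \<times> (real^'n). P (snd z))"
    by (intro linear_continuous_on_compose[OF _ linear_P] continuous_intros)+
  have "closed {z. P (fst z) = P (snd z) \<and> norm (P (fst z) - P p) \<le> \<rho>}"
    by (intro closed_Collect_conj closed_Collect_eq closed_Collect_le continuous_intros contP)
  moreover have "Z = (K \<times> K) \<inter> {z. P (fst z) = P (snd z) \<and> norm (P (fst z) - P p) \<le> \<rho>}"
    by (auto simp: Z_def)
  ultimately have compZ: "compact Z" using compact_Int_closed[OF compact_Times[OF compK compK]] by simp
  have contPhi: "continuous_on Z \<Phi>"
    unfolding \<Phi>_def using \<beta>
    by (intro continuous_on_diff continuous_on_powr' continuous_on_mult continuous_on_const continuous_on_norm
        continuous_on_fst continuous_on_snd continuous_on_id continuous_on_subset[OF contP(1)]) auto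
  have pZ: "(p, p) \<in> Z" using p_in r1 \<rho> by (simp add: Z_def K_iff)
  obtain z0 where z0: "z0 \<in> Z" "\<And>z. z \<in> Z \<Longrightarrow> \<Phi> z \<le> \<Phi> z0"
    using continuous_attains_sup[OF compZ _ contPhi] pZ by blast
  have "\<Phi> z0 \<le> 0"
  proof (rule ccontr)
    assume "\<not> \<Phi> z0 \<le> 0"
    obtain x x' where xx': "z0 = (x, x')" by (cases z0)
    have x: "x \<in> X" "norm (x - p) \<le> r1" and x': "x' \<in> X" "norm (x' - p) \<le> r1" and Pxx': "P x = P x'"
      and \<rho>x: "norm (P x - P p) \<le> \<rho>"
      using z0(1) by (auto simp: Z_def xx' K_iff)
    define a where "a = norm (x - x')"
    define h where "h = P x - P p"
    have \<Phi>0: "\<Phi> z0 = a powr \<beta> - c * norm h" by (simp add: \<Phi>_def xx' a_def h_def)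
    have a: "a > 0"
    proof (rule ccontr)
      assume "\<not> a > 0"
      then have "a = 0" by (simp add: a_def)
      then have "\<Phi> z0 \<le> 0" using c by (simp add: \<Phi>0)
      then show False using \<open>\<not> \<Phi> z0 \<le> 0\<close> by simp
    qed
    have "C * norm h \<le> C * \<rho>" using \<rho>x C by (intro mult_left_mono) (auto simp: h_def)
    then have close: "norm (x - p) < r1" "norm (x' - p) < r1" "norm (x - p) < s" "norm (x' - p) < s"
      using sep[OF x] sep[OF x'] \<rho> Pxx' by (auto simp: h_def)
    have h: "norm h > 0"
    proof (rule ccontr)
      assume "\<not> norm h > 0"
      then have "P x = P p" "P x' = P p" using Pxx' by (auto simp: h_def)
      then have "x = p" "x' = p" using sep[OF x] sep[OF x'] by auto
      then show False using a by (simp add: a_def)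
    qed
    have hT: "h \<in> T0" unfolding h_def by (intro subspace_diff[OF T0] P_in)
    \<comment> \<open>The derivative of \<open>a powr \<beta>\<close> carries the factor
      \<open>a powr (- \<alpha>)\<close>, which \<open>a powr \<alpha>\<close> cancels. The quarter
      makes both deviations together consume half of the reserve in \<open>c\<close>.\<close>
    define \<epsilon> where "\<epsilon> = a powr \<alpha> / 4"
    have \<epsilon>: "\<epsilon> > 0" using a by (simp add: \<epsilon>_def)
    have xr: "norm (x - p) \<le> r0" "norm (x' - p) \<le> r0" "norm (x - p) < r0" "norm (x' - p) < r0"
      using close r1 by auto
    obtain d1 where d1: "d1 > 0" "\<And>y. y \<in> X \<Longrightarrow> norm (y - x) < d1 \<Longrightarrow> norm (dev x (y - x)) \<le> \<epsilon> * norm (P (y - x))"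
      using dev_small_P[OF x(1) xr(1) \<epsilon>] by auto
    obtain d2 where d2: "d2 > 0" "\<And>y. y \<in> X \<Longrightarrow> norm (y - x') < d2 \<Longrightarrow> norm (dev x' (y - x')) \<le> \<epsilon> * norm (P (y - x'))"
      using dev_small_P[OF x'(1) xr(2) \<epsilon>] by auto
    obtain e1 where e1: "e1 > 0"
      "\<And>y. y \<in> T0 \<Longrightarrow> norm (y - P x) < e1 \<Longrightarrow> \<exists>z\<in>X. norm (z - x) < min d1 (r1 - norm (x - p)) \<and> P z = y"
      using P_locally_open[OF x(1) xr(3), of "min d1 (r1 - norm (x - p))"] d1(1) close by auto
    obtain e2 where e2: "e2 > 0"
      "\<And>y. y \<in> T0 \<Longrightarrow> norm (y - P x') < e2 \<Longrightarrow> \<exists>z\<in>X. norm (z - x') < min d2 (r1 - norm (x' - p)) \<and> P z = y"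
      using P_locally_open[OF x'(1) xr(4), of "min d2 (r1 - norm (x' - p))"] d2(1) close by auto
    define \<kappa> where "\<kappa> = norm h * (H * a powr \<alpha> + 2 * \<epsilon>)"
    have \<kappa>: "\<kappa> > 0" using h H \<epsilon> a unfolding \<kappa>_def by (intro mult_pos_pos add_nonneg_pos) auto
    \<comment> \<open>Up to the constant \<open>c * norm h\<close>, a lower bound for the functional
      at the pair lying over \<open>P x - \<tau> *\<^sub>R h\<close>. The reserve leaves it the
      derivative \<open>norm h * (\<beta> / 2)\<close> at 0, which is positive.\<close>
    define g where "g \<tau> = (a - \<tau> * \<kappa>) powr \<beta> + c * (\<tau> * norm h)" for \<tau>
    have "(g has_real_derivative (\<beta> * a powr (\<beta> - 1) * (- \<kappa>) + c * norm h)) (at 0)"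
      unfolding g_def using a by (auto intro!: derivative_eq_intros simp: powr_diff field_simps)
    moreover have "\<beta> * a powr (\<beta> - 1) * (- \<kappa>) + c * norm h = norm h * (\<beta> / 2)"
    proof -
      have "a powr (\<beta> - 1) * a powr \<alpha> = 1" using a by (simp add: powr_add[symmetric] \<beta>_def)
      moreover have "\<kappa> = norm h * ((H + 1/2) * a powr \<alpha>)" by (simp add: \<kappa>_def \<epsilon>_def algebra_simps)
      ultimately have "a powr (\<beta> - 1) * \<kappa> = norm h * (H + 1/2)"
        by (metis (no_types, opaque_lifting) mult.assoc mult.commute mult.right_neutral)
      then have "\<beta> * a powr (\<beta> - 1) * (- \<kappa>) = - \<beta> * (norm h * (H + 1/2))" by simp
      then show ?thesis by (simp add: c_def algebra_simps)
    qed
    ultimately have "(g has_real_derivative norm h * (\<beta> / 2)) (at 0)" by (simp only:)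
    moreover have "0 < norm h * (\<beta> / 2)" using h \<beta> by simp
    ultimately obtain d where d: "d > 0" "\<And>\<tau>. 0 < \<tau> \<Longrightarrow> \<tau> < d \<Longrightarrow> g 0 < g \<tau>"
      using DERIV_pos_inc_right[of g "norm h * (\<beta> / 2)" 0] by auto
    define m where "m = Min {d, 1, a / \<kappa>, e1 / norm h, e2 / norm h}"
    have "0 < m" using d(1) a \<kappa> e1(1) e2(1) h by (simp add: m_def)
    define \<tau> where "\<tau> = m / 2"
    have "0 < \<tau>" "\<tau> < m" using \<open>0 < m\<close> by (simp_all add: \<tau>_def)
    then have \<tau>: "0 < \<tau>" "\<tau> < d" "\<tau> < 1" "\<tau> < a / \<kappa>" "\<tau> < e1 / norm h" "\<tau> < e2 / norm h"
      unfolding m_def by simp_all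
    then have \<tau>': "\<tau> * \<kappa> < a" "norm (\<tau> *\<^sub>R h) < e1" "norm (\<tau> *\<^sub>R h) < e2"
      using \<kappa> h by (auto simp: pos_less_divide_eq)
    define y where "y = P x - \<tau> *\<^sub>R h"
    have yT: "y \<in> T0" unfolding y_def by (intro subspace_diff[OF T0] subspace_mul[OF T0] P_in hT)
    obtain z where z: "z \<in> X" "norm (z - x) < d1" "norm (z - x) < r1 - norm (x - p)" "P z = y"
      using e1(2)[OF yT] \<tau>'(2) by (auto simp: y_def)
    obtain z' where z': "z' \<in> X" "norm (z' - x') < d2" "norm (z' - x') < r1 - norm (x' - p)" "P z' = y"
      using e2(2)[OF yT] \<tau>'(3) Pxx' by (auto simp: y_def)
    have yp: "y - P p = (1 - \<tau>) *\<^sub>R h" by (simp add: y_def h_def algebra_simps)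
    have "norm (y - P p) \<le> norm h" unfolding yp using \<tau> by (simp add: mult_left_le_one_le)
    moreover have "norm (z - p) \<le> r1" "norm (z' - p) \<le> r1"
      using z(3) z'(3) norm_triangle_ineq[of "z - x" "x - p"] norm_triangle_ineq[of "z' - x'" "x' - p"] by auto
    ultimately have zZ: "(z, z') \<in> Z" using z z' \<rho>x by (simp add: Z_def K_iff h_def)
    have Pz: "P (z - x) = - (\<tau> *\<^sub>R h)" "P (z' - x') = - (\<tau> *\<^sub>R h)"
      using z(4) z'(4) Pxx' by (auto simp: P_diff y_def)
    have Az: "A x *v (z - x) = - (\<tau> *\<^sub>R (A x *v h))" "A x' *v (z' - x') = - (\<tau> *\<^sub>R (A x' *v h))"
      using A_P[OF x(1) xr(1), of "z - x"] A_P[OF x'(1) xr(2), of "z' - x'"]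
      by (auto simp: Pz matrix_vector_mult_scaleR vec.neg)
    have dev_eq: "dev x (z - x) = (z - x) + \<tau> *\<^sub>R h + \<tau> *\<^sub>R (A x *v h)"
      "dev x' (z' - x') = (z' - x') + \<tau> *\<^sub>R h + \<tau> *\<^sub>R (A x' *v h)"
      unfolding dev_def Pz Az by simp_all
    \<comment> \<open>The common horizontal move cancels. What remains is the difference of the
      slopes, controlled by the Hoelder bound at distance \<open>a\<close>, and the two
      deviations.\<close>
    have eq: "x - x' = (z - z') - \<tau> *\<^sub>R (A x' *v h - A x *v h) - (dev x (z - x) - dev x' (z' - x'))"
      unfolding dev_eq by (simp add: algebra_simps)
    have "a \<le> norm (z - z') + norm (\<tau> *\<^sub>R (A x' *v h - A x *v h)) + norm (dev x (z - x) - dev x' (z' - x'))"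
      unfolding a_def eq
      using norm_triangle_ineq4[of "(z - z') - \<tau> *\<^sub>R (A x' *v h - A x *v h)" "dev x (z - x) - dev x' (z' - x')"]
        norm_triangle_ineq4[of "z - z'" "\<tau> *\<^sub>R (A x' *v h - A x *v h)"] by linarith
    moreover have "norm (\<tau> *\<^sub>R (A x' *v h - A x *v h)) \<le> \<tau> * (H * a powr \<alpha> * norm h)"
      using holder[OF x'(1) close(4) x(1) close(3), of h] \<tau>(1) by (simp add: a_def norm_minus_commute)
    moreover have "norm (dev x (z - x) - dev x' (z' - x')) \<le> \<epsilon> * (\<tau> * norm h) + \<epsilon> * (\<tau> * norm h)"
      using norm_triangle_ineq4[of "dev x (z - x)" "dev x' (z' - x')"] d1(2)[OF z(1,2)] d2(2)[OF z'(1,2)] \<tau>(1)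
      by (simp add: Pz)
    ultimately have "a - \<tau> * \<kappa> \<le> norm (z - z')" by (simp add: \<kappa>_def algebra_simps)
    then have "(a - \<tau> * \<kappa>) powr \<beta> \<le> norm (z - z') powr \<beta>"
      using \<tau>'(1) \<beta> by (intro powr_mono2) auto
    moreover have "\<Phi> (z, z') = norm (z - z') powr \<beta> - c * ((1 - \<tau>) * norm h)"
      using \<tau>(3) by (simp add: \<Phi>_def z(4) yp)
    ultimately have "g \<tau> - c * norm h \<le> \<Phi> (z, z')" by (simp add: g_def algebra_simps)
    moreover have "g 0 - c * norm h = \<Phi> z0" by (simp add: g_def \<Phi>0)
    ultimately have "\<Phi> z0 < \<Phi> (z, z')" using d(2)[OF \<tau>(1,2)] by linarith
    then show False using z0(2)[OF zZ] by simp
  qed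
  then have "\<Phi> z \<le> 0" if "z \<in> Z" for z using z0(2)[OF that] by simp
  then have "norm (x - x') powr (1 - \<alpha>) \<le> c * norm (P x - P p)"
    if "x \<in> X" "x' \<in> X" "norm (x - p) \<le> r1" "norm (x' - p) \<le> r1" "P x = P x'" "norm (P x - P p) < \<rho>" for x x'
  proof -
    have "(x, x') \<in> Z" using that by (simp add: Z_def K_iff)
    from \<open>\<And>z. z \<in> Z \<Longrightarrow> \<Phi> z \<le> 0\<close>[OF this] show ?thesis by (simp add: \<Phi>_def \<beta>_def)
  qed
  then show ?thesis using c \<rho>(1) by blast
qed

end

section \<open>Polynomial boundedness against flat gaps\<close>

context polynomially_bounded_o_minimal
begin

text \<open>If pairs with equal projection and positive gap occurred arbitrarily close to
  \<open>P p\<close>, polynomial boundedness would provide, within distance \<open>1 / s\<close>, a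
  pair whose gap is at least \<open>1 / s ^ N\<close>. For large \<open>s\<close> this contradicts
  flatness of order \<open>N + 1\<close>.\<close>

lemma no_flat_gap:
  fixes K :: "'a::euclidean_space set" and P :: "'a \<Rightarrow> 'a"
  assumes K: "definable_pred (\<lambda>x. x \<in> K)" and P: "linear P"
    and flat: "\<And>N. \<exists>c \<rho>. 0 < \<rho> \<and> (\<forall>x\<in>K. \<forall>x'\<in>K. P x = P x' \<longrightarrow> norm (P x - P p) < \<rho> \<longrightarrow>
      norm (x - x') \<le> c * norm (P x - P p) ^ N)"
  shows "\<exists>\<rho>>0. \<forall>x\<in>K. \<forall>x'\<in>K. P x = P x' \<longrightarrow> norm (P x - P p) < \<rho> \<longrightarrow> x = x'"
proof (rule ccontr)
  assume neg: "\<not> ?thesis"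
  \<comment> \<open>\<open>u\<close> is the inverse of the gap, and the distance to
    \<open>P p\<close> is at most \<open>1 / \<bar>s\<bar>\<close> when \<open>s\<close> is nonzero.
    Both conditions are multiplied out: they are polynomial and make sense for every real
    \<open>s\<close>, as nonempty slices are required for all of them.\<close>
  define E where "E s u \<longleftrightarrow> 0 < u \<and> (\<exists>x x'. x \<in> K \<and> x' \<in> K \<and> P x = P x' \<and>
     (s * s) * ((P x - P p) \<bullet> (P x - P p)) \<le> 1 \<and> (u * u) * ((x - x') \<bullet> (x - x')) = 1)" for s u :: real
  have K': "definable_pred (\<lambda>z. f z \<in> K)" if "poly_map f" for f :: "'b::euclidean_space \<Rightarrow> 'a"
    by (rule definable_pred_vimage[OF K that])
  have P': "poly_map (\<lambda>z. P (f z))" if "poly_map f" for f :: "'b::euclidean_space \<Rightarrow> 'a"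
    by (rule poly_map_linear_comp[OF that P])
  have "definable_pred (\<lambda>z. E (fst z) (snd z))"
    unfolding E_def
    by (rule definable_pred_conj definable_pred_ex K' definable_pred_less definable_pred_le definable_pred_eq poly_map_mult poly_map_inner
        poly_map_diff P' poly_map_id poly_map_const poly_map_fst poly_map_snd)+
  moreover have "\<exists>u. E s u" for s
  proof -
    have "0 < 1 / (\<bar>s\<bar> + 1)" by simp
    with neg obtain x x' where x: "x \<in> K" "x' \<in> K" "P x = P x'" "norm (P x - P p) < 1 / (\<bar>s\<bar> + 1)" "x \<noteq> x'"
      by blast
    have "(\<bar>s\<bar> + 1) * norm (P x - P p) < 1" using x(4) by (simp add: field_simps)
    moreover have "\<bar>s\<bar> * norm (P x - P p) \<le> (\<bar>s\<bar> + 1) * norm (P x - P p)" by (intro mult_right_mono) auto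
    ultimately have "\<bar>s * norm (P x - P p)\<bar> \<le> 1" by (simp add: abs_mult)
    then have "(s * norm (P x - P p))\<^sup>2 \<le> 1" by (simp add: abs_square_le_1)
    then have "(s * s) * ((P x - P p) \<bullet> (P x - P p)) \<le> 1"
      by (simp add: dot_square_norm power2_eq_square mult_ac)
    moreover have "((1 / norm (x - x')) * (1 / norm (x - x'))) * ((x - x') \<bullet> (x - x')) = 1"
      using x(5) by (simp add: dot_square_norm power2_eq_square)
    ultimately have "E s (1 / norm (x - x'))" unfolding E_def using x
      by (intro conjI exI[of _ x] exI[of _ x']) simp_all
    then show ?thesis ..
  qed
  moreover have "0 \<le> u" if "E s u" for s u using that by (simp add: E_def)
  ultimately obtain N where N: "eventually (\<lambda>s. \<exists>u. E s u \<and> u \<le> s ^ N) at_top"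
    using polynomially_bounded_slices[of E] by auto
  obtain c \<rho> where c: "0 < \<rho>" "\<And>x x'. x \<in> K \<Longrightarrow> x' \<in> K \<Longrightarrow> P x = P x' \<Longrightarrow> norm (P x - P p) < \<rho> \<Longrightarrow>
      norm (x - x') \<le> c * norm (P x - P p) ^ (N + 1)"
    using flat[of "N + 1"] by auto
  have "eventually (\<lambda>s. max (max c (1 / \<rho>)) 1 < s \<and> (\<exists>u. E s u \<and> u \<le> s ^ N)) at_top"
    using N eventually_gt_at_top by (rule eventually_conj[rotated])
  from eventually_happens[OF this] obtain s where s: "c < s" "1 / \<rho> < s" "1 < s" "\<exists>u. E s u \<and> u \<le> s ^ N"
    by auto
  then obtain u x x' where u: "0 < u" "u \<le> s ^ N" and x: "x \<in> K" "x' \<in> K" "P x = P x'"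
     and 1: "(s * s) * ((P x - P p) \<bullet> (P x - P p)) \<le> 1" and 2: "(u * u) * ((x - x') \<bullet> (x - x')) = 1"
    by (auto simp: E_def)
  have "(s * norm (P x - P p))\<^sup>2 \<le> 1\<^sup>2"
    using 1 by (simp add: dot_square_norm power2_eq_square mult_ac)
  then have "s * norm (P x - P p) \<le> 1" by (rule power2_le_imp_le) simp
  then have h: "norm (P x - P p) \<le> 1 / s" using s by (simp add: field_simps)
  have "1 / s < \<rho>" using s c(1) by (simp add: field_simps)
  with h have "norm (P x - P p) < \<rho>" by simp
  from c(2)[OF x this] have "norm (x - x') \<le> c * norm (P x - P p) ^ (N + 1)" .
  also have "\<dots> \<le> max c 0 * (1 / s) ^ (N + 1)"
    using h by (intro mult_mono power_mono) auto
  finally have 3: "norm (x - x') * s ^ (N + 1) \<le> max c 0"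
    using s by (simp add: power_divide pos_le_divide_eq field_simps)
  have "(u * norm (x - x'))\<^sup>2 = 1" using 2 by (simp add: dot_square_norm power2_eq_square mult_ac)
  then have "u * norm (x - x') = 1 \<or> u * norm (x - x') = - 1" by (simp only: power2_eq_1_iff)
  moreover have "0 \<le> u * norm (x - x')" using u(1) by simp
  ultimately have "u * norm (x - x') = 1" by linarith
  then have "1 \<le> s ^ N * norm (x - x')" using u(2) mult_right_mono[of u "s ^ N" "norm (x - x')"] by simp
  \<comment> \<open>Flatness of order \<open>N + 1\<close> leaves one surplus factor
    \<open>s\<close>, which would have to stay below the constant.\<close>
  then have "s * 1 \<le> s * (s ^ N * norm (x - x'))" using s by (intro mult_left_mono) auto
  then have "s \<le> max c 0" using 3 by (simp add: mult_ac)
  then show False using s by auto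
qed

end

text \<open>Only small closed balls in \<open>X\<close> are required to be definable, as
  \<open>X\<close> is just locally definable. The radius and the constant of the Hoelder bound may
  depend on \<alpha>.\<close>

locale definable_flat_cones = flat_cones X T0 A p r0 + polynomially_bounded_o_minimal S
  for X T0 :: "(real^'n) set" and A p r0 S +
  assumes holder: "\<And>\<alpha>. 0 < \<alpha> \<Longrightarrow> \<alpha> < 1 \<Longrightarrow> \<exists>s>0. \<exists>H\<ge>0. \<forall>x\<in>X. \<forall>y\<in>X. \<forall>v. norm (x - p) < s \<longrightarrow>
      norm (y - p) < s \<longrightarrow> norm (A x *v v - A y *v v) \<le> H * norm (x - y) powr \<alpha> * norm v"
    and definable_ball: "\<And>r. 0 < r \<Longrightarrow> r \<le> r0 \<Longrightarrow> definable_pred (\<lambda>x. x \<in> X \<and> norm (x - p) \<le> r)"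
begin

lemma single_sheet:
  obtains r1 \<rho> where "0 < r1" "r1 < r0" "0 < \<rho>"
    "\<And>x x'. x \<in> X \<Longrightarrow> x' \<in> X \<Longrightarrow> norm (x - p) \<le> r1 \<Longrightarrow> norm (x' - p) \<le> r1 \<Longrightarrow> P x = P x' \<Longrightarrow>
      norm (P x - P p) < \<rho> \<Longrightarrow> x = x'"
proof -
  obtain \<delta> C where C: "\<delta> > 0" "C > 0" "\<And>y. y \<in> X \<Longrightarrow> norm (y - p) < \<delta> \<Longrightarrow> norm (y - p) \<le> C * norm (P (y - p))"
    using norm_le_P[OF p_in] r0 by auto
  define r1 where "r1 = min \<delta> r0 / 2"
  have r1: "0 < r1" "r1 < r0" "r1 < \<delta>" using C(1) r0 by (auto simp: r1_def)
  have sep: "norm (x - p) \<le> C * norm (P x - P p)" if "x \<in> X" "norm (x - p) \<le> r1" for x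
    using C(3)[of x] that r1 by (simp add: P_diff)
  define K where "K = {x \<in> X. norm (x - p) \<le> r1}"
  have "\<exists>c \<rho>. 0 < \<rho> \<and> (\<forall>x\<in>K. \<forall>x'\<in>K. P x = P x' \<longrightarrow> norm (P x - P p) < \<rho> \<longrightarrow>
      norm (x - x') \<le> c * norm (P x - P p) ^ N)" for N
  proof -
    \<comment> \<open>Then \<open>1 / (1 - \<alpha>)\<close> is \<open>N + 2\<close>. With
      \<open>N + 1\<close> in its place, \<alpha> would be 0 for \<open>N = 0\<close>.\<close>
    define \<alpha> where "\<alpha> = 1 - 1 / real (N + 2)"
    have \<alpha>: "0 < \<alpha>" "\<alpha> < 1" by (auto simp: \<alpha>_def)
    obtain s H where H: "0 < s" "0 \<le> H" "\<And>x y v. x \<in> X \<Longrightarrow> norm (x - p) < s \<Longrightarrow> y \<in> X \<Longrightarrow> norm (y - p) < s \<Longrightarrow>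
        norm (A x *v v - A y *v v) \<le> H * norm (x - y) powr \<alpha> * norm v"
      using holder[OF \<alpha>] by metis
    obtain c \<rho> where c: "0 \<le> c" "0 < \<rho>" "\<And>x x'. x \<in> X \<Longrightarrow> x' \<in> X \<Longrightarrow> norm (x - p) \<le> r1 \<Longrightarrow> norm (x' - p) \<le> r1 \<Longrightarrow>
        P x = P x' \<Longrightarrow> norm (P x - P p) < \<rho> \<Longrightarrow> norm (x - x') powr (1 - \<alpha>) \<le> c * norm (P x - P p)"
      using sheet_distance[OF r1(1,2) C(2) sep \<alpha> H] by blast
    \<comment> \<open>The bound by 1 on the distance to \<open>P p\<close> allows its exponent
      \<open>N + 2\<close> to be lowered to \<open>N\<close>.\<close>
    have "norm (x - x') \<le> c ^ (N + 2) * norm (P x - P p) ^ N"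
      if x: "x \<in> K" "x' \<in> K" "P x = P x'" "norm (P x - P p) < min \<rho> 1" for x x'
    proof -
      have "norm (x - x') = (norm (x - x') powr (1 - \<alpha>)) powr real (N + 2)"
        by (simp add: powr_powr \<alpha>_def)
      also have "\<dots> \<le> (c * norm (P x - P p)) powr real (N + 2)"
        using x c(3)[of x x'] by (intro powr_mono2) (auto simp: K_def)
      also have "\<dots> = (c * norm (P x - P p)) ^ (N + 2)"
        using c(1) by (cases "c * norm (P x - P p) = 0") (auto simp: powr_realpow[symmetric] simp del: power_Suc)
      also have "\<dots> \<le> c ^ (N + 2) * norm (P x - P p) ^ N"
        unfolding power_mult_distrib using x(4) c(1)
        by (intro mult_left_mono power_decreasing) auto
      finally show ?thesis .
    qed
    then show ?thesis using c(2) by (intro exI[of _ "c ^ (N + 2)"] exI[of _ "min \<rho> 1"]) auto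
  qed
  moreover have "definable_pred (\<lambda>x. x \<in> K)" using definable_ball[of r1] r1 by (simp add: K_def)
  ultimately obtain \<rho> where "0 < \<rho>" "\<forall>x\<in>K. \<forall>x'\<in>K. P x = P x' \<longrightarrow> norm (P x - P p) < \<rho> \<longrightarrow> x = x'"
    using no_flat_gap[OF _ linear_P, of K p] by blast
  then show ?thesis using that[OF r1(1,2)] by (auto simp: K_def)
qed

text \<open>\<gamma> sends each point of the cylinder around \<open>p\<close> to the only nearby
  point of \<open>X\<close> on its fibre of \<open>P\<close>. It factors through \<open>P\<close>,
  so its derivative is the tangent graph composed with \<open>P\<close>: the term
  \<open>A (\<gamma> x) *v h\<close> only sees \<open>P h\<close>.\<close>

lemma local_graph:
  obtains r1 \<rho> \<gamma> where "0 < r1" "r1 < r0" "0 < \<rho>"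
    "\<And>x. norm (P x - P p) < \<rho> \<Longrightarrow> \<gamma> x \<in> X \<and> norm (\<gamma> x - p) < r1 \<and> P (\<gamma> x) = P x"
    "\<And>x z. norm (P x - P p) < \<rho> \<Longrightarrow> z \<in> X \<Longrightarrow> norm (z - p) \<le> r1 \<Longrightarrow> P z = P x \<Longrightarrow> z = \<gamma> x"
    "\<And>x. norm (P x - P p) < \<rho> \<Longrightarrow> (\<gamma> has_derivative (\<lambda>h. P h + A (\<gamma> x) *v h)) (at x)"
proof -
  obtain r1 \<rho>0 where r1: "0 < r1" "r1 < r0" "0 < \<rho>0"
    and inj: "\<And>x x'. x \<in> X \<Longrightarrow> x' \<in> X \<Longrightarrow> norm (x - p) \<le> r1 \<Longrightarrow> norm (x' - p) \<le> r1 \<Longrightarrow> P x = P x' \<Longrightarrow>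
      norm (P x - P p) < \<rho>0 \<Longrightarrow> x = x'"
    using single_sheet by blast
  obtain \<delta> where \<delta>: "\<delta> > 0" "\<And>y. y \<in> T0 \<Longrightarrow> norm (y - P p) < \<delta> \<Longrightarrow> \<exists>z\<in>X. norm (z - p) < r1 \<and> P z = y"
    using P_locally_open[OF p_in, of r1] r0 r1 by auto
  define \<rho> where "\<rho> = min \<rho>0 \<delta>"
  have \<rho>: "0 < \<rho>" "\<rho> \<le> \<rho>0" "\<rho> \<le> \<delta>" using r1 \<delta> by (auto simp: \<rho>_def)
  define \<gamma> where "\<gamma> x = (SOME z. z \<in> X \<and> norm (z - p) < r1 \<and> P z = P x)" for x
  have \<gamma>: "\<gamma> x \<in> X" "norm (\<gamma> x - p) < r1" "P (\<gamma> x) = P x" if "norm (P x - P p) < \<rho>" for x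
  proof -
    have "\<exists>z. z \<in> X \<and> norm (z - p) < r1 \<and> P z = P x" using \<delta>(2)[OF P_in, of x] that \<rho> by auto
    from someI_ex[OF this] show "\<gamma> x \<in> X" "norm (\<gamma> x - p) < r1" "P (\<gamma> x) = P x" unfolding \<gamma>_def by auto
  qed
  have uniq: "z = \<gamma> x" if "norm (P x - P p) < \<rho>" "z \<in> X" "norm (z - p) \<le> r1" "P z = P x" for x z
    using inj[of z "\<gamma> x"] \<gamma>[OF that(1)] that \<rho> by auto
  have "(\<gamma> has_derivative (\<lambda>h. P h + A (\<gamma> x) *v h)) (at x)" if x: "norm (P x - P p) < \<rho>" for x
    unfolding has_derivative_at_alt
  proof (intro conjI allI impI)
    show "bounded_linear (\<lambda>h. P h + A (\<gamma> x) *v h)"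
      unfolding P_def by (intro bounded_linear_add matrix_vector_mul_bounded_linear)
  next
    fix e :: real assume "0 < e"
    let ?q = "\<gamma> x"
    have q: "?q \<in> X" "norm (?q - p) \<le> r0" "norm (?q - p) < r0" using \<gamma>[OF x] r1 by auto
    obtain d where d: "d > 0" "\<And>y. y \<in> X \<Longrightarrow> norm (y - ?q) < d \<Longrightarrow> norm (dev ?q (y - ?q)) \<le> e * norm (P (y - ?q))"
      using dev_small_P[OF q(1,2) \<open>0 < e\<close>] by auto
    \<comment> \<open>Openness of \<open>P\<close> at \<open>?q\<close> provides a point of
      \<open>X\<close> over \<open>P y\<close> near \<open>?q\<close>, and uniqueness identifies it
      with \<open>\<gamma> y\<close>. Continuity of \<gamma> is thereby included.\<close>
    obtain d' where d': "d' > 0"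
      "\<And>y. y \<in> T0 \<Longrightarrow> norm (y - P ?q) < d' \<Longrightarrow> \<exists>z\<in>X. norm (z - ?q) < min d (r1 - norm (?q - p)) \<and> P z = y"
      using P_locally_open[OF q(1,3), of "min d (r1 - norm (?q - p))"] d(1) \<gamma>[OF x] by auto
    show "\<exists>d>0. \<forall>y. norm (y - x) < d \<longrightarrow>
        norm (\<gamma> y - \<gamma> x - (P (y - x) + A (\<gamma> x) *v (y - x))) \<le> e * norm (y - x)"
    proof (intro exI[of _ "min d' (\<rho> - norm (P x - P p))"] conjI allI impI)
      fix y assume y: "norm (y - x) < min d' (\<rho> - norm (P x - P p))"
      have Pyx: "norm (P y - P x) \<le> norm (y - x)" using norm_P[of "y - x"] by (simp add: P_diff)
      have "norm (P y - P p) < \<rho>" using norm_triangle_ineq[of "P y - P x" "P x - P p"] Pyx y by simp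
      obtain z where z: "z \<in> X" "norm (z - ?q) < d" "norm (z - ?q) < r1 - norm (?q - p)" "P z = P y"
        using d'(2)[OF P_in, of y] Pyx y \<gamma>(3)[OF x] by auto
      have "norm (z - p) \<le> r1" using norm_triangle_ineq[of "z - ?q" "?q - p"] z(3) by simp
      then have zy: "z = \<gamma> y" using uniq[OF \<open>norm (P y - P p) < \<rho>\<close> z(1)] z(4) by simp
      have Pz: "P (z - ?q) = P (y - x)" using \<gamma>(3)[OF x] z(4) by (simp add: P_diff)
      have Az: "A ?q *v (z - ?q) = A ?q *v (y - x)"
        using A_P[OF q(1,2), of "z - ?q"] A_P[OF q(1,2), of "y - x"] Pz by simp
      \<comment> \<open>The deviation from the tangent plane is exactly the remainder in the
        definition of the derivative.\<close>
      have "dev ?q (z - ?q) = \<gamma> y - \<gamma> x - (P (y - x) + A (\<gamma> x) *v (y - x))"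
        by (simp add: dev_def Pz[unfolded zy] Az[unfolded zy] zy)
      moreover have "norm (dev ?q (z - ?q)) \<le> e * norm (P (y - x))" using d(2)[OF z(1,2)] Pz by simp
      moreover have "e * norm (P (y - x)) \<le> e * norm (y - x)" using \<open>0 < e\<close> norm_P by (intro mult_left_mono) auto
      ultimately show "norm (\<gamma> y - \<gamma> x - (P (y - x) + A (\<gamma> x) *v (y - x))) \<le> e * norm (y - x)" by simp
    qed (use d'(1) x in auto)
  qed
  then show ?thesis using that[OF r1(1,2) \<rho>(1)] \<gamma> uniq by blast
qed

end

section \<open>From the Nash transformation to a submanifold\<close>

subsection \<open>Definable functions of all Hoelder classes are Lipschitz\<close>

context real_structure
begin

definition definable_on :: "'a::euclidean_space set \<Rightarrow> ('a \<Rightarrow> 'b::euclidean_space) \<Rightarrow> bool" where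
  "definable_on V f \<longleftrightarrow> definable_pred (\<lambda>z. fst z \<in> V \<and> snd z = f (fst z))"

lemma definable_pred_graph:
  assumes "definable_on V f" "poly_map g" "poly_map h"
  shows "definable_pred (\<lambda>z. g z \<in> V \<and> h z = f (g z))"
  using definable_pred_vimage[OF assms(1)[unfolded definable_on_def] poly_map_Pair[OF assms(2,3)]] by simp

text \<open>The limit of the difference quotients is a first-order condition on the graph of
  \<open>f\<close>. Function values occur as quantified variables tied to \<open>G\<close>, because
  only polynomial terms may be substituted into definable predicates.\<close>

lemma definable_on_derivative:
  fixes f :: "real^'n \<Rightarrow> 'b::euclidean_space"
  assumes V: "open V" and f: "definable_on V f"
    and D: "\<And>x. x \<in> V \<Longrightarrow> ((\<lambda>t. f (x + t *\<^sub>R axis i 1)) has_vector_derivative D x) (at 0)"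
  shows "definable_on V D"
proof -
  define G where "G x y \<longleftrightarrow> x \<in> V \<and> y = f x" for x y
  \<comment> \<open>Norms are squared and there is no division by \<open>t\<close>. The condition
    \<open>t * t < \<delta>\<close> expresses that \<open>t\<close> is small, and at
    \<open>t = 0\<close> the inequality reads \<open>0 \<le> 0\<close>.\<close>
  define Q where "Q x w \<longleftrightarrow> (\<exists>b. G x b \<and> (\<forall>\<epsilon>. 0 < \<epsilon> \<longrightarrow> (\<exists>\<delta>. 0 < \<delta> \<and> (\<forall>t. t * t < \<delta> \<longrightarrow>
     (\<exists>a. G (x + t *\<^sub>R axis i 1) a \<and>
       (a - b - t *\<^sub>R w) \<bullet> (a - b - t *\<^sub>R w) \<le> (\<epsilon> * \<epsilon>) * (t * t))))))" for x and w :: 'b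
  have G: "definable_pred (\<lambda>z. G (g z) (h z))" if "poly_map g" "poly_map h"
    for g :: "'c::euclidean_space \<Rightarrow> real^'n" and h :: "'c \<Rightarrow> 'b"
    unfolding G_def by (rule definable_pred_graph[OF f that])
  have "definable_pred (\<lambda>z. Q (fst z) (snd z))"
    unfolding Q_def
    by (rule definable_pred_ex definable_pred_conj definable_pred_all definable_pred_imp G definable_pred_less definable_pred_le poly_map_mult poly_map_inner
        poly_map_diff poly_map_add poly_map_scaleR poly_map_id poly_map_const poly_map_fst poly_map_snd)+
  moreover have "Q x w \<longleftrightarrow> x \<in> V \<and> w = D x" for x w
  proof (cases "x \<in> V")
    case x: True
    define q where "q t = (1 / t) *\<^sub>R (f (x + t *\<^sub>R axis i 1) - f x)" for t
    have lim: "(q \<longlongrightarrow> D x) (at 0)"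
      using D[OF x] unfolding has_vector_derivative_at_0_iff by (simp add: q_def[abs_def])
    have norm_eq: "(f (x + t *\<^sub>R axis i 1) - f x - t *\<^sub>R w) \<bullet> (f (x + t *\<^sub>R axis i 1) - f x - t *\<^sub>R w) \<le>
        (\<epsilon> * \<epsilon>) * (t * t) \<longleftrightarrow> norm (q t - w) \<le> \<epsilon>" if "t \<noteq> 0" "0 < \<epsilon>" for t \<epsilon>
    proof -
      have "f (x + t *\<^sub>R axis i 1) - f x - t *\<^sub>R w = t *\<^sub>R (q t - w)"
        using that by (simp add: q_def scaleR_diff_right)
      then have "(f (x + t *\<^sub>R axis i 1) - f x - t *\<^sub>R w) \<bullet> (f (x + t *\<^sub>R axis i 1) - f x - t *\<^sub>R w) =
          (norm (q t - w))\<^sup>2 * (t * t)"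
        by (simp add: dot_square_norm power2_eq_square)
      moreover have "0 < t * t" using that by (metis mult_eq_0_iff not_real_square_gt_zero)
      ultimately show ?thesis
        using that by (simp add: mult_le_cancel_right abs_le_square_iff[symmetric] power2_eq_square[symmetric])
    qed
    obtain r where r: "r > 0" "ball x r \<subseteq> V" using V x openE by blast
    have inV: "x + t *\<^sub>R axis i 1 \<in> V" if "t * t < r * r" for t
    proof -
      have "\<bar>t\<bar> < r" using that r by (metis abs_mult_self_eq abs_ge_zero less_imp_le mult_mono not_less)
      then show ?thesis using r(2) by (auto simp: dist_norm subset_eq norm_axis_1)
    qed
    have Q_iff: "Q x w \<longleftrightarrow> (\<forall>\<epsilon>>0. \<exists>\<delta>>0. \<forall>t. t * t < \<delta> \<longrightarrow> x + t *\<^sub>R axis i 1 \<in> V \<and> (t \<noteq> 0 \<longrightarrow> norm (q t - w) \<le> \<epsilon>))"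
    proof -
      have "(\<exists>a. G (x + t *\<^sub>R axis i 1) a \<and> (a - f x - t *\<^sub>R w) \<bullet> (a - f x - t *\<^sub>R w) \<le> (\<epsilon> * \<epsilon>) * (t * t)) \<longleftrightarrow>
          x + t *\<^sub>R axis i 1 \<in> V \<and> (t \<noteq> 0 \<longrightarrow> norm (q t - w) \<le> \<epsilon>)" if "0 < \<epsilon>" for t \<epsilon>
        using norm_eq[of t \<epsilon>] that by (cases "t = 0") (auto simp: G_def)
      then show ?thesis unfolding Q_def using x by (simp add: G_def[of x] cong: conj_cong)
    qed
    have "Q x w \<longleftrightarrow> w = D x"
    proof
      assume Q: "Q x w"
      have "(q \<longlongrightarrow> w) (at 0)"
      proof (rule tendstoI)
        fix e :: real assume "0 < e"
        then obtain \<delta> where \<delta>: "\<delta> > 0" "\<And>t. t * t < \<delta> \<Longrightarrow> t \<noteq> 0 \<Longrightarrow> norm (q t - w) \<le> e / 2"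
          using Q unfolding Q_iff by (metis half_gt_zero)
        have "((\<lambda>t. t * t) \<longlongrightarrow> 0 * 0) (at (0::real))" by (intro tendsto_intros)
        then have "eventually (\<lambda>t. t * t < \<delta>) (at (0::real))" using \<delta>(1) by (intro order_tendstoD) auto
        then show "eventually (\<lambda>t. dist (q t) w < e) (at 0)"
          unfolding eventually_at_filter
        proof (rule eventually_mono, intro impI)
          fix t :: real assume "t \<noteq> 0 \<longrightarrow> t \<in> UNIV \<longrightarrow> t * t < \<delta>" "t \<noteq> 0" "t \<in> UNIV"
          then have "norm (q t - w) \<le> e / 2" using \<delta>(2) by blast
          then show "dist (q t) w < e" using \<open>0 < e\<close> by (simp add: dist_norm)
        qed
      qed
      then show "w = D x" using lim tendsto_unique[of "at (0::real)"] by auto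
    next
      assume w: "w = D x"
      show "Q x w"
        unfolding Q_iff
      proof (intro allI impI)
        fix \<epsilon> :: real assume "0 < \<epsilon>"
        then have "eventually (\<lambda>t. dist (q t) w < \<epsilon>) (at 0)" using tendstoD[OF lim] w by simp
        then obtain d where d: "d > 0" "\<And>t. t \<noteq> 0 \<Longrightarrow> dist t 0 < d \<Longrightarrow> dist (q t) w < \<epsilon>"
          unfolding eventually_at by auto
        show "\<exists>\<delta>>0. \<forall>t. t * t < \<delta> \<longrightarrow> x + t *\<^sub>R axis i 1 \<in> V \<and> (t \<noteq> 0 \<longrightarrow> norm (q t - w) \<le> \<epsilon>)"
        proof (intro exI[of _ "min (r * r) (d * d)"] conjI allI impI)
          fix t assume "t * t < min (r * r) (d * d)"
          then have "t * t < r * r" "t * t < d * d" by auto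
          then show "x + t *\<^sub>R axis i 1 \<in> V" by (intro inV)
          assume "t \<noteq> 0"
          have "\<bar>t\<bar> < d" using \<open>t * t < d * d\<close> d by (metis abs_mult_self_eq abs_ge_zero less_imp_le mult_mono not_less)
          then show "norm (q t - w) \<le> \<epsilon>" using d(2)[OF \<open>t \<noteq> 0\<close>] by (simp add: dist_norm less_imp_le)
        qed (use r d in auto)
      qed
    qed
    then show ?thesis using x by simp
  next
    case False
    then show ?thesis by (simp add: Q_def G_def)
  qed
  ultimately show ?thesis unfolding definable_on_def by simp
qed

end

context polynomially_bounded_o_minimal
begin

text \<open>If \<open>f\<close> is not Lipschitz on a ball, for each \<open>s\<close> some pair has
  difference quotient at least \<open>s\<close>, and by polynomial boundedness the pair can be
  chosen with inverse distance at most \<open>s ^ N\<close>. A Hoelder bound with constant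
  \<open>C\<close> then gives \<open>s \<le> C * s powr (N * (1 - \<alpha>))\<close>, which fails
  for large \<open>s\<close> when \<alpha> is close to 1.\<close>

lemma definable_holder_imp_Lipschitz:
  fixes f :: "'a::euclidean_space \<Rightarrow> 'b::euclidean_space"
  assumes V: "open V" and f: "definable_on V f" and cont: "continuous_on V f"
    and holder: "\<And>\<alpha>. 0 < \<alpha> \<Longrightarrow> \<alpha> < 1 \<Longrightarrow> locally_holder_on \<alpha> f V"
  shows "locally_holder_on 1 f V"
proof (rule locally_holder_onI)
  fix p assume p: "p \<in> V"
  obtain r where r: "r > 0" "cball p r \<subseteq> V" using V p open_contains_cball by blast
  have "\<exists>L. \<forall>x\<in>cball p r. \<forall>y\<in>cball p r. norm (f x - f y) \<le> L * norm (x - y)"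
  proof (rule ccontr)
    assume neg: "\<not> ?thesis"
    define G where "G x y \<longleftrightarrow> x \<in> V \<and> y = f x" for x y
    have G: "definable_pred (\<lambda>z. G (g z) (h z))" if "poly_map g" "poly_map h"
      for g :: "'c::euclidean_space \<Rightarrow> 'a" and h :: "'c \<Rightarrow> 'b"
      unfolding G_def by (rule definable_pred_graph[OF f that])
    \<comment> \<open>\<open>u\<close> is the inverse distance of a pair in the ball whose
      difference quotient is at least \<open>\<bar>s\<bar>\<close>.\<close>
    define E where "E s u \<longleftrightarrow> 0 < u \<and> (\<exists>x y a b. G x a \<and> G y b \<and> norm (x - p) \<le> r \<and> norm (y - p) \<le> r \<and>
      (u * u) * ((x - y) \<bullet> (x - y)) = 1 \<and> s * s \<le> ((a - b) \<bullet> (a - b)) * (u * u))" for s u :: real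
    have E_iff: "E s u \<longleftrightarrow> 0 < u \<and> (\<exists>x\<in>cball p r. \<exists>y\<in>cball p r. u * norm (x - y) = 1 \<and> \<bar>s\<bar> \<le> norm (f x - f y) * u)" for s u
    proof -
      have 1: "(u * u) * ((x - y) \<bullet> (x - y)) = 1 \<longleftrightarrow> u * norm (x - y) = 1" if "0 < u" for x y :: 'a
      proof -
        have "(u * u) * ((x - y) \<bullet> (x - y)) = (u * norm (x - y))\<^sup>2" by (simp add: dot_square_norm power2_eq_square mult_ac)
        moreover have "0 \<le> u * norm (x - y)" using that by simp
        ultimately show ?thesis by (metis power2_eq_1_iff not_one_le_zero neg_0_le_iff_le one_power2)
      qed
      have 2: "s * s \<le> ((a - b) \<bullet> (a - b)) * (u * u) \<longleftrightarrow> \<bar>s\<bar> \<le> norm (a - b) * u" if "0 < u" for a b :: 'b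
      proof -
        have "((a - b) \<bullet> (a - b)) * (u * u) = (norm (a - b) * u)\<^sup>2" by (simp add: dot_square_norm power2_eq_square mult_ac)
        then show ?thesis using that abs_le_square_iff[of s "norm (a - b) * u"] by (simp add: power2_eq_square mult_ac)
      qed
      have 3: "norm (x - p) \<le> r \<longleftrightarrow> x \<in> cball p r" for x by (simp add: dist_norm norm_minus_commute)
      have "(\<exists>x y a b. G x a \<and> G y b \<and> norm (x - p) \<le> r \<and> norm (y - p) \<le> r \<and>
          (u * u) * ((x - y) \<bullet> (x - y)) = 1 \<and> s * s \<le> ((a - b) \<bullet> (a - b)) * (u * u)) \<longleftrightarrow>
        (\<exists>x\<in>cball p r. \<exists>y\<in>cball p r. u * norm (x - y) = 1 \<and> \<bar>s\<bar> \<le> norm (f x - f y) * u)" if "0 < u"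
        unfolding 1[OF that] 2[OF that] 3 using r(2) by (auto simp: G_def simp del: mem_cball)
      then show ?thesis unfolding E_def by blast
    qed
    have "definable_pred (\<lambda>z. E (fst z) (snd z))"
      unfolding E_def
      by (rule definable_pred_ex definable_pred_conj G definable_pred_less definable_pred_eq definable_pred_norm_le definable_pred_le poly_map_mult poly_map_inner
          poly_map_diff poly_map_id poly_map_const poly_map_fst poly_map_snd)+
    moreover have "\<exists>u. E s u" for s
    proof -
      obtain x y where x: "x \<in> cball p r" "y \<in> cball p r" "\<bar>s\<bar> * norm (x - y) < norm (f x - f y)"
        using neg by (meson not_le)
      then have "x \<noteq> y" by auto
      then have "E s (1 / norm (x - y))"
        unfolding E_iff using x by (intro conjI bexI[of _ x] bexI[of _ y]) (auto simp: field_simps)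
      then show ?thesis ..
    qed
    moreover have "0 \<le> u" if "E s u" for s u using that by (simp add: E_def)
    ultimately obtain N where N: "eventually (\<lambda>s. \<exists>u. E s u \<and> u \<le> s ^ N) at_top"
      using polynomially_bounded_slices[of E] by auto
    then obtain s0 where s0: "\<And>s. s0 \<le> s \<Longrightarrow> \<exists>u. E s u \<and> u \<le> s ^ N"
      unfolding eventually_at_top_linorder by blast
    define s where "s n = max s0 1 + real n" for n
    have s1: "1 \<le> s n" "s0 \<le> s n" for n by (auto simp: s_def)
    have s_top: "filterlim s at_top sequentially"
      unfolding s_def by (rule filterlim_tendsto_add_at_top[OF tendsto_const filterlim_real_sequentially])
    have "\<exists>u x y. 0 < u \<and> u \<le> s n ^ N \<and> x \<in> cball p r \<and> y \<in> cball p r \<and> u * norm (x - y) = 1 \<and>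
        s n \<le> norm (f x - f y) * u" for n
    proof -
      obtain u where "E (s n) u" "u \<le> s n ^ N" using s0[OF s1(2)] by blast
      then show ?thesis unfolding E_iff using s1(1)[of n] by fastforce
    qed
    then obtain u x y where uxy: "\<And>n. 0 < u n" "\<And>n. u n \<le> s n ^ N" "\<And>n. x n \<in> cball p r" "\<And>n. y n \<in> cball p r"
      "\<And>n. u n * norm (x n - y n) = 1" "\<And>n. s n \<le> norm (f (x n) - f (y n)) * u n"
      by metis
    have key: "s n * norm (x n - y n) \<le> norm (f (x n) - f (y n))" for n
    proof -
      have "s n * norm (x n - y n) \<le> (norm (f (x n) - f (y n)) * u n) * norm (x n - y n)"
        using uxy(6) by (intro mult_right_mono) auto
      also have "\<dots> = norm (f (x n) - f (y n)) * (u n * norm (x n - y n))" by (simp only: mult.assoc)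
      finally show ?thesis by (simp add: uxy(5))
    qed
    have "bounded (f ` cball p r)"
      using compact_continuous_image[OF continuous_on_subset[OF cont r(2)] compact_cball] by (rule compact_imp_bounded)
    then obtain M where M: "\<And>z. z \<in> cball p r \<Longrightarrow> norm (f z) \<le> M" unfolding bounded_iff by blast
    have "norm (x n - y n) \<le> 2 * M / s n" for n
    proof -
      have "norm (f (x n) - f (y n)) \<le> 2 * M"
        using norm_triangle_ineq4[of "f (x n)" "f (y n)"] M[OF uxy(3)[of n]] M[OF uxy(4)[of n]] by linarith
      then show ?thesis using key[of n] s1(1)[of n] by (simp add: field_simps)
    qed
    moreover have "((\<lambda>n. 2 * M / s n) \<longlongrightarrow> 0) sequentially"
      by (rule tendsto_divide_0[OF tendsto_const filterlim_at_top_imp_at_infinity[OF s_top]])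
    ultimately have xy0: "((\<lambda>n. x n - y n) \<longlongrightarrow> 0) sequentially"
      by (intro Lim_null_comparison[of "\<lambda>n. x n - y n" "\<lambda>n. 2 * M / s n"]) auto
    \<comment> \<open>Hoelder constants are local, so the bad pairs have to accumulate at one point.
      The two points of a pair come together because \<open>f\<close> is bounded on the ball while
      the quotients tend to infinity.\<close>
    obtain z \<sigma> where z: "z \<in> cball p r" "strict_mono (\<sigma> :: nat \<Rightarrow> nat)" "(x \<circ> \<sigma>) \<longlonglongrightarrow> z"
      using compact_cball[of p r] uxy(3) unfolding compact_def by metis
    have "(\<lambda>n. x (\<sigma> n) - (x (\<sigma> n) - y (\<sigma> n))) \<longlonglongrightarrow> z - 0"
      using z(3) LIMSEQ_subseq_LIMSEQ[OF xy0 z(2)] by (intro tendsto_diff) (auto simp: o_def)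
    then have ylim: "(\<lambda>n. y (\<sigma> n)) \<longlonglongrightarrow> z" by simp
    \<comment> \<open>Chosen after \<open>N\<close>, so that
      \<open>N * (1 - \<alpha>) \<le> 1/2\<close> and \<open>s\<close> is at most a constant times
      its square root.\<close>
    define \<alpha> where "\<alpha> = 1 - 1 / (2 * real N + 2)"
    have \<alpha>: "0 < \<alpha>" "\<alpha> < 1" by (auto simp: \<alpha>_def field_simps)
    obtain U C where U: "open U" "z \<in> U" "0 \<le> C"
      "\<And>x y. x \<in> U \<Longrightarrow> x \<in> V \<Longrightarrow> y \<in> U \<Longrightarrow> y \<in> V \<Longrightarrow> dist (f x) (f y) \<le> C * dist x y powr \<alpha>"
      using locally_holder_onE[OF holder[OF \<alpha>], of z] z(1) r(2) by (metis subsetD)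
    have "filterlim (s \<circ> \<sigma>) at_top sequentially"
      unfolding o_def by (rule filterlim_compose[OF s_top filterlim_subseq[OF z(2)]])
    then have "eventually (\<lambda>n. C * C < s (\<sigma> n)) sequentially"
      unfolding o_def filterlim_at_top_dense by blast
    moreover have "eventually (\<lambda>n. x (\<sigma> n) \<in> U) sequentially"
      using topological_tendstoD[OF z(3) U(1,2)] by (simp add: o_def)
    moreover have "eventually (\<lambda>n. y (\<sigma> n) \<in> U) sequentially"
      using topological_tendstoD[OF ylim U(1,2)] .
    ultimately have "eventually (\<lambda>n. C * C < s (\<sigma> n) \<and> x (\<sigma> n) \<in> U \<and> y (\<sigma> n) \<in> U) sequentially"
      by (intro eventually_conj)
    from eventually_happens[OF this] obtain n where n: "C * C < s (\<sigma> n)" "x (\<sigma> n) \<in> U" "y (\<sigma> n) \<in> U" by auto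
    define m where "m = \<sigma> n"
    have d: "norm (x m - y m) > 0" using uxy(5)[of m] by (cases "norm (x m - y m) = 0") auto
    have u: "u m = 1 / norm (x m - y m)" using uxy(5)[of m] d by (simp add: field_simps)
    have "s m * norm (x m - y m) \<le> C * norm (x m - y m) powr \<alpha>"
      using key[of m] U(4)[of "x m" "y m"] n uxy(3,4) r(2) by (auto simp: m_def dist_norm subset_eq)
    then have "s m \<le> C * (norm (x m - y m) powr \<alpha> / norm (x m - y m))" using d by (simp add: field_simps)
    also have "norm (x m - y m) powr \<alpha> / norm (x m - y m) = u m powr (1 - \<alpha>)"
      using d by (simp add: u powr_diff powr_divide)
    also have "C * u m powr (1 - \<alpha>) \<le> C * (s m ^ N) powr (1 - \<alpha>)"
      using U(3) uxy(1)[of m] uxy(2)[of m] \<alpha> by (intro mult_left_mono powr_mono2) auto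
    also have "(s m ^ N) powr (1 - \<alpha>) = s m powr (real N * (1 - \<alpha>))"
      using s1(1)[of m] by (simp add: powr_realpow[symmetric] powr_powr)
    also have "C * s m powr (real N * (1 - \<alpha>)) \<le> C * s m powr (1/2)"
      using U(3) s1(1)[of m] by (intro mult_left_mono powr_mono) (auto simp: \<alpha>_def field_simps)
    also have "s m powr (1/2) = sqrt (s m)" using s1(1)[of m] by (simp add: powr_half_sqrt)
    finally have "s m \<le> C * sqrt (s m)" .
    moreover have "s m = sqrt (s m) * sqrt (s m)" using s1(1)[of m] by simp
    moreover have "0 < sqrt (s m)" using s1(1)[of m] by simp
    ultimately have "sqrt (s m) \<le> C" by (metis mult_le_cancel_right_pos)
    then have "s m \<le> C * C" using mult_mono[of "sqrt (s m)" C "sqrt (s m)" C] s1(1)[of m] U(3) by simp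
    then show False using n(1) by (simp add: m_def)
  qed
  then obtain L where L: "\<And>x y. x \<in> cball p r \<Longrightarrow> y \<in> cball p r \<Longrightarrow> norm (f x - f y) \<le> L * norm (x - y)" by blast
  then show "\<exists>U C. open U \<and> p \<in> U \<and>
    (\<forall>x y. x \<in> U \<longrightarrow> x \<in> V \<longrightarrow> y \<in> U \<longrightarrow> y \<in> V \<longrightarrow> dist (f x) (f y) \<le> C * dist x y powr 1)"
    using r(1) by (intro exI[of _ "ball p r"] exI[of _ L]) (auto simp: dist_norm)
qed

text \<open>Only the derivatives of order \<open>k\<close> have to be improved; they are reached by
  induction, since partial derivatives inherit definability and all the Hoelder classes.\<close>

lemma definable_CH_Lipschitz:
  fixes f :: "real^'n \<Rightarrow> real^'m"
  assumes V: "open V"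
  shows "definable_on V f \<Longrightarrow> (\<And>\<alpha>. 0 < \<alpha> \<Longrightarrow> \<alpha> < 1 \<Longrightarrow> holder_smooth UNIV k \<alpha> f V) \<Longrightarrow> holder_smooth UNIV k 1 f V"
proof (induction k arbitrary: f)
  case 0
  have "continuous_on V f" using 0(2)[of "1/2"] by simp
  then show ?case using definable_holder_imp_Lipschitz[OF V 0(1)] 0(2) by simp
next
  case (Suc k)
  have half: "holder_smooth UNIV (Suc k) (1/2) f V" by (rule Suc.prems) auto
  have "holder_smooth UNIV k 1 (partial_deriv i f) V" for i
  proof (rule Suc.IH)
    show "definable_on V (partial_deriv i f)"
      by (rule definable_on_derivative[OF V Suc.prems(1) holder_smooth_SucD[OF half]]) auto
    show "holder_smooth UNIV k \<alpha> (partial_deriv i f) V" if "0 < \<alpha>" "\<alpha> < 1" for \<alpha>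
      using Suc.prems(2)[OF that] by simp
  qed
  then show ?case using half by simp
qed

end

subsection \<open>Regularity of the parametrization\<close>

text \<open>\<gamma> takes values in \<open>X\<close>, so \<open>A\<close> may be replaced along
  \<gamma> by its smooth ambient extensions \<open>A'\<close>. If \<gamma> is of order
  \<open>j \<le> k\<close>, so is its derivative \<open>P h + A' (\<gamma> x) *v h\<close>, and
  \<gamma> gains one order. This stops one order beyond that of \<open>A'\<close>.\<close>

lemma holder_smooth_bootstrap:
  fixes \<gamma> :: "real^'n \<Rightarrow> real^'n"
  assumes B: "open B" and \<alpha>: "0 < \<alpha>" "\<alpha> \<le> 1" and X: "\<gamma> ` B \<subseteq> X" and P: "bounded_linear P"
    and der: "\<And>x. x \<in> B \<Longrightarrow> (\<gamma> has_derivative (\<lambda>h. P h + A (\<gamma> x) *v h)) (at x)"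
    and ext: "\<And>x. x \<in> B \<Longrightarrow> \<exists>V A'. open V \<and> \<gamma> x \<in> V \<and> holder_smooth UNIV k \<alpha> A' V \<and> (\<forall>z\<in>X \<inter> V. A' z = A z)"
  shows "holder_smooth UNIV (Suc k) \<alpha> \<gamma> B"
proof -
  have cont: "continuous_on B \<gamma>"
    using der has_derivative_continuous by (metis continuous_at_imp_continuous_on)
  define D where "D i x = P (axis i 1) + A (\<gamma> x) *v axis i 1" for i x
  \<comment> \<open>The composition rule for \<open>A'\<close> and \<gamma> at order
    \<open>j\<close> is a hypothesis here; the induction below supplies it from the regularity of
    \<gamma> already obtained.\<close>
  have holder_smooth_D: "holder_smooth UNIV j \<alpha> (D i) B"
    if j: "j \<le> k" and \<gamma>: "\<And>U. U \<subseteq> B \<Longrightarrow> open U \<Longrightarrow> 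
        (\<And>V (A' :: real^'n \<Rightarrow> real^'n^'n). open V \<Longrightarrow> \<gamma> ` U \<subseteq> V \<Longrightarrow> holder_smooth UNIV k \<alpha> A' V \<Longrightarrow> holder_smooth UNIV j \<alpha> (\<lambda>x. A' (\<gamma> x)) U)"
    for i j
  proof (rule holder_smooth_local[OF B])
    fix x assume x: "x \<in> B"
    obtain V A' where V: "open V" "\<gamma> x \<in> V" "holder_smooth UNIV k \<alpha> A' V" "\<forall>z\<in>X \<inter> V. A' z = A z"
      using ext[OF x] by blast
    define U where "U = B \<inter> \<gamma> -` V"
    have U: "open U" "x \<in> U" "U \<subseteq> B" "\<gamma> ` U \<subseteq> V"
      using continuous_on_open_vimage[OF B] cont V x by (auto simp: U_def Int_commute)
    have "holder_smooth UNIV j \<alpha> (\<lambda>x. A' (\<gamma> x)) U" by (rule \<gamma>[OF U(3,1) V(1) U(4) V(3)])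
    then have "holder_smooth UNIV j \<alpha> (\<lambda>x. P (axis i 1) + A' (\<gamma> x) *v axis i 1) U"
      by (intro holder_smooth_add[OF U(1)] holder_smooth_const holder_smooth_linear[OF bounded_bilinear.bounded_linear_left[OF bounded_bilinear_matrix_vector_mult] U(1)])
    moreover have "P (axis i 1) + A' (\<gamma> y) *v axis i 1 = D i y" if "y \<in> U" for y
    proof -
      have "\<gamma> y \<in> X \<inter> V" using that U X by blast
      then show ?thesis using V(4) by (simp add: D_def)
    qed
    ultimately have "holder_smooth UNIV j \<alpha> (D i) U" by (rule holder_smooth_cong_open[OF U(1), rotated])
    then show "\<exists>U. open U \<and> x \<in> U \<and> U \<subseteq> B \<and> holder_smooth UNIV j \<alpha> (D i) U" using U by blast
  qed
  have pd: "((\<lambda>t. \<gamma> (x + t *\<^sub>R axis i 1)) has_vector_derivative D i x) (at 0)" if "x \<in> B" for i x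
  proof -
    have "((\<lambda>t. x + t *\<^sub>R axis i 1) has_vector_derivative axis i 1) (at 0)"
      by (auto intro!: derivative_eq_intros)
    from vector_derivative_diff_chain_within[OF this, of \<gamma> "\<lambda>h. P h + A (\<gamma> x) *v h"]
    show ?thesis using der[OF that] by (simp add: o_def D_def has_derivative_at_withinI)
  qed
  have contD: "continuous_on B (D i)" for i
  proof (rule continuous_at_imp_continuous_on, rule ballI)
    fix x assume x: "x \<in> B"
    obtain V A' where V: "open V" "\<gamma> x \<in> V" "holder_smooth UNIV k \<alpha> A' V" "\<forall>z\<in>X \<inter> V. A' z = A z"
      using ext[OF x] by blast
    define U where "U = B \<inter> \<gamma> -` V"
    have U: "open U" "x \<in> U" "U \<subseteq> B" "\<gamma> ` U \<subseteq> V"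
      using continuous_on_open_vimage[OF B] cont V x by (auto simp: U_def Int_commute)
    have "continuous_on U (\<lambda>x. A' (\<gamma> x))"
      by (rule continuous_on_compose2[OF holder_smooth_continuous[OF V(3)] continuous_on_subset[OF cont U(3)] U(4)])
    then have "continuous_on U (\<lambda>x. P (axis i 1) + A' (\<gamma> x) *v axis i 1)"
      by (intro continuous_on_add continuous_on_const
          bounded_linear.continuous_on[OF bounded_bilinear.bounded_linear_left[OF bounded_bilinear_matrix_vector_mult]])
    moreover have "P (axis i 1) + A' (\<gamma> y) *v axis i 1 = D i y" if "y \<in> U" for y
    proof -
      have "\<gamma> y \<in> X \<inter> V" using that U X by blast
      then show ?thesis using V(4) by (simp add: D_def)
    qed
    ultimately have "continuous_on U (D i)" using continuous_on_cong[of U U] by simp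
    then show "isCont (D i) x" using U by (simp add: continuous_on_eq_continuous_at)
  qed
  have lip: "locally_holder_on 1 \<gamma> B"
    by (rule locally_Lipschitz_partial_derivs[OF B pd contD])
  have "holder_smooth UNIV j \<alpha> \<gamma> B" if "j \<le> Suc k" for j
    using that
  proof (induction j)
    case 0
    show ?case using cont locally_holder_on_mono[OF lip \<alpha>(2)] by simp
  next
    case (Suc j)
    show ?case
    proof (rule holder_smooth_SucI[where D = D])
      fix i
      have "j \<le> k" using Suc.prems by simp
      then show "holder_smooth UNIV j \<alpha> (D i) B"
      proof (rule holder_smooth_D)
        fix U V and A' :: "real^'n \<Rightarrow> real^'n^'n"
        assume *: "U \<subseteq> B" "open U" "open V" "\<gamma> ` U \<subseteq> V" "holder_smooth UNIV k \<alpha> A' V"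
        have A': "holder_smooth UNIV j \<alpha> A' V" by (rule holder_smooth_mono_order[OF *(3) \<alpha>(2) *(5) \<open>j \<le> k\<close>])
        have "holder_smooth UNIV j \<alpha> \<gamma> B" using Suc.IH Suc.prems by simp
        then have "holder_smooth UNIV j \<alpha> \<gamma> U" using *(1) by (rule holder_smooth_subset)
        with A' show "holder_smooth UNIV j \<alpha> (\<lambda>x. A' (\<gamma> x)) U"
          by (rule holder_smooth_compose[OF *(3,2) less_imp_le[OF \<alpha>(1)] \<alpha>(2) *(4) locally_holder_on_subset[OF lip *(1)]])
      qed
    qed (use B cont pd in auto)
  qed
  then show ?thesis by blast
qed

subsection \<open>Coordinates adapted to a plane\<close>

text \<open>Graphs are defined over coordinate subspaces. \<open>T0\<close> and its complement are
  carried to complementary coordinate subspaces by two isometries, glued along the orthogonal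
  projections.\<close>

lemma adapted_coordinates:
  fixes T0 :: "(real^'n) set"
  assumes T0: "subspace T0"
  obtains I and L L' :: "real^'n \<Rightarrow> real^'n" where "card I = dim T0" "linear L" "linear L'"
    "\<And>x. L' (L x) = x" "\<And>y. L (L' y) = y"
    "\<And>x. x \<in> T0 \<Longrightarrow> L x \<in> coord_space I" "\<And>x. x \<in> orthogonal_comp T0 \<Longrightarrow> L x \<in> coord_space (- I)"
    "\<And>y. y \<in> coord_space I \<Longrightarrow> L' y \<in> T0"
proof -
  have "dim T0 \<le> card (UNIV :: 'n set)" using dim_subset_UNIV[of T0] by simp
  then obtain I :: "'n set" where I: "card I = dim T0" by (metis obtain_subset_with_card_n)
  have "dim (orthogonal_comp T0) + dim T0 = dim (UNIV :: (real^'n) set)"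
    using dim_subspace_orthogonal_to_vectors[OF T0 subspace_UNIV] by (simp add: orthogonal_comp_def)
  then have dimc: "dim (orthogonal_comp T0) = dim (coord_space (- I) :: (real^'n) set)"
    using I by (simp add: dim_coord_space Compl_eq_Diff_UNIV card_Diff_subset)
  obtain f g where f: "linear f" "linear g" "f ` T0 = coord_space I" "g ` coord_space I = T0"
    "\<And>x. x \<in> T0 \<Longrightarrow> g (f x) = x" "\<And>y. y \<in> coord_space I \<Longrightarrow> f (g y) = y"
    by (rule isometries_subspaces[OF T0 subspace_coord_space, of I]) (auto simp: I dim_coord_space)
  obtain f' g' where f': "linear f'" "linear g'" "f' ` orthogonal_comp T0 = coord_space (- I)"
    "g' ` coord_space (- I) = orthogonal_comp T0"
    "\<And>x. x \<in> orthogonal_comp T0 \<Longrightarrow> g' (f' x) = x" "\<And>y. y \<in> coord_space (- I) \<Longrightarrow> f' (g' y) = y"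
    by (rule isometries_subspaces[OF subspace_orthogonal_comp subspace_coord_space, of T0 "- I"]) (auto simp: dimc)
  define P where "P = (*v) (proj_matrix T0)"
  have P: "linear P" "P x \<in> T0" "x - P x \<in> orthogonal_comp T0"
    "x \<in> T0 \<Longrightarrow> P x = x" "x \<in> orthogonal_comp T0 \<Longrightarrow> P x = 0" for x
    unfolding P_def by (auto simp: proj_matrix_in[OF T0] proj_matrix_compl[OF T0] proj_matrix_id[OF T0] proj_matrix_orthogonal[OF T0])
  have Q: "y - coord_proj I y \<in> coord_space (- I)" for y
    by (auto simp: coord_proj_def coord_space_def)
  define L where "L x = f (P x) + f' (x - P x)" for x
  define L' where "L' y = g (coord_proj I y) + g' (y - coord_proj I y)" for y
  have fin: "f x \<in> coord_space I" if "x \<in> T0" for x using f(3) that by blast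
  have f'in: "f' x \<in> coord_space (- I)" if "x \<in> orthogonal_comp T0" for x using f'(3) that by blast
  have gin: "g x \<in> T0" if "x \<in> coord_space I" for x using f(4) that by blast
  have g'in: "g' x \<in> orthogonal_comp T0" if "x \<in> coord_space (- I)" for x using f'(4) that by blast
  have "coord_proj I (L x) = f (P x)" for x
    unfolding L_def using linear_add[OF linear_coord_proj, of I "f (P x)"] fin[OF P(2)] f'in[OF P(3)] by simp
  then have 1: "L' (L x) = x" for x
    using f(5)[OF P(2), of x] f'(5)[OF P(3), of x] by (simp add: L'_def) (simp add: L_def)
  have "P (L' y) = g (coord_proj I y)" for y
    unfolding L'_def using linear_add[OF P(1), of "g (coord_proj I y)"] P(4)[OF gin] P(5)[OF g'in[OF Q]] by simp
  then have 2: "L (L' y) = y" for y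
    using f(6)[of "coord_proj I y"] f'(6)[OF Q, of y] by (simp add: L_def) (simp add: L'_def)
  show ?thesis
  proof (rule that[OF I _ _ 1 2])
    show "linear L" unfolding L_def
      using linear_compose[OF P(1) f(1)] linear_compose[OF linear_compose_sub[OF linear_id P(1)] f'(1)]
      by (intro linear_compose_add) (auto simp: o_def)
    show "linear L'" unfolding L'_def
      using linear_compose[OF linear_coord_proj f(2)] linear_compose[OF linear_compose_sub[OF linear_id linear_coord_proj] f'(2)]
      by (intro linear_compose_add) (auto simp: o_def)
    show "L x \<in> coord_space I" if "x \<in> T0" for x
      using P(4)[OF that] fin[OF that] linear_0[OF f'(1)] by (simp add: L_def)
    show "L x \<in> coord_space (- I)" if "x \<in> orthogonal_comp T0" for x
      using P(5)[OF that] f'in[OF that] linear_0[OF f(1)] by (simp add: L_def)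
    show "L' y \<in> T0" if "y \<in> coord_space I" for y
      using gin[OF that] linear_0[OF f'(2)] that by (simp add: L'_def)
  qed
qed

text \<open>The Gauss mapping extended to all of \<open>X\<close>, with the plane in the fibre of
  the Nash mapping as its value.\<close>

definition gauss :: "nat \<Rightarrow> (real^'n) set \<Rightarrow> real^'n \<Rightarrow> (real^'n) set" where
  "gauss d X x = snd (nash_inverse d X x)"

text \<open>Surjectivity of the Nash mapping provides a plane over each point, and injectivity
  leaves no other.\<close>

lemma
  assumes "homeomorphic_map (nash_topology d X) (top_of_set X) nash_map" and "x \<in> X"
  shows nash_inverse_eq: "nash_inverse d X x = (x, gauss d X x)"
    and gauss_in_Gr: "gauss d X x \<in> Gr d"
    and nash_fibre: "(x, T) \<in> nash_transformation d X \<longleftrightarrow> T = gauss d X x"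
proof -
  have top: "topspace (nash_topology d X) = nash_transformation d X"
    unfolding nash_topology_def topspace_subtopology nash_transformation_def
    by (rule Int_absorb1[OF closure_of_subset_topspace])
  have inj: "inj_on fst (nash_transformation d X)" and im: "fst ` nash_transformation d X = X"
    using assms(1) unfolding homeomorphic_eq_everything_map top nash_map_def by simp_all
  have in_N: "nash_inverse d X x \<in> nash_transformation d X" and fst: "fst (nash_inverse d X x) = x"
    unfolding nash_inverse_def nash_map_def using im assms(2) by (auto intro: inv_into_into f_inv_into_f)
  show eq: "nash_inverse d X x = (x, gauss d X x)" unfolding gauss_def using fst by (metis prod.collapse)
  show "gauss d X x \<in> Gr d" using in_N unfolding eq in_nash_transformation_iff by blast
  show "(x, T) \<in> nash_transformation d X \<longleftrightarrow> T = gauss d X x"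
  proof
    assume "(x, T) \<in> nash_transformation d X"
    then have "(x, T) = (x, gauss d X x)" using inj in_N unfolding eq by (metis fst_conv inj_onD)
    then show "T = gauss d X x" by simp
  qed (use in_N eq in simp)
qed

section \<open>Construction of the local graph from the Nash mapping\<close>

context polynomially_bounded_o_minimal
begin

lemma nash_imp_submanifold:
  fixes X :: "(real^'n) set"
  assumes lc: "locally_closed_set X" and ld: "locally_definable S X"
    and C34: "C3_C4_coincide_linearly d X"
    and hom: "homeomorphic_map (nash_topology d X) (top_of_set X) nash_map"
    and smooth: "\<And>\<alpha>. 0 < \<alpha> \<Longrightarrow> \<alpha> < 1 \<Longrightarrow> Ck_holder_into_Gr_on_subset d k \<alpha> (nash_inverse d X) X"
  shows "Ck_holder_submanifold (k + 1) 1 d X"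
  unfolding Ck_holder_submanifold_def
proof
  fix p assume p: "p \<in> X"
  let ?T = "gauss d X"
  have Gr: "subspace (?T x)" "dim (?T x) = d" if "x \<in> X" for x
    using gauss_in_Gr[OF hom that] by (auto simp: Gr_def)
  \<comment> \<open>The fibre is a single plane, so \<open>C4_cone\<close> is that plane and linear
    coincidence applies at every point of \<open>X\<close>.\<close>
  have cone: "C3_cone X x = ?T x" if x: "x \<in> X" for x
  proof -
    have "C4_cone d X x = ?T x" using C4_cone_eq_Union_nash[OF x] nash_fibre[OF hom x] by simp
    then show ?thesis using C34 x gauss_in_Gr[OF hom x] by (simp add: C3_C4_coincide_linearly_def)
  qed
  define T0 where "T0 = ?T p"
  have T0: "subspace T0" "dim T0 = d" using Gr[OF p] by (auto simp: T0_def)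
  note dim_T0 = T0(2)
  define A where "A x = Gr_chart T0 (?T x)" for x
  have local_chart: "\<exists>V A'. open V \<and> q \<in> V \<and> holder_smooth UNIV k \<alpha> A' V \<and>
      (\<forall>x\<in>X \<inter> V. A' x = A x \<and> chart_matrix T0 (A x) \<and> ?T x = graph_over T0 (A x))"
    if \<alpha>: "0 < \<alpha>" "\<alpha> < 1" and q: "q \<in> X" and tr: "?T q \<inter> orthogonal_comp T0 = {0}" for \<alpha> q
  proof -
    obtain U F where U: "open U" "q \<in> U" "Ck_holder_into_Gr d k \<alpha> F U" "\<forall>x\<in>X \<inter> U. F x = nash_inverse d X x"
      using smooth[OF \<alpha>] q unfolding Ck_holder_into_Gr_on_subset_def by blast
    obtain V T1 where V: "open V" "q \<in> V" "V \<subseteq> U" "T1 \<in> Gr d" "\<forall>x\<in>V. snd (F x) \<in> Gr_chart_domain T1"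
      "Ck_holder_on UNIV k \<alpha> (\<lambda>x. (fst (F x), Gr_chart T1 (snd (F x)))) V"
      using U(2,3) unfolding Ck_holder_into_Gr_def by blast
    have T1: "subspace T1" "dim T1 = d" using V(4) by (auto simp: Gr_def)
    define A1 where "A1 x = Gr_chart T1 (snd (F x))" for x
    have "holder_smooth UNIV k \<alpha> (\<lambda>x. snd (fst (F x), Gr_chart T1 (snd (F x)))) V"
      using V(1,6) by (intro holder_smooth_linear[OF bounded_linear_snd V(1)]) (simp add: Ck_holder_on_iff_holder_smooth)
    then have holder_smooth_A1: "holder_smooth UNIV k \<alpha> A1 V" by (simp add: A1_def[abs_def])
    have snd_F: "snd (F x) = ?T x" if "x \<in> X" "x \<in> V" for x
      using U(4) V(3) that nash_inverse_eq[OF hom that(1)] by auto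
    have A1: "chart_matrix T1 (A1 x)" "?T x = graph_over T1 (A1 x)" if "x \<in> X" "x \<in> V" for x
      using Gr_chart_domain_graph[OF T1(1)] V(5) that snd_F[OF that] unfolding A1_def by metis+
    \<comment> \<open>A family of matrices whose images of \<open>T1\<close> are the planes at the
      points of \<open>X\<close> in \<open>V\<close>; it is smooth on all of \<open>V\<close> and so
      yields the extension of \<open>A\<close>.\<close>
    define M where "M x = mat 1 + A1 x" for x
    have Mv: "M x *v v = v + A1 x *v v" for x v by (simp add: M_def matrix_vector_mult_add_rdistrib)
    have M_image: "(\<lambda>v. M x *v v) ` T1 = ?T x" if "x \<in> X" "x \<in> V" for x
      unfolding A1(2)[OF that] by (auto simp: Mv graph_over_def)
    have holder_smooth_M: "holder_smooth UNIV k \<alpha> M V" unfolding M_def by (intro holder_smooth_add[OF V(1)] holder_smooth_const holder_smooth_A1)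
    have tr': "v = 0" if v: "v \<in> T1" "M q *v v \<in> orthogonal_comp T0" for v
    proof -
      have "M q *v v \<in> ?T q" using M_image[OF q V(2)] v(1) by blast
      then have "M q *v v = 0" using tr v(2) by blast
      then show ?thesis
        using proj_graph_over[OF T1(1) A1(1)[OF q V(2)] v(1)] by (simp add: Mv)
    qed
    obtain V' where V': "open V'" "q \<in> V'" "V' \<subseteq> V"
      "\<And>x. x \<in> V' \<Longrightarrow> \<exists>A. chart_matrix T0 A \<and> (\<lambda>v. M x *v v) ` T1 = graph_over T0 A"
      "holder_smooth UNIV k \<alpha> (\<lambda>x. Gr_chart T0 ((\<lambda>v. M x *v v) ` T1)) V'"
      by (rule holder_smooth_Gr_chart_image[OF V(1,2) holder_smooth_M less_imp_le[OF \<alpha>(2)] T0(1) T1(1)]) (use T0(2) T1(2) tr' in auto)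
    have "Gr_chart T0 ((\<lambda>v. M x *v v) ` T1) = A x \<and> chart_matrix T0 (A x) \<and> ?T x = graph_over T0 (A x)"
      if "x \<in> X" "x \<in> V'" for x
    proof -
      have im: "(\<lambda>v. M x *v v) ` T1 = ?T x" using M_image that V'(3) by blast
      from V'(4)[OF that(2)] im obtain B where B: "chart_matrix T0 B" "?T x = graph_over T0 B" by auto
      then have "A x = B" unfolding A_def using Gr_chart_graph_over[OF T0(1) B(1)] by simp
      then show ?thesis using B im by (simp add: A_def)
    qed
    then show ?thesis using V'(1,2,5) by (intro exI[of _ V'] exI[of _ "\<lambda>x. Gr_chart T0 ((\<lambda>v. M x *v v) ` T1)"]) auto
  qed
  have tr_p: "?T p \<inter> orthogonal_comp T0 = {0}"
    using orthogonal_comp_Int subspace_0[OF T0(1)] subspace_0[OF subspace_orthogonal_comp] by (auto simp: T0_def)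
  obtain V0 where V0: "open V0" "p \<in> V0" "\<And>x. x \<in> X \<Longrightarrow> x \<in> V0 \<Longrightarrow> chart_matrix T0 (A x)"
    "\<And>x. x \<in> X \<Longrightarrow> x \<in> V0 \<Longrightarrow> ?T x = graph_over T0 (A x)"
    using local_chart[of "1/2", OF _ _ p tr_p] by auto
  obtain C O' where CO: "closed C" "open O'" "X = C \<inter> O'" using lc by (auto simp: locally_closed_set_def)
  obtain U0 where U0: "p \<in> interior U0" "definable S (X \<inter> U0)"
    using ld p closure_subset unfolding locally_definable_def by blast
  \<comment> \<open>On a ball inside this set \<open>X\<close> is relatively closed, definable, and
    has all its planes in the chart over \<open>T0\<close>.\<close>
  have "open (V0 \<inter> O' \<inter> interior U0)" "p \<in> V0 \<inter> O' \<inter> interior U0" using V0 CO U0 p by auto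
  then obtain r0 where r0: "r0 > 0" "cball p r0 \<subseteq> V0 \<inter> O' \<inter> interior U0"
    using open_contains_cball by metis
  have ball: "x \<in> cball p r0" if "norm (x - p) \<le> r0" for x using that by (simp add: dist_norm norm_minus_commute)
  have V0': "x \<in> V0" if "norm (x - p) \<le> r0" for x using ball[OF that] r0(2) by blast
  interpret definable_flat_cones X T0 A p r0 S
  proof
    show "compact (X \<inter> cball p r0)"
    proof -
      have "X \<inter> cball p r0 = C \<inter> cball p r0" using r0(2) CO(3) by blast
      then show ?thesis using CO(1) by (simp add: closed_Int_compact)
    qed
    show "C3_cone X x = graph_over T0 (A x)" if "x \<in> X" "norm (x - p) \<le> r0" for x
      using cone[OF that(1)] V0(4)[OF that(1) V0'[OF that(2)]] by simp
    show "\<exists>s>0. \<exists>H\<ge>0. \<forall>x\<in>X. \<forall>y\<in>X. \<forall>v. norm (x - p) < s \<longrightarrow> norm (y - p) < s \<longrightarrow>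
        norm (A x *v v - A y *v v) \<le> H * norm (x - y) powr \<alpha> * norm v" if \<alpha>: "0 < \<alpha>" "\<alpha> < 1" for \<alpha>
    proof -
      obtain V A' where V: "open V" "p \<in> V" "holder_smooth UNIV k \<alpha> A' V" "\<And>x. x \<in> X \<Longrightarrow> x \<in> V \<Longrightarrow> A' x = A x"
        using local_chart[OF \<alpha> p tr_p] by blast
      obtain W H where W: "open W" "p \<in> W" "0 \<le> H"
        "\<And>x y. x \<in> W \<Longrightarrow> x \<in> V \<Longrightarrow> y \<in> W \<Longrightarrow> y \<in> V \<Longrightarrow> dist (A' x) (A' y) \<le> H * dist x y powr \<alpha>"
        using locally_holder_onE[OF holder_smooth_locally_holder[OF V(1,3) less_imp_le[OF \<alpha>(2)]] V(2)] by metis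
      have "open (V \<inter> W)" "p \<in> V \<inter> W" using V W by auto
      then obtain s where s: "s > 0" "ball p s \<subseteq> V \<inter> W" by (rule openE)
      obtain K where K: "K > 0" "\<And>(B :: real^'n^'n) v. norm (B *v v) \<le> K * norm B * norm v"
        using matrix_vector_mult_bound by blast
      have "norm (A x *v v - A y *v v) \<le> (K * H) * norm (x - y) powr \<alpha> * norm v"
        if "x \<in> X" "y \<in> X" "norm (x - p) < s" "norm (y - p) < s" for x y v
      proof -
        have xy: "x \<in> V \<inter> W" "y \<in> V \<inter> W" using that s(2) by (auto simp: dist_norm norm_minus_commute subset_eq)
        have "norm (A x *v v - A y *v v) = norm ((A x - A y) *v v)" by (simp add: matrix_vector_mult_diff_rdistrib)
        also have "\<dots> \<le> K * norm (A x - A y) * norm v" by (rule K)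
        also have "norm (A x - A y) \<le> H * norm (x - y) powr \<alpha>"
          using W(4)[of x y] xy V(4) that by (simp add: dist_norm)
        finally show ?thesis using K(1) by (simp add: mult_left_mono mult_right_mono mult.assoc)
      qed
      then show ?thesis using s(1) K(1) W(3) by (intro exI[of _ s] conjI exI[of _ "K * H"]) auto
    qed
    show "definable_pred (\<lambda>x. x \<in> X \<and> norm (x - p) \<le> r)" if "0 < r" "r \<le> r0" for r
    proof -
      have "definable_pred (\<lambda>x. x \<in> X \<inter> U0 \<and> norm (x - p) \<le> r)"
        by (intro definable_pred_conj definable_imp_definable_pred U0 definable_pred_norm_le poly_map_diff poly_map_id poly_map_const)
      moreover have "x \<in> U0" if "norm (x - p) \<le> r" for x
        using ball[of x] that \<open>r \<le> r0\<close> r0(2) interior_subset[of U0] by auto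
      then have "(\<lambda>x. x \<in> X \<inter> U0 \<and> norm (x - p) \<le> r) = (\<lambda>x. x \<in> X \<and> norm (x - p) \<le> r)" by auto
      ultimately show ?thesis by simp
    qed
  qed (use T0 p r0 V0 V0' in auto)
  obtain r1 \<rho> \<gamma> where r1: "0 < r1" "r1 < r0" "0 < \<rho>"
    and \<gamma>: "\<And>x. norm (P x - P p) < \<rho> \<Longrightarrow> \<gamma> x \<in> X \<and> norm (\<gamma> x - p) < r1 \<and> P (\<gamma> x) = P x"
    and uniq: "\<And>x z. norm (P x - P p) < \<rho> \<Longrightarrow> z \<in> X \<Longrightarrow> norm (z - p) \<le> r1 \<Longrightarrow> P z = P x \<Longrightarrow> z = \<gamma> x"
    and der: "\<And>x. norm (P x - P p) < \<rho> \<Longrightarrow> (\<gamma> has_derivative (\<lambda>h. P h + A (\<gamma> x) *v h)) (at x)"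
    using local_graph by blast
  define B where "B = {x. norm (P x - P p) < \<rho>}"
  have contP: "continuous_on UNIV P" by (rule linear_continuous_on_compose[OF continuous_on_id linear_P])
  have B: "open B" unfolding B_def by (intro open_Collect_less continuous_intros contP)
  have "holder_smooth UNIV (Suc k) \<alpha> \<gamma> B" if \<alpha>: "0 < \<alpha>" "\<alpha> < 1" for \<alpha>
  proof (rule holder_smooth_bootstrap[OF B \<alpha>(1) less_imp_le[OF \<alpha>(2)], where X = X and P = P and A = A])
    show "\<exists>V A'. open V \<and> \<gamma> x \<in> V \<and> holder_smooth UNIV k \<alpha> A' V \<and> (\<forall>z\<in>X \<inter> V. A' z = A z)" if "x \<in> B" for x
    proof -
      have "\<gamma> x \<in> X" "norm (\<gamma> x - p) \<le> r0" using \<gamma>[of x] that r1 by (auto simp: B_def)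
      then have "chart_matrix T0 (A (\<gamma> x))" "?T (\<gamma> x) = graph_over T0 (A (\<gamma> x))" using V0 V0' by auto
      then have "?T (\<gamma> x) \<inter> orthogonal_comp T0 = {0}" using graph_over_transverse[OF T0(1)] by simp
      then show ?thesis using local_chart[OF \<alpha> \<open>\<gamma> x \<in> X\<close>] by blast
    qed
  qed (use \<gamma> der linear_P in \<open>auto simp: B_def linear_conv_bounded_linear\<close>)
  \<comment> \<open>Uniqueness in the closed ball of radius \<open>r1\<close> describes the graph of
    \<gamma> by a formula, although \<gamma> itself arises from a choice.\<close>
  moreover have "definable_on B \<gamma>"
  proof -
    have P': "poly_map (\<lambda>z. P (f z))" if "poly_map f" for f :: "'b::euclidean_space \<Rightarrow> real^'n"
      by (rule poly_map_linear_comp[OF that linear_P])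
    have ball1: "definable_pred (\<lambda>z. f z \<in> X \<and> norm (f z - p) \<le> r1)" if "poly_map f" for f :: "'b::euclidean_space \<Rightarrow> real^'n"
      using definable_pred_vimage[OF definable_ball[of r1] that] r1 by simp
    have "definable_pred (\<lambda>z :: (real^'n) \<times> (real^'n). \<not> \<rho> * \<rho> \<le> (P (fst z) - P p) \<bullet> (P (fst z) - P p) \<and>
        (snd z \<in> X \<and> norm (snd z - p) \<le> r1) \<and> P (snd z) = P (fst z))"
      by (rule definable_pred_conj definable_pred_not ball1 definable_pred_eq definable_pred_le P' poly_map_inner poly_map_diff poly_map_id
          poly_map_const poly_map_fst poly_map_snd)+
    moreover have "(\<not> \<rho> * \<rho> \<le> (P x - P p) \<bullet> (P x - P p) \<and> (y \<in> X \<and> norm (y - p) \<le> r1) \<and> P y = P x) \<longleftrightarrow>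
        x \<in> B \<and> y = \<gamma> x" for x y
    proof -
      have "\<rho> * \<rho> \<le> (P x - P p) \<bullet> (P x - P p) \<longleftrightarrow> \<rho> \<le> norm (P x - P p)"
        using r1(3) abs_le_square_iff[of \<rho> "norm (P x - P p)"] by (simp add: dot_square_norm power2_eq_square)
      then show ?thesis using \<gamma>[of x] uniq[of x y] by (auto simp: B_def)
    qed
    ultimately show ?thesis unfolding definable_on_def by simp
  qed
  ultimately have holder_smooth_\<gamma>: "holder_smooth UNIV (Suc k) 1 \<gamma> B" by (rule definable_CH_Lipschitz[OF B, rotated])
  obtain I and L L' :: "real^'n \<Rightarrow> real^'n" where L: "card I = dim T0" "linear L" "linear L'"
    "\<And>x. L' (L x) = x" "\<And>y. L (L' y) = y"
    "\<And>x. x \<in> T0 \<Longrightarrow> L x \<in> coord_space I" "\<And>x. x \<in> orthogonal_comp T0 \<Longrightarrow> L x \<in> coord_space (- I)"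
    "\<And>y. y \<in> coord_space I \<Longrightarrow> L' y \<in> T0"
    using adapted_coordinates[OF T0(1)] by blast
  \<comment> \<open>The bound on the projection is part of \<open>U\<close>: it makes
    \<open>X \<inter> U\<close> a graph over the full open piece \<open>W\<close> of the coordinate
    subspace.\<close>
  define U where "U = {x. norm (x - p) < r1 \<and> norm (P x - P p) < \<rho>}"
  define W where "W = coord_space I \<inter> (L' -` B)"
  define g where "g y = L (\<gamma> (L' y) - P (\<gamma> (L' y)))" for y
  have bl: "bounded_linear L" "bounded_linear L'" "bounded_linear P"
    using L(2,3) linear_P by (simp_all add: linear_conv_bounded_linear)
  have openLB: "open (L' -` B)"
    using linear_continuous_on_compose[OF continuous_on_id L(3)] B by (metis open_vimage)
  show "graph_at (\<lambda>I. Ck_holder_on I (k + 1) 1) d X p"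
    unfolding graph_at_def
  proof (intro exI conjI)
    show "open U" unfolding U_def by (intro open_Collect_conj open_Collect_less continuous_intros contP)
    show "p \<in> U" using r1 by (simp add: U_def)
    show "linear L" by fact
    show "bij L" using L(4,5) by (metis bijI')
    show "card I = d" using L(1) dim_T0 by simp
    show openW: "openin (top_of_set (coord_space I)) W" unfolding W_def using openLB by (simp add: openin_open_Int)
    show "g ` W \<subseteq> coord_space (- I)"
      unfolding g_def P_def using L(7)[OF proj_matrix_compl[OF T0(1)]] by auto
    have CH1: "holder_smooth UNIV (Suc k) 1 (\<lambda>y. \<gamma> (L' y)) (L' -` B)"
    proof (rule holder_smooth_compose[OF B openLB _ _ _ _ holder_smooth_\<gamma>])
      show "holder_smooth UNIV (Suc k) 1 L' (L' -` B)" by (rule holder_smooth_subset[OF holder_smooth_affine[OF bl(2)]]) auto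
      then show "locally_holder_on 1 L' (L' -` B)" by (rule holder_smooth_locally_Lipschitz[OF openLB])
    qed auto
    have "holder_smooth UNIV (Suc k) 1 g (L' -` B)"
      unfolding g_def[abs_def]
      by (rule holder_smooth_linear[OF bl(1) openLB holder_smooth_diff[OF openLB CH1 holder_smooth_linear[OF bl(3) openLB CH1]]])
    then have "holder_smooth I (Suc k) 1 g W"
      by (rule holder_smooth_subset[OF holder_smooth_subset_index[OF _ subset_UNIV]]) (simp add: W_def)
    then show "Ck_holder_on I (k + 1) 1 g W" by (simp add: Ck_holder_on_iff_holder_smooth[OF openW])
    show "L ` (X \<inter> U) = (\<lambda>x. x + g x) ` W"
    proof (intro equalityI subsetI)
      fix y assume "y \<in> L ` (X \<inter> U)"
      then obtain x where x: "x \<in> X" "norm (x - p) < r1" "norm (P x - P p) < \<rho>" "y = L x" by (auto simp: U_def)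
      have PP: "P (P x) = P x" by (rule P_id[OF P_in])
      have "x = \<gamma> (P x)" using uniq[of "P x" x] x PP by simp
      then have "g (L (P x)) = L (x - P x)" by (simp add: g_def L(4))
      then have "y = L (P x) + g (L (P x))" using x(4) by (simp add: linear_add[OF L(2), symmetric])
      moreover have "L (P x) \<in> W" using L(6)[OF P_in] x PP by (simp add: W_def B_def L(4))
      ultimately show "y \<in> (\<lambda>x. x + g x) ` W" by blast
    next
      fix y' assume "y' \<in> (\<lambda>x. x + g x) ` W"
      then obtain y where y: "y \<in> coord_space I" "norm (P (L' y) - P p) < \<rho>" "y' = y + g y" by (auto simp: W_def B_def)
      note z = \<gamma>[OF y(2)]
      have "P (\<gamma> (L' y)) = L' y" using z P_id[OF L(8)[OF y(1)]] by simp
      then have "y' = L (\<gamma> (L' y))" using y(3) by (simp add: g_def linear_diff[OF L(2)] L(5))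
      moreover have "\<gamma> (L' y) \<in> X \<inter> U" using z y(2) by (simp add: U_def)
      ultimately show "y' \<in> L ` (X \<inter> U)" by blast
    qed
  qed
qed

end

section \<open>From a submanifold to the Nash transformation\<close>

lemma tangent_space_subset_C3_cone:
  fixes X :: "(real^'n) set"
  shows "tangent_space X q \<subseteq> C3_cone X q"
proof
  fix v assume "v \<in> tangent_space X q"
  then obtain \<gamma> \<epsilon> where \<gamma>: "0 < \<epsilon>" "\<gamma> ` {-\<epsilon><..<\<epsilon>} \<subseteq> X" "\<gamma> 0 = q" "(\<gamma> has_vector_derivative v) (at 0)"
    by (auto simp: tangent_space_def)
  \<comment> \<open>\<open>Suc (Suc j)\<close> keeps \<open>t j\<close> strictly below \<epsilon>,
    inside the domain of the curve, already for \<open>j = 0\<close>.\<close>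
  define t where "t j = \<epsilon> * (1 / real (Suc (Suc j)))" for j
  have t: "0 < t j" "t j < \<epsilon>" for j
    using \<gamma>(1) mult_strict_left_mono[of "1 / real (Suc (Suc j))" 1 \<epsilon>] by (simp_all add: t_def)
  have "t \<longlonglongrightarrow> \<epsilon> * 0"
    unfolding t_def using LIMSEQ_Suc[OF LIMSEQ_inverse_real_of_nat]
    by (intro tendsto_mult tendsto_const) (simp add: divide_inverse)
  then have t0: "t \<longlonglongrightarrow> 0" by simp
  then have "filterlim t (at 0) sequentially"
    using t(1) by (auto simp: filterlim_at less_imp_neq[symmetric] intro!: always_eventually)
  moreover have "((\<lambda>s. (1 / s) *\<^sub>R (\<gamma> s - q)) \<longlongrightarrow> v) (at 0)"
    using \<gamma>(3,4) by (simp add: has_vector_derivative_at_0_iff)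
  ultimately have "(\<lambda>j. (1 / t j) *\<^sub>R (\<gamma> (t j) - q)) \<longlonglongrightarrow> v"
    by (rule filterlim_compose[rotated])
  moreover have "\<gamma> (t j) \<in> X" for j using t[of j] \<gamma>(1,2) by (auto simp: image_subset_iff)
  ultimately show "v \<in> C3_cone X q"
    unfolding C3_cone_def using t(1) t0 by (intro CollectI exI[of _ "\<lambda>j. \<gamma> (t j)"] exI[of _ t]) auto
qed

text \<open>Near each of its points, a submanifold is the image of a retraction of constant rank.\<close>

locale local_retraction =
  fixes X :: "(real^'n) set" and d k :: nat and U B C :: "(real^'n) set" and G \<pi> :: "real^'n \<Rightarrow> real^'n"
  assumes U: "open U" and B: "open B" and sub: "X \<inter> U \<subseteq> B" and G_in: "\<And>x. x \<in> B \<Longrightarrow> G x \<in> X"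
    and G_id: "\<And>x. x \<in> X \<Longrightarrow> x \<in> U \<Longrightarrow> G x = x" and holder_smooth_G: "holder_smooth UNIV (Suc k) 1 G B"
    and \<pi>: "linear \<pi>" and C: "subspace C" and dim_C: "dim C = d" and \<pi>_in: "\<And>w. \<pi> w \<in> C"
    and \<pi>_id: "\<And>w. w \<in> C \<Longrightarrow> \<pi> w = w" and \<pi>_G: "\<And>x. x \<in> B \<Longrightarrow> \<pi> (G x) = \<pi> x"
    and G_\<pi>: "\<And>x y. x \<in> B \<Longrightarrow> y \<in> B \<Longrightarrow> \<pi> x = \<pi> y \<Longrightarrow> G x = G y"
begin

definition M :: "real^'n \<Rightarrow> real^'n^'n" where "M x = (\<chi> i j. partial_deriv j G x $ i)"

lemma M_mult: "M x *v h = (\<Sum>j\<in>UNIV. h $ j *\<^sub>R partial_deriv j G x)"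
  by (simp add: M_def matrix_vector_mult_def vec_eq_iff mult.commute)

lemma has_derivative_G: "x \<in> B \<Longrightarrow> (G has_derivative (\<lambda>h. M x *v h)) (at x)"
  unfolding M_mult by (rule holder_smooth_has_derivative[OF B holder_smooth_G])

lemma holder_smooth_M: "holder_smooth UNIV k 1 M B"
proof -
  define E where "E j v = (\<chi> i l. if l = j then v $ i else 0)" for j :: 'n and v :: "real^'n"
  have "linear (E j)" for j by (auto intro!: linearI simp: E_def vec_eq_iff)
  then have bl: "bounded_linear (E j)" for j by (simp add: linear_conv_bounded_linear)
  have "M x = (\<Sum>j\<in>UNIV. E j (partial_deriv j G x))" for x
    by (simp add: M_def E_def vec_eq_iff)
  then have "M = (\<lambda>x. \<Sum>j\<in>UNIV. E j (partial_deriv j G x))" by blast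
  moreover have "holder_smooth UNIV k 1 (\<lambda>x. \<Sum>j\<in>UNIV. E j (partial_deriv j G x)) B"
    using holder_smooth_G by (intro holder_smooth_sum[OF B] holder_smooth_linear[OF bl B]) simp
  ultimately show ?thesis by simp
qed

text \<open>Obtained by differentiating \<open>\<pi> (G x) = \<pi> x\<close> and the fact that
  \<open>G\<close> only depends on \<open>\<pi> x\<close>. Hence \<open>M x\<close> is injective on
  \<open>C\<close> and its range is the image of \<open>C\<close>, at every \<open>x \<in> B\<close>
  and not only on \<open>X\<close>: the rank is constant.\<close>

lemma M_\<pi>:
  assumes x: "x \<in> B"
  shows "M x *v \<pi> w = M x *v w" "\<pi> (M x *v w) = \<pi> w"
proof -
  have vd: "((\<lambda>t. G (x + t *\<^sub>R w)) has_vector_derivative M x *v w) (at 0)" for w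
  proof -
    have "((\<lambda>t. x + t *\<^sub>R w) has_vector_derivative w) (at 0)" by (auto intro!: derivative_eq_intros)
    from vector_derivative_diff_chain_within[OF this, of G "\<lambda>h. M x *v h"]
    show ?thesis using has_derivative_G[OF x] by (simp add: o_def has_derivative_at_withinI)
  qed
  have ev: "eventually (\<lambda>t. x + t *\<^sub>R w \<in> B) (nhds (0::real))" for w
  proof -
    have "continuous (at 0) (\<lambda>t. x + t *\<^sub>R w)" by (intro continuous_intros)
    then have "((\<lambda>t. x + t *\<^sub>R w) \<longlongrightarrow> x) (nhds (0::real))" by (simp add: continuous_at tendsto_nhds_iff)
    then show ?thesis using B x by (rule topological_tendstoD)
  qed
  have \<pi>_line: "\<pi> (x + t *\<^sub>R w) = \<pi> x + t *\<^sub>R \<pi> w" for t w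
    by (simp add: linear_add[OF \<pi>] linear_cmul[OF \<pi>])
  have "eventually (\<lambda>t. G (x + t *\<^sub>R \<pi> w) = G (x + t *\<^sub>R w)) (nhds (0::real))"
    using ev[of w] ev[of "\<pi> w"]
    by eventually_elim (rule G_\<pi>; simp add: \<pi>_line \<pi>_id[OF \<pi>_in])
  then have "((\<lambda>t. G (x + t *\<^sub>R \<pi> w)) has_vector_derivative M x *v w) (at 0) \<longleftrightarrow>
      ((\<lambda>t. G (x + t *\<^sub>R w)) has_vector_derivative M x *v w) (at 0)"
    by (intro has_vector_derivative_cong_ev) (auto elim: eventually_mono)
  then have "((\<lambda>t. G (x + t *\<^sub>R \<pi> w)) has_vector_derivative M x *v w) (at 0)" using vd[of w] by blast
  then show "M x *v \<pi> w = M x *v w" using vd[of "\<pi> w"] by (rule vector_derivative_unique_at[rotated])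
  have bl: "bounded_linear \<pi>" using \<pi> by (simp add: linear_conv_bounded_linear)
  have 1: "((\<lambda>t. \<pi> (G (x + t *\<^sub>R w))) has_vector_derivative \<pi> (M x *v w)) (at 0)"
    by (rule bounded_linear.has_vector_derivative[OF bl vd])
  have "eventually (\<lambda>t. \<pi> (G (x + t *\<^sub>R w)) = \<pi> x + t *\<^sub>R \<pi> w) (nhds (0::real))"
    using ev[of w] by eventually_elim (simp add: \<pi>_G \<pi>_line)
  then have "((\<lambda>t. \<pi> (G (x + t *\<^sub>R w))) has_vector_derivative \<pi> w) (at 0) \<longleftrightarrow>
      ((\<lambda>t. \<pi> x + t *\<^sub>R \<pi> w) has_vector_derivative \<pi> w) (at 0)"
    using \<pi>_G[OF x] by (intro has_vector_derivative_cong_ev) (auto elim: eventually_mono)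
  moreover have "((\<lambda>t. \<pi> x + t *\<^sub>R \<pi> w) has_vector_derivative \<pi> w) (at 0)" by (auto intro!: derivative_eq_intros)
  ultimately have "((\<lambda>t. \<pi> (G (x + t *\<^sub>R w))) has_vector_derivative \<pi> w) (at 0)" by blast
  with 1 show "\<pi> (M x *v w) = \<pi> w" by (rule vector_derivative_unique_at)
qed

lemma M_inj: "x \<in> B \<Longrightarrow> w \<in> C \<Longrightarrow> M x *v w = 0 \<Longrightarrow> w = 0"
  using M_\<pi>(2)[of x w] \<pi>_id[of w] linear_0[OF \<pi>] by simp

text \<open>The circle of inclusions: images of \<open>C\<close> are velocities of the curves
  \<open>G (q + t *\<^sub>R w)\<close>, velocities lie in \<open>C3_cone\<close>, and vectors of
  \<open>C3_cone\<close> are fixed by \<open>M q\<close> because points of \<open>X\<close> near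
  \<open>q\<close> are fixed by \<open>G\<close>.\<close>

lemma tangent_cones:
  assumes q: "q \<in> X" "q \<in> U"
  shows "tangent_space X q = (\<lambda>v. M q *v v) ` C" "C3_cone X q = (\<lambda>v. M q *v v) ` C"
proof -
  have qB: "q \<in> B" using q sub by blast
  have "(\<lambda>v. M q *v v) ` C \<subseteq> tangent_space X q"
  proof
    fix v assume "v \<in> (\<lambda>v. M q *v v) ` C"
    then obtain w where w: "v = M q *v w" by blast
    obtain r where r: "r > 0" "ball q r \<subseteq> B" using B qB by (rule openE)
    define \<epsilon> where "\<epsilon> = r / (norm w + 1)"
    have \<epsilon>: "\<epsilon> > 0" using r by (auto simp: \<epsilon>_def intro!: divide_pos_pos add_nonneg_pos)
    have inB: "q + t *\<^sub>R w \<in> B" if "t \<in> {-\<epsilon><..<\<epsilon>}" for t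
    proof -
      have "\<bar>t\<bar> * norm w \<le> \<bar>t\<bar> * (norm w + 1)" by (intro mult_left_mono) auto
      also have "\<dots> < \<epsilon> * (norm w + 1)"
        using that by (intro mult_strict_right_mono) (auto simp: add_nonneg_pos)
      also have "\<dots> = r" using add_nonneg_pos[OF norm_ge_zero[of w] zero_less_one] by (simp add: \<epsilon>_def)
      finally show ?thesis using r(2) by (auto simp: dist_norm subset_eq)
    qed
    have vd: "((\<lambda>t. G (q + t *\<^sub>R w)) has_vector_derivative M (q + t *\<^sub>R w) *v w) (at t)"
      if "t \<in> {-\<epsilon><..<\<epsilon>}" for t
    proof -
      have "((\<lambda>t. q + t *\<^sub>R w) has_vector_derivative w) (at t)" by (auto intro!: derivative_eq_intros)
      from vector_derivative_diff_chain_within[OF this, of G "\<lambda>h. M (q + t *\<^sub>R w) *v h"]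
      show ?thesis using has_derivative_G[OF inB[OF that]] by (simp add: o_def has_derivative_at_withinI)
    qed
    have contM: "continuous_on {-\<epsilon><..<\<epsilon>} (\<lambda>t. M (q + t *\<^sub>R w))"
      by (rule continuous_on_compose2[OF holder_smooth_continuous[OF holder_smooth_M]]) (use inB in \<open>auto intro!: continuous_intros\<close>)
    have "continuous_on {-\<epsilon><..<\<epsilon>} (\<lambda>t. M (q + t *\<^sub>R w) *v w)"
      by (rule bounded_bilinear.continuous_on[OF bounded_bilinear_matrix_vector_mult contM continuous_on_const])
    then have "(\<lambda>t. G (q + t *\<^sub>R w)) C1_differentiable_on {-\<epsilon><..<\<epsilon>}"
      unfolding C1_differentiable_on_def using vd by (intro exI[of _ "\<lambda>t. M (q + t *\<^sub>R w) *v w"]) simp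
    moreover have "(\<lambda>t. G (q + t *\<^sub>R w)) ` {-\<epsilon><..<\<epsilon>} \<subseteq> X" using inB G_in by blast
    moreover have "((\<lambda>t. G (q + t *\<^sub>R w)) has_vector_derivative v) (at 0)" using vd[of 0] \<epsilon> w by simp
    ultimately show "v \<in> tangent_space X q"
      unfolding tangent_space_def using \<epsilon> G_id[OF q]
      by (intro CollectI exI[of _ "\<lambda>t. G (q + t *\<^sub>R w)"] exI[of _ \<epsilon>]) simp
  qed
  moreover note tangent_space_subset_C3_cone[of X q]
  moreover have "C3_cone X q \<subseteq> (\<lambda>v. M q *v v) ` C"
  proof
    fix v assume "v \<in> C3_cone X q"
    then obtain x t where x: "\<And>j::nat. x j \<in> X" "\<And>j. t j > 0" "t \<longlonglongrightarrow> 0"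
      "(\<lambda>j. (1 / t j) *\<^sub>R (x j - q)) \<longlonglongrightarrow> v" by (auto simp: C3_cone_def)
    define u where "u j = (1 / t j) *\<^sub>R (x j - q)" for j
    have xu: "x j - q = t j *\<^sub>R u j" for j using x(2)[of j] by (simp add: u_def)
    have u: "u \<longlonglongrightarrow> v" using x(4) by (simp add: u_def[abs_def])
    have "(\<lambda>j. q + t j *\<^sub>R u j) \<longlonglongrightarrow> q + 0 *\<^sub>R v" by (intro tendsto_intros x u)
    then have xq: "x \<longlonglongrightarrow> q" by (simp add: xu[symmetric])
    have "norm (v - M q *v v) \<le> e * norm v" if "e > 0" for e
    proof -
      obtain \<delta> where \<delta>: "\<delta> > 0"
        "\<And>y. norm (y - q) < \<delta> \<Longrightarrow> norm (G y - G q - M q *v (y - q)) \<le> e * norm (y - q)"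
        using has_derivative_G[OF qB] \<open>e > 0\<close> unfolding has_derivative_at_alt by blast
      have "eventually (\<lambda>j. x j \<in> U) sequentially" using topological_tendstoD[OF xq U q(2)] .
      moreover have "eventually (\<lambda>j. norm (x j - q) < \<delta>) sequentially" using tendstoD[OF xq \<delta>(1)] by (simp add: dist_norm)
      ultimately have "eventually (\<lambda>j. norm (u j - M q *v u j) \<le> e * norm (u j)) sequentially"
      proof eventually_elim
        case (elim j)
        have "norm (x j - q - M q *v (x j - q)) \<le> e * norm (x j - q)"
          using \<delta>(2)[OF elim(2)] G_id[OF x(1) elim(1)] G_id[OF q] by simp
        moreover have "x j - q - M q *v (x j - q) = t j *\<^sub>R (u j - M q *v u j)"
          by (simp add: xu matrix_vector_mult_scaleR scaleR_diff_right)
        ultimately have "t j * norm (u j - M q *v u j) \<le> t j * (e * norm (u j))"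
          using x(2)[of j] by (simp add: xu mult_ac)
        then show ?case using x(2)[of j] by simp
      qed
      moreover have "(\<lambda>j. norm (u j - M q *v u j)) \<longlonglongrightarrow> norm (v - M q *v v)"
        by (intro tendsto_norm tendsto_diff u bounded_linear.tendsto[OF matrix_vector_mul_bounded_linear])
      moreover have "(\<lambda>j. e * norm (u j)) \<longlonglongrightarrow> e * norm v" by (intro tendsto_intros u)
      ultimately show ?thesis by (intro tendsto_le[OF sequentially_bot])
    qed
    \<comment> \<open>The previous bound is used with \<open>e / (norm v + 1)\<close>; the summand 1
      covers the case \<open>v = 0\<close>.\<close>
    then have "norm (v - M q *v v) \<le> 0 + e" if "e > 0" for e
      using that \<open>\<And>e. e > 0 \<Longrightarrow> norm (v - M q *v v) \<le> e * norm v\<close>[of "e / (norm v + 1)"]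
      by (smt (verit) divide_pos_pos mult_left_mono nonzero_eq_divide_eq norm_ge_zero)
    then have "norm (v - M q *v v) \<le> 0" by (rule field_le_epsilon)
    then have "v = M q *v \<pi> v" using M_\<pi>(1)[OF qB, of v] by simp
    then show "v \<in> (\<lambda>v. M q *v v) ` C" using \<pi>_in by blast
  qed
  ultimately show "tangent_space X q = (\<lambda>v. M q *v v) ` C" "C3_cone X q = (\<lambda>v. M q *v v) ` C" by auto
qed

lemma tangent_space_in_Gr:
  assumes q: "q \<in> X" "q \<in> U"
  shows "tangent_space X q \<in> Gr d"
proof -
  have qB: "q \<in> B" using q sub by blast
  have lin: "linear (\<lambda>v. M q *v v)" by (rule matrix_vector_mul_linear)
  have inj: "inj_on (\<lambda>v. M q *v v) C"
  proof (rule inj_onI)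
    fix v w assume vw: "v \<in> C" "w \<in> C" "M q *v v = M q *v w"
    have "v - w = 0"
      by (rule M_inj[OF qB subspace_diff[OF C vw(1,2)]]) (simp add: matrix_vector_mult_diff_distrib vw(3))
    then show "v = w" by simp
  qed
  have "dim ((\<lambda>v. M q *v v) ` C) = dim C"
    using inj by (intro dim_image_eq[OF lin]) (simp add: span_eq_iff[THEN iffD2, OF C])
  then show ?thesis
    unfolding tangent_cones[OF q] Gr_def using linear_subspace_image[OF lin C] dim_C by simp
qed

text \<open>The planes are images of the fixed \<open>C\<close> under a smooth family of matrices,
  defined also off \<open>X\<close>. This produces the ambient extension of the Gauss
  mapping.\<close>

lemma chart_at:
  assumes p: "p \<in> X" "p \<in> U"
  obtains V where "open V" "p \<in> V"
    "\<And>x. x \<in> V \<Longrightarrow> \<exists>A. chart_matrix (tangent_space X p) A \<and> (\<lambda>v. M x *v v) ` C = graph_over (tangent_space X p) A"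
    "holder_smooth UNIV k 1 (\<lambda>x. Gr_chart (tangent_space X p) ((\<lambda>v. M x *v v) ` C)) V"
proof -
  have pB: "p \<in> B" using p sub by blast
  have T: "subspace (tangent_space X p)" "dim (tangent_space X p) = d"
    using tangent_space_in_Gr[OF p] by (auto simp: Gr_def)
  have tr: "v = 0" if "v \<in> C" "M p *v v \<in> orthogonal_comp (tangent_space X p)" for v
  proof -
    have "M p *v v \<in> tangent_space X p" using that tangent_cones(1)[OF p] by blast
    then have "M p *v v = 0" using that(2) by (rule orthogonal_comp_Int)
    then show ?thesis by (rule M_inj[OF pB that(1)])
  qed
  show ?thesis
    by (rule holder_smooth_Gr_chart_image[OF B pB holder_smooth_M order_refl T(1) C]) (use T dim_C tr that in auto)
qed

end

text \<open>In graph coordinates, \<open>G\<close> forgets the complementary coordinates and returns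
  to the graph. \<open>B\<close> is the full cylinder over \<open>W\<close>, hence open in the whole
  space, while \<open>U\<close> limits the points of \<open>X\<close> known to be fixed.
  \<open>C\<close> is the coordinate subspace in the original coordinates.\<close>

lemma submanifold_local_retraction:
  fixes X :: "(real^'n) set"
  assumes "graph_at (\<lambda>I. Ck_holder_on I (k + 1) 1) d X p"
  obtains U B C G \<pi> where "p \<in> U" "local_retraction X d k U B C G \<pi>"
proof -
  obtain U and L :: "real^'n \<Rightarrow> real^'n" and I W g where U: "open U" "p \<in> U" "linear L" "bij L" "card I = d"
    "openin (top_of_set (coord_space I)) W" "Ck_holder_on I (k + 1) 1 g W" "g ` W \<subseteq> coord_space (- I)"
    "L ` (X \<inter> U) = (\<lambda>x. x + g x) ` W"
    using assms unfolding graph_at_def by (elim exE conjE) (rule that)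
  define L' where "L' = inv L"
  have L': "L' (L x) = x" "L (L' x) = x" for x
    using U(4) by (auto simp: L'_def bij_is_inj bij_is_surj surj_f_inv_f)
  have linL': "linear L'"
    unfolding L'_def using U(3,4) by (intro inj_linear_imp_inv_linear) (auto simp: bij_is_inj)
  note lin\<pi> = linear_coord_proj[of I]
  have bl: "bounded_linear L" "bounded_linear L'" "bounded_linear (coord_proj I)"
    using U(3) linL' lin\<pi> by (simp_all add: linear_conv_bounded_linear)
  define B where "B = L -` (coord_proj I -` W)"
  define \<pi> where "\<pi> x = L' (coord_proj I (L x))" for x
  define G where "G x = L' (coord_proj I (L x) + g (coord_proj I (L x)))" for x
  have W: "w \<in> coord_space I" "coord_proj I (w + g w) = w" if "w \<in> W" for w
  proof -
    show w: "w \<in> coord_space I" using U(6) that openin_imp_subset by blast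
    have "g w \<in> coord_space (- I)" using U(8) that by blast
    then show "coord_proj I (w + g w) = w" using w by (simp add: linear_add[OF lin\<pi>])
  qed
  have LG: "L (G x) = coord_proj I (L x) + g (coord_proj I (L x))" for x by (simp add: G_def L'(2))
  have inj: "inj_on L' (coord_space I)" by (rule inj_on_inverseI[of _ L]) (rule L'(2))
  have openW: "open (coord_proj I -` W)" by (rule open_vimage_coord_proj[OF U(6)])
  have openB: "open B"
    unfolding B_def using linear_continuous_on_compose[OF continuous_on_id U(3)] openW by (metis open_vimage)
  show ?thesis
  proof (rule that[OF U(2)], unfold_locales)
    show "open U" by (rule U(1))
    show "open B" by (rule openB)
    show "X \<inter> U \<subseteq> B"
    proof
      fix x assume "x \<in> X \<inter> U"
      then obtain w where "w \<in> W" "L x = w + g w" using U(9) by blast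
      then show "x \<in> B" using W by (simp add: B_def)
    qed
    show "G x \<in> X" if "x \<in> B" for x
    proof -
      have "L (G x) \<in> L ` (X \<inter> U)" using that unfolding LG U(9) by (auto simp: B_def)
      then show ?thesis using L'(1) by (metis IntD1 imageE)
    qed
    show "G x = x" if "x \<in> X" "x \<in> U" for x
    proof -
      have "L x \<in> (\<lambda>x. x + g x) ` W" using that U(9) by blast
      then obtain w where "w \<in> W" "L x = w + g w" by blast
      then show ?thesis using W(2)[of w] L'(1)[of x] by (simp add: G_def)
    qed
    show "holder_smooth UNIV (Suc k) 1 G B"
    proof -
      have "holder_smooth I (Suc k) 1 g W" using U(7) by (simp add: Ck_holder_on_iff_holder_smooth[OF U(6)])
      then have 1: "holder_smooth UNIV (Suc k) 1 (\<lambda>x. g (coord_proj I x)) (coord_proj I -` W)"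
        by (rule holder_smooth_extend[OF U(6)]) simp
      have 2: "holder_smooth UNIV (Suc k) 1 L B" by (rule holder_smooth_subset[OF holder_smooth_affine[OF bl(1)]]) auto
      have 3: "holder_smooth UNIV (Suc k) 1 (\<lambda>x. g (coord_proj I (L x))) B"
        by (rule holder_smooth_compose[OF openW openB _ _ _ holder_smooth_locally_Lipschitz[OF openB 2] 1 2]) (auto simp: B_def)
      show ?thesis
        unfolding G_def[abs_def]
        by (rule holder_smooth_linear[OF bl(2) openB holder_smooth_add[OF openB holder_smooth_linear[OF bl(3) openB 2] 3]])
    qed
    show "\<pi> (x + y) = \<pi> x + \<pi> y" "\<pi> (c *\<^sub>R x) = c *\<^sub>R \<pi> x" for x y c
      by (simp_all add: \<pi>_def linear_add[OF U(3)] linear_add[OF lin\<pi>] linear_add[OF linL']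
          linear_cmul[OF U(3)] linear_cmul[OF lin\<pi>] linear_cmul[OF linL'])
    show "subspace (L' ` coord_space I)" by (rule linear_subspace_image[OF linL' subspace_coord_space])
    show "dim (L' ` coord_space I) = d"
      using inj U(5) dim_image_eq[OF linL', of "coord_space I"]
      by (simp add: dim_coord_space span_eq_iff[THEN iffD2, OF subspace_coord_space])
    show "\<pi> w \<in> L' ` coord_space I" for w unfolding \<pi>_def by (intro imageI coord_proj_in)
    show "\<pi> w = w" if "w \<in> L' ` coord_space I" for w using that by (auto simp: \<pi>_def L'(2))
    show "\<pi> (G x) = \<pi> x" if "x \<in> B" for x
      unfolding \<pi>_def LG using W(2)[of "coord_proj I (L x)"] that by (simp add: B_def)
    show "G x = G y" if "\<pi> x = \<pi> y" for x y
    proof -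
      have "coord_proj I (L x) = coord_proj I (L y)" using that inj by (auto simp: \<pi>_def inj_on_def)
      then show ?thesis by (simp add: G_def)
    qed
  qed
qed

text \<open>Near each \<open>p\<close>, the images of \<open>C\<close> under the derivative of the
  retraction form a family \<open>D\<close> of planes on an open set that is of class C^(k,1) and
  restricts to the Gauss mapping. Its continuity shows that the closure adds no planes; its
  regularity gives that of the inverse Nash mapping.\<close>

lemma submanifold_imp_nash:
  fixes X :: "(real^'n) set"
  assumes sub: "Ck_holder_submanifold (k + 1) 1 d X"
  shows "C3_C4_coincide_linearly d X"
    and "homeomorphic_map (nash_topology d X) (top_of_set X) nash_map"
    and "0 < \<alpha> \<Longrightarrow> \<alpha> < 1 \<Longrightarrow> Ck_holder_into_Gr_on_subset d k \<alpha> (nash_inverse d X) X"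
proof -
  let ?T = "tangent_space X"
  \<comment> \<open>Order \<open>k + 1\<close> is at least 1, so no point is singular and the
    closure is taken over the Gauss graph of all of \<open>X\<close>.\<close>
  have "graph_at (\<lambda>I. Ck_on I 1) d X p" if "p \<in> X" for p
  proof -
    have "Ck_on I 1 g W" if "Ck_holder_on I (k + 1) 1 g W" for I and g :: "real^'n \<Rightarrow> real^'n" and W
      using that by (auto simp: Ck_holder_on_def Ck_on_def)
    then show ?thesis
      using sub that unfolding Ck_holder_submanifold_def graph_at_def by meson
  qed
  then have Sing: "Sing1 X = {}" by (auto simp: Sing1_def)
  have retr: "\<exists>U B C G \<pi>. p \<in> U \<and> local_retraction X d k U B C G \<pi>" if "p \<in> X" for p
    using submanifold_local_retraction sub that unfolding Ck_holder_submanifold_def by metis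
  have T_Gr: "?T p \<in> Gr d" and C3: "C3_cone X p = ?T p" if p: "p \<in> X" for p
  proof -
    obtain U B C G \<pi> where "p \<in> U" and l: "local_retraction X d k U B C G \<pi>" using retr[OF p] by blast
    show "?T p \<in> Gr d" by (rule local_retraction.tangent_space_in_Gr[OF l p \<open>p \<in> U\<close>])
    show "C3_cone X p = ?T p" using local_retraction.tangent_cones[OF l p \<open>p \<in> U\<close>] by simp
  qed
  have chart: "\<exists>V D. open V \<and> p \<in> V \<and>
      (\<forall>x\<in>V. \<exists>A. chart_matrix (?T p) A \<and> D x = graph_over (?T p) A) \<and>
      holder_smooth UNIV k 1 (\<lambda>x. Gr_chart (?T p) (D x)) V \<and> (\<forall>x\<in>X \<inter> V. D x = ?T x)" if p: "p \<in> X" for p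
  proof -
    obtain U B C G \<pi> where "p \<in> U" and l: "local_retraction X d k U B C G \<pi>" using retr[OF p] by blast
    interpret local_retraction X d k U B C G \<pi> by (rule l)
    obtain V where V: "open V" "p \<in> V"
      "\<And>x. x \<in> V \<Longrightarrow> \<exists>A. chart_matrix (?T p) A \<and> (\<lambda>v. M x *v v) ` C = graph_over (?T p) A"
      "holder_smooth UNIV k 1 (\<lambda>x. Gr_chart (?T p) ((\<lambda>v. M x *v v) ` C)) V"
      using chart_at[OF p \<open>p \<in> U\<close>] by blast
    show ?thesis
    proof (intro exI[of _ "V \<inter> U"] exI[of _ "\<lambda>x. (\<lambda>v. M x *v v) ` C"] conjI ballI)
      show "holder_smooth UNIV k 1 (\<lambda>x. Gr_chart (?T p) ((\<lambda>v. M x *v v) ` C)) (V \<inter> U)"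
        by (rule holder_smooth_subset[OF V(4)]) simp
      show "(\<lambda>v. M x *v v) ` C = ?T x" if "x \<in> X \<inter> (V \<inter> U)" for x
        using tangent_cones(1)[of x] that by simp
    qed (use V U \<open>p \<in> U\<close> in auto)
  qed
  have cont: "continuous_on X (\<lambda>x. proj_matrix (?T x))"
    unfolding continuous_on_eq_continuous_within
  proof
    fix p assume p: "p \<in> X"
    obtain V D where V: "open V" "p \<in> V" "\<And>x. x \<in> V \<Longrightarrow> \<exists>A. chart_matrix (?T p) A \<and> D x = graph_over (?T p) A"
      "holder_smooth UNIV k 1 (\<lambda>x. Gr_chart (?T p) (D x)) V" "\<And>x. x \<in> X \<Longrightarrow> x \<in> V \<Longrightarrow> D x = ?T x"
      using chart[OF p] by (metis IntI)
    have T0: "subspace (?T p)" using T_Gr[OF p] by (simp add: Gr_def)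
    have A: "chart_matrix (?T p) (Gr_chart (?T p) (D x)) \<and> graph_over (?T p) (Gr_chart (?T p) (D x)) = D x" if "x \<in> V" for x
      using V(3)[OF that] Gr_chart_graph_over[OF T0] by metis
    have "continuous_on V (\<lambda>x. proj_matrix (graph_over (?T p) (Gr_chart (?T p) (D x))))"
      using A by (intro continuous_on_proj_matrix_graph_over[OF T0 _ holder_smooth_continuous[OF V(4)]]) blast
    then have "continuous_on (X \<inter> V) (\<lambda>x. proj_matrix (graph_over (?T p) (Gr_chart (?T p) (D x))))"
      by (rule continuous_on_subset) simp
    moreover have "proj_matrix (graph_over (?T p) (Gr_chart (?T p) (D x))) = proj_matrix (?T x)" if "x \<in> X \<inter> V" for x
      using A[of x] V(5)[of x] that by (metis IntD1 IntD2)
    ultimately have "continuous_on (X \<inter> V) (\<lambda>x. proj_matrix (?T x))"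
      using continuous_on_cong[OF refl] by (metis (no_types, lifting))
    then have "continuous (at p within X \<inter> V) (\<lambda>x. proj_matrix (?T x))"
      using p V(2) by (simp add: continuous_on_eq_continuous_within)
    then show "continuous (at p within X) (\<lambda>x. proj_matrix (?T x))"
      using at_within_nhd[OF V(2,1), of "X \<inter> V" X] by (simp add: Int_assoc)
  qed
  \<comment> \<open>The graph of a continuous map is closed: a plane in the closure over
    \<open>p\<close> has distance at most \<open>e\<close> from the tangent space for every
    \<open>e > 0\<close>.\<close>
  have N_iff: "(p, T) \<in> nash_transformation d X \<longleftrightarrow> p \<in> X \<and> T = ?T p" for p T
  proof
    assume N: "(p, T) \<in> nash_transformation d X"
    then have p: "p \<in> X" and T: "T \<in> Gr d" by (auto simp: in_nash_transformation_iff)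
    have "dist (proj_matrix T) (proj_matrix (?T p)) \<le> 0 + e" if "e > 0" for e
    proof -
      obtain \<delta> where \<delta>: "\<delta> > 0" "\<And>x. x \<in> X \<Longrightarrow> dist x p < \<delta> \<Longrightarrow> dist (proj_matrix (?T x)) (proj_matrix (?T p)) < e / 2"
        using cont p half_gt_zero[OF \<open>e > 0\<close>] unfolding continuous_on_iff by metis
      obtain x where "x \<in> X" "dist x p < min \<delta> (e / 2)" "dist (proj_matrix (?T x)) (proj_matrix T) < min \<delta> (e / 2)"
        using N \<delta>(1) \<open>e > 0\<close> unfolding in_nash_transformation_iff Sing
        by (metis Diff_empty half_gt_zero min_less_iff_conj)
      then have "dist (proj_matrix (?T x)) (proj_matrix (?T p)) < e / 2" "dist (proj_matrix (?T x)) (proj_matrix T) < e / 2"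
        using \<delta>(2) by auto
      then show ?thesis using dist_triangle_half_r[of "proj_matrix (?T x)" "proj_matrix T" e "proj_matrix (?T p)"] by simp
    qed
    then have "dist (proj_matrix T) (proj_matrix (?T p)) \<le> 0" by (rule field_le_epsilon)
    then have "T = ?T p" using T T_Gr[OF p] by (intro proj_matrix_inj) (auto simp: Gr_def)
    then show "p \<in> X \<and> T = ?T p" using p by simp
  next
    assume "p \<in> X \<and> T = ?T p"
    then show "(p, T) \<in> nash_transformation d X"
      using T_Gr unfolding in_nash_transformation_iff Sing by (metis Diff_empty dist_self)
  qed
  show "C3_C4_coincide_linearly d X"
    unfolding C3_C4_coincide_linearly_def using C3 by (simp add: C4_cone_eq_Union_nash N_iff)
  show hom: "homeomorphic_map (nash_topology d X) (top_of_set X) nash_map"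
  proof -
    have "continuous_map (nash_topology d X) (top_of_set X) fst"
      unfolding nash_topology_def by (intro continuous_map_from_subtopology continuous_map_fst)
    moreover have "continuous_map (top_of_set X) (nash_topology d X) (\<lambda>x. (x, ?T x))"
      unfolding nash_topology_def continuous_map_in_subtopology
    proof
      have "continuous_map (top_of_set X) (Gr_topology d) ?T"
        by (rule continuous_map_Gr_topology) (use T_Gr cont in auto)
      then show "continuous_map (top_of_set X) (prod_topology (top_of_set X) (Gr_topology d)) (\<lambda>x. (x, ?T x))"
        by (simp add: continuous_map_pairwise o_def continuous_map_id[unfolded id_def])
    qed (auto simp: N_iff)
    moreover have "topspace (nash_topology d X) \<subseteq> nash_transformation d X"
      by (auto simp: nash_topology_def)
    then have "(fst z, ?T (fst z)) = z" if "z \<in> topspace (nash_topology d X)" for z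
      using that N_iff[of "fst z" "snd z"] by (metis prod.collapse subsetD)
    ultimately have "homeomorphic_maps (nash_topology d X) (top_of_set X) fst (\<lambda>x. (x, ?T x))"
      unfolding homeomorphic_maps_def by simp
    then show ?thesis unfolding nash_map_def homeomorphic_map_maps by blast
  qed
  have inverse: "nash_inverse d X x = (x, ?T x)" if "x \<in> X" for x
    using nash_inverse_eq[OF hom that] nash_fibre[OF hom that, of "?T x"] N_iff that by simp
  assume \<alpha>: "0 < \<alpha>" "\<alpha> < 1"
  show "Ck_holder_into_Gr_on_subset d k \<alpha> (nash_inverse d X) X"
    unfolding Ck_holder_into_Gr_on_subset_def
  proof
    fix p assume p: "p \<in> X"
    obtain V D where V: "open V" "p \<in> V" "\<And>x. x \<in> V \<Longrightarrow> \<exists>A. chart_matrix (?T p) A \<and> D x = graph_over (?T p) A"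
      "holder_smooth UNIV k 1 (\<lambda>x. Gr_chart (?T p) (D x)) V" "\<And>x. x \<in> X \<Longrightarrow> x \<in> V \<Longrightarrow> D x = ?T x"
      using chart[OF p] by (metis IntI)
    have T0: "subspace (?T p)" using T_Gr[OF p] by (simp add: Gr_def)
    have dom: "D x \<in> Gr_chart_domain (?T p)" if "x \<in> V" for x
      using V(3)[OF that] graph_over_in_Gr_chart_domain[OF T0] by metis
    \<comment> \<open>Exponent 1 is lowered to \<alpha>; the point itself enters as an affine
      component.\<close>
    have "holder_smooth UNIV k \<alpha> (\<lambda>x. (x, Gr_chart (?T p) (D x))) V"
      using \<alpha> by (intro holder_smooth_Pair[OF V(1)] holder_smooth_mono_exponent[OF V(4)] holder_smooth_subset[OF holder_smooth_affine[OF bounded_linear_ident]]) auto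
    then have "Ck_holder_on UNIV k \<alpha> (\<lambda>x. (fst (x, D x), Gr_chart (?T p) (snd (x, D x)))) V"
      using V(1) by (simp add: Ck_holder_on_iff_holder_smooth)
    then have "Ck_holder_into_Gr d k \<alpha> (\<lambda>x. (x, D x)) V"
      unfolding Ck_holder_into_Gr_def using V(1) T_Gr[OF p] dom
      by (intro ballI exI[of _ V] exI[of _ "?T p"]) auto
    then show "\<exists>U F. open U \<and> p \<in> U \<and> Ck_holder_into_Gr d k \<alpha> F U \<and> (\<forall>x\<in>X \<inter> U. F x = nash_inverse d X x)"
      using V inverse by (intro exI[of _ V] exI[of _ "\<lambda>x. (x, D x)"]) auto
  qed
qed

theorem corollary3p2:
  fixes S :: "nat \<Rightarrow> real list set set"
    and X :: "(real^'n) set"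
    and d k :: nat
  assumes "polynomially_bounded_o_minimal S"
    and "locally_closed_set X"
    and "pure_dimensional S d X"
    and "locally_definable S X"
  shows "Ck_holder_submanifold (k + 1) 1 d X \<longleftrightarrow>
    C3_C4_coincide_linearly d X \<and>
    homeomorphic_map (nash_topology d X) (top_of_set X) nash_map \<and>
    (\<forall>\<alpha>. 0 < \<alpha> \<and> \<alpha> < 1 \<longrightarrow> Ck_holder_into_Gr_on_subset d k \<alpha> (nash_inverse d X) X)"
  using submanifold_imp_nash[of k d X]
    polynomially_bounded_o_minimal.nash_imp_submanifold[OF assms(1,2,4), of d k]
  by blast

end
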